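(* Let $\mathbf K$ be a compactly generated monoidal triangulated category and let $\sigma:\mathbf K\to\mathcal X$ be an extended weak support datum for a Zariski space $X$ such that $\Phi_\sigma(\langle C\rangle)$ is closed for every compact object $C$. Assume that $\sigma$ satisfies the following two properties. (Faithfulness) For all $M\in\mathbf K$: $\Phi_\sigma(\langle\!\langle M\rangle\!\rangle)=\varnothing$ if and only if $M=0$. (Realization) For every closed $W\subseteq X$ there exists $M\in\mathbf K^c$ such that $\Phi_\sigma(\langle M\rangle)=W$. Then: (a) The map $\Phi_\sigma:\mathrm{ThickId}(\mathbf K^c)\to\mathcal X_{sp}$ is an isomorphism of ordered monoids, where $\mathrm{ThickId}(\mathbf K^c)$ is equipped with the operation $\mathbf I,\mathbf J\mapsto\langle\mathbf I\otimes\mathbf J\rangle$ and the inclusion partial order, and $\mathcal X_{sp}$ is equipped with the operation of intersection and the inclusion partial order. (b) The map $f_\sigma:X\to\mathrm{Spc}\,\mathbf K^c$ given by $f_\sigma(x)=\{A\in\mathbf K^c: x\notin\Phi_\sigma(\langle A\rangle)\}$ for $x\in X$ is a homeomorphism.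
   Context: A monoidal triangulated category (M$\Delta$C) is a monoidal category (unit $1$) which is also triangulated (shift $\Sigma$) with $\otimes$ an exact bifunctor; no symmetry or braiding is assumed. An M$\Delta$C $\mathbf K$ is compactly generated if it has arbitrary set-indexed coproducts, $\otimes$ preserves set-indexed coproducts, $\mathbf K$ is compactly generated as a triangulated category (isomorphism classes of compact objects form a set, and for every nonzero $M$ there is a compact $C$ with $\mathbf K(C,M)\ne0$), the tensor product of compact objects is compact, $1$ is compact, and every compact object is rigid (has left and right duals). $\mathbf K^c$ is the full subcategory of compact objects; it is itself an M$\Delta$C. A thick (two-sided) ideal of an M$\Delta$C is a full triangulated subcategory closed under direct summands and under left and right tensoring with arbitrary objects. For $\mathcal S\subseteq\mathbf K^c$, $\langle\mathcal S\rangle$ is the smallest thick ideal of $\mathbf K^c$ containing $\mathcal S$; for $\mathcal S\subseteq\mathbf K$, $\langle\!\langle\mathcal S\rangle\!\rangle$ is the smallest thick ideal of $\mathbf K$ containing $\mathcal S$. $\mathrm{ThickId}(\mathbf K^c)$ is the set of thick ideals of $\mathbf K^c$. $\mathbf I\otimes\mathbf J=\{A\otimes B:A\in\mathbf I,B\in\mathbf J\}$. A prime ideal is a proper thick ideal $\mathbf P$ with $\mathbf I\otimes\mathbf J\subseteq\mathbf P\Rightarrow\mathbf I\subseteq\mathbf P$ or $\mathbf J\subseteq\mathbf P$ for all thick ideals $\mathbf I,\mathbf J$. $\mathrm{Spc}\,\mathbf K^c$ is the set of prime ideals of $\mathbf K^c$ with closed sets $V(\mathcal S)=\{\mathbf P:\mathbf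 P\cap\mathcal S=\varnothing\}$, $\mathcal S\subseteq\mathbf K^c$. A Zariski space is a Noetherian topological space in which every irreducible closed set has a unique generic point. $\mathcal X$ is the set of all subsets of $X$, and $\mathcal X_{sp}$ the set of specialization closed subsets (arbitrary unions of closed subsets). For $\sigma:\mathbf K\to\mathcal X$ and a collection $\mathcal S$ of objects, $\Phi_\sigma(\mathcal S)=\bigcup_{A\in\mathcal S}\sigma(A)$. An extended weak support datum is a map $\sigma:\mathbf K\to\mathcal X$ such that: (i) $\sigma(0)=\varnothing$, $\sigma(1)=X$; (ii') $\sigma(\bigoplus_{i\in I}A_i)=\bigcup_{i\in I}\sigma(A_i)$ for all set-indexed families; (iii) $\sigma(\Sigma A)=\sigma(A)$; (iv) $\sigma(A)\subseteq\sigma(B)\cup\sigma(C)$ for every distinguished triangle $A\to B\to C\to\Sigma A$; (v') $\Phi_\sigma(\mathbf I\otimes\mathbf J)=\Phi_\sigma(\mathbf I)\cap\Phi_\sigma(\mathbf J)$ for all thick ideals $\mathbf I,\mathbf J$ of $\mathbf K$. *)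

theory Defs
  imports "HOL-Algebra.Free_Abelian_Groups" "HOL-Analysis.Abstract_Topology"
begin

unbundle cardinal_syntax

section \<open>Monoidal triangulated categories\<close>

text \<open>
  The data are only constrained on \<open>Obj\<close> and \<open>Arr\<close>.  Composition is written in
  function order: \<open>Comp K g f\<close> is \<open>g\<close> after \<open>f\<close>.  A triple \<open>(f, g, h)\<close> in \<open>Triangles\<close>
  counts only when it is typed as \<open>A \<rightarrow> B \<rightarrow> C \<rightarrow> \<Sigma> A\<close>; see \<open>distinguished\<close> below.
\<close>

record ('o, 'm) mtcat =
  Obj :: "'o set"
  Arr :: "'m set"
  Dom :: "'m \<Rightarrow> 'o"
  Cod :: "'m \<Rightarrow> 'o"
  Idn :: "'o \<Rightarrow> 'm"
  Comp :: "'m \<Rightarrow> 'm \<Rightarrow> 'm"  (infixr \<open>\<cdot>\<index>\<close> 70)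
  Plus :: "'m \<Rightarrow> 'm \<Rightarrow> 'm"  (infixl \<open>\<boxplus>\<index>\<close> 65)
  Null :: "'o \<Rightarrow> 'o \<Rightarrow> 'm"
  ShiftO :: "'o \<Rightarrow> 'o"
  ShiftA :: "'m \<Rightarrow> 'm"
  Triangles :: "('m \<times> 'm \<times> 'm) set"
  TensorO :: "'o \<Rightarrow> 'o \<Rightarrow> 'o"  (infixl \<open>\<boxtimes>\<index>\<close> 75)
  TensorA :: "'m \<Rightarrow> 'm \<Rightarrow> 'm"  (infixl \<open>\<boxdot>\<index>\<close> 75)
  UnitO :: "'o"
  Assoc :: "'o \<Rightarrow> 'o \<Rightarrow> 'o \<Rightarrow> 'm"
  LUnit :: "'o \<Rightarrow> 'm"
  RUnit :: "'o \<Rightarrow> 'm"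

definition Hom :: "('o, 'm) mtcat \<Rightarrow> 'o \<Rightarrow> 'o \<Rightarrow> 'm set" where
  "Hom K A B = {f \<in> Arr K. Dom K f = A \<and> Cod K f = B}"

definition inverse_arrows :: "('o, 'm) mtcat \<Rightarrow> 'o \<Rightarrow> 'o \<Rightarrow> 'm \<Rightarrow> 'm \<Rightarrow> bool" where
  "inverse_arrows K A B f g \<longleftrightarrow>
     f \<in> Hom K A B \<and> g \<in> Hom K B A \<and> Comp K g f = Idn K A \<and> Comp K f g = Idn K B"

definition isomorphism :: "('o, 'm) mtcat \<Rightarrow> 'o \<Rightarrow> 'o \<Rightarrow> 'm \<Rightarrow> bool" where
  "isomorphism K A B f \<longleftrightarrow> (\<exists>g. inverse_arrows K A B f g)"

definition isomorphic :: "('o, 'm) mtcat \<Rightarrow> 'o \<Rightarrow> 'o \<Rightarrow> bool" where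
  "isomorphic K A B \<longleftrightarrow> (\<exists>f. isomorphism K A B f)"

definition full_subcategory :: "('o, 'm) mtcat \<Rightarrow> 'o set \<Rightarrow> ('o, 'm) mtcat" where
  "full_subcategory K S =
     K\<lparr>Obj := S, Arr := {f \<in> Arr K. Dom K f \<in> S \<and> Cod K f \<in> S}\<rparr>"

locale category =
  fixes K :: "('o, 'm) mtcat" (structure)
  assumes dom_cod: "f \<in> Arr K \<Longrightarrow> Dom K f \<in> Obj K \<and> Cod K f \<in> Obj K"
    and ide_hom: "A \<in> Obj K \<Longrightarrow> Idn K A \<in> Hom K A A"
    and comp_hom: "f \<in> Hom K A B \<Longrightarrow> g \<in> Hom K B C \<Longrightarrow> g \<cdot> f \<in> Hom K A C"
    and comp_assoc: "f \<in> Hom K A B \<Longrightarrow> g \<in> Hom K B C \<Longrightarrow> h \<in> Hom K C D \<Longrightarrow>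
        h \<cdot> (g \<cdot> f) = (h \<cdot> g) \<cdot> f"
    and comp_ide_right: "f \<in> Hom K A B \<Longrightarrow> f \<cdot> Idn K A = f"
    and comp_ide_left: "f \<in> Hom K A B \<Longrightarrow> Idn K B \<cdot> f = f"

subsection \<open>Additive structure\<close>

definition hom_group :: "('o, 'm) mtcat \<Rightarrow> 'o \<Rightarrow> 'o \<Rightarrow> 'm monoid" where
  "hom_group K A B = \<lparr>carrier = Hom K A B, monoid.mult = Plus K, one = Null K A B\<rparr>"

definition zero_object :: "('o, 'm) mtcat \<Rightarrow> 'o \<Rightarrow> bool" where
  "zero_object K Z \<longleftrightarrow> Z \<in> Obj K \<and>
     (\<forall>A\<in>Obj K. (\<exists>!f. f \<in> Hom K Z A) \<and> (\<exists>!f. f \<in> Hom K A Z))"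

definition biproduct :: "('o, 'm) mtcat \<Rightarrow> 'o \<Rightarrow> 'o \<Rightarrow> 'o \<Rightarrow> bool" where
  "biproduct K A B M \<longleftrightarrow> A \<in> Obj K \<and> B \<in> Obj K \<and> M \<in> Obj K \<and>
     (\<exists>i \<in> Hom K A M. \<exists>j \<in> Hom K B M. \<exists>p \<in> Hom K M A. \<exists>q \<in> Hom K M B.
        Comp K p i = Idn K A \<and> Comp K q j = Idn K B \<and>
        Plus K (Comp K i p) (Comp K j q) = Idn K M)"

locale additive_category = category +
  assumes hom_comm_group: "A \<in> Obj K \<Longrightarrow> B \<in> Obj K \<Longrightarrow> comm_group (hom_group K A B)"
    and comp_plus_right: "f \<in> Hom K A B \<Longrightarrow> f' \<in> Hom K A B \<Longrightarrow> g \<in> Hom K B C \<Longrightarrow>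
        g \<cdot> (f \<boxplus> f') = (g \<cdot> f) \<boxplus> (g \<cdot> f')"
    and comp_plus_left: "f \<in> Hom K A B \<Longrightarrow> g \<in> Hom K B C \<Longrightarrow> g' \<in> Hom K B C \<Longrightarrow>
        (g \<boxplus> g') \<cdot> f = (g \<cdot> f) \<boxplus> (g' \<cdot> f)"
    and zero_object_exists: "\<exists>Z. zero_object K Z"
    and biproduct_exists: "A \<in> Obj K \<Longrightarrow> B \<in> Obj K \<Longrightarrow> \<exists>M. biproduct K A B M"

definition additive_endofunctor ::
  "('o, 'm) mtcat \<Rightarrow> ('o \<Rightarrow> 'o) \<Rightarrow> ('m \<Rightarrow> 'm) \<Rightarrow> bool" where
  "additive_endofunctor K Fo Fa \<longleftrightarrow>
     (\<forall>A\<in>Obj K. Fo A \<in> Obj K \<and> Fa (Idn K A) = Idn K (Fo A)) \<and>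
     (\<forall>A B f. f \<in> Hom K A B \<longrightarrow> Fa f \<in> Hom K (Fo A) (Fo B)) \<and>
     (\<forall>A B C f g. f \<in> Hom K A B \<and> g \<in> Hom K B C \<longrightarrow>
        Fa (Comp K g f) = Comp K (Fa g) (Fa f)) \<and>
     (\<forall>A B f f'. f \<in> Hom K A B \<and> f' \<in> Hom K A B \<longrightarrow>
        Fa (Plus K f f') = Plus K (Fa f) (Fa f'))"

definition autoequivalence ::
  "('o, 'm) mtcat \<Rightarrow> ('o \<Rightarrow> 'o) \<Rightarrow> ('m \<Rightarrow> 'm) \<Rightarrow> bool" where
  "autoequivalence K Fo Fa \<longleftrightarrow> additive_endofunctor K Fo Fa \<and>
     (\<forall>A\<in>Obj K. \<forall>B\<in>Obj K. bij_betw Fa (Hom K A B) (Hom K (Fo A) (Fo B))) \<and>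
     (\<forall>B\<in>Obj K. \<exists>A\<in>Obj K. isomorphic K (Fo A) B)"

subsection \<open>Triangulated structure\<close>

definition candidate_triangle ::
  "('o, 'm) mtcat \<Rightarrow> 'o \<Rightarrow> 'o \<Rightarrow> 'o \<Rightarrow> 'm \<Rightarrow> 'm \<Rightarrow> 'm \<Rightarrow> bool" where
  "candidate_triangle K A B C f g h \<longleftrightarrow>
     f \<in> Hom K A B \<and> g \<in> Hom K B C \<and> h \<in> Hom K C (ShiftO K A)"

definition distinguished ::
  "('o, 'm) mtcat \<Rightarrow> 'o \<Rightarrow> 'o \<Rightarrow> 'o \<Rightarrow> 'm \<Rightarrow> 'm \<Rightarrow> 'm \<Rightarrow> bool" where
  "distinguished K A B C f g h \<longleftrightarrow> candidate_triangle K A B C f g h \<and> (f, g, h) \<in> Triangles K"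

definition triangle_map ::
  "('o, 'm) mtcat \<Rightarrow> 'm \<times> 'm \<times> 'm \<Rightarrow> 'm \<times> 'm \<times> 'm \<Rightarrow> 'm \<Rightarrow> 'm \<Rightarrow> 'm \<Rightarrow> bool" where
  "triangle_map K = (\<lambda>(f, g, h) (f', g', h') a b c.
     Comp K b f = Comp K f' a \<and> Comp K c g = Comp K g' b \<and>
     Comp K (ShiftA K a) h = Comp K h' c)"

locale triangulated_category = additive_category +
  assumes shift_autoequivalence: "autoequivalence K (ShiftO K) (ShiftA K)"
    and triangle_ide: "A \<in> Obj K \<Longrightarrow> zero_object K Z \<Longrightarrow>
        distinguished K A A Z (Idn K A) (Null K A Z) (Null K Z (ShiftO K A))"
    and triangle_iso: "distinguished K A B C f g h \<Longrightarrow> candidate_triangle K A' B' C' f' g' h' \<Longrightarrow>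
        isomorphism K A A' a \<Longrightarrow> isomorphism K B B' b \<Longrightarrow> isomorphism K C C' c \<Longrightarrow>
        triangle_map K (f, g, h) (f', g', h') a b c \<Longrightarrow> distinguished K A' B' C' f' g' h'"
    and triangle_complete: "f \<in> Hom K A B \<Longrightarrow> \<exists>C g h. distinguished K A B C f g h"
    and triangle_rotate: "candidate_triangle K A B C f g h \<Longrightarrow>
        distinguished K A B C f g h \<longleftrightarrow>
        distinguished K B C (ShiftO K A) g h
          (inv\<^bsub>hom_group K (ShiftO K A) (ShiftO K B)\<^esub> (ShiftA K f))"
    and triangle_map_complete: "distinguished K A B C f g h \<Longrightarrow>
        distinguished K A' B' C' f' g' h' \<Longrightarrow> a \<in> Hom K A A' \<Longrightarrow> b \<in> Hom K B B' \<Longrightarrow>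
        b \<cdot> f = f' \<cdot> a \<Longrightarrow>
        \<exists>c \<in> Hom K C C'. triangle_map K (f, g, h) (f', g', h') a b c"
    and octahedral: "distinguished K A B D f u u' \<Longrightarrow> distinguished K B C F g v v' \<Longrightarrow>
        distinguished K A C E (g \<cdot> f) w w' \<Longrightarrow>
        \<exists>a b. distinguished K D E F a b (ShiftA K u \<cdot> v') \<and>
          a \<cdot> u = w \<cdot> g \<and> w' \<cdot> a = u' \<and> b \<cdot> w = v \<and> v' \<cdot> b = ShiftA K f \<cdot> w'"

definition exact_endofunctor ::
  "('o, 'm) mtcat \<Rightarrow> ('o \<Rightarrow> 'o) \<Rightarrow> ('m \<Rightarrow> 'm) \<Rightarrow> bool" where
  "exact_endofunctor K Fo Fa \<longleftrightarrow> additive_endofunctor K Fo Fa \<and>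
     (\<exists>\<phi>. (\<forall>A\<in>Obj K. isomorphism K (Fo (ShiftO K A)) (ShiftO K (Fo A)) (\<phi> A)) \<and>
          (\<forall>A B f. f \<in> Hom K A B \<longrightarrow>
             Comp K (\<phi> B) (Fa (ShiftA K f)) = Comp K (ShiftA K (Fa f)) (\<phi> A)) \<and>
          (\<forall>A B C f g h. distinguished K A B C f g h \<longrightarrow>
             distinguished K (Fo A) (Fo B) (Fo C) (Fa f) (Fa g) (Comp K (\<phi> A) (Fa h))))"

subsection \<open>Monoidal structure\<close>

locale monoidal_category = category +
  assumes unit_obj: "UnitO K \<in> Obj K"
    and tensor_obj: "A \<in> Obj K \<Longrightarrow> B \<in> Obj K \<Longrightarrow> A \<boxtimes> B \<in> Obj K"
    and tensor_hom: "f \<in> Hom K A A' \<Longrightarrow> g \<in> Hom K B B' \<Longrightarrow>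
        f \<boxdot> g \<in> Hom K (A \<boxtimes> B) (A' \<boxtimes> B')"
    and tensor_ide: "A \<in> Obj K \<Longrightarrow> B \<in> Obj K \<Longrightarrow> Idn K A \<boxdot> Idn K B = Idn K (A \<boxtimes> B)"
    and tensor_comp: "f \<in> Hom K A B \<Longrightarrow> g \<in> Hom K B C \<Longrightarrow> f' \<in> Hom K A' B' \<Longrightarrow>
        g' \<in> Hom K B' C' \<Longrightarrow> (g \<cdot> f) \<boxdot> (g' \<cdot> f') = (g \<boxdot> g') \<cdot> (f \<boxdot> f')"
    and assoc_iso: "A \<in> Obj K \<Longrightarrow> B \<in> Obj K \<Longrightarrow> C \<in> Obj K \<Longrightarrow>
        isomorphism K ((A \<boxtimes> B) \<boxtimes> C) (A \<boxtimes> (B \<boxtimes> C)) (Assoc K A B C)"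
    and assoc_natural: "f \<in> Hom K A A' \<Longrightarrow> g \<in> Hom K B B' \<Longrightarrow> h \<in> Hom K C C' \<Longrightarrow>
        Assoc K A' B' C' \<cdot> ((f \<boxdot> g) \<boxdot> h) = (f \<boxdot> (g \<boxdot> h)) \<cdot> Assoc K A B C"
    and lunit_iso: "A \<in> Obj K \<Longrightarrow> isomorphism K (UnitO K \<boxtimes> A) A (LUnit K A)"
    and lunit_natural: "f \<in> Hom K A B \<Longrightarrow>
        LUnit K B \<cdot> (Idn K (UnitO K) \<boxdot> f) = f \<cdot> LUnit K A"
    and runit_iso: "A \<in> Obj K \<Longrightarrow> isomorphism K (A \<boxtimes> UnitO K) A (RUnit K A)"
    and runit_natural: "f \<in> Hom K A B \<Longrightarrow>
        RUnit K B \<cdot> (f \<boxdot> Idn K (UnitO K)) = f \<cdot> RUnit K A"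
    and pentagon: "A \<in> Obj K \<Longrightarrow> B \<in> Obj K \<Longrightarrow> C \<in> Obj K \<Longrightarrow> D \<in> Obj K \<Longrightarrow>
        Assoc K A B (C \<boxtimes> D) \<cdot> Assoc K (A \<boxtimes> B) C D =
        (Idn K A \<boxdot> Assoc K B C D) \<cdot> Assoc K A (B \<boxtimes> C) D \<cdot> (Assoc K A B C \<boxdot> Idn K D)"
    and unit_triangle: "A \<in> Obj K \<Longrightarrow> B \<in> Obj K \<Longrightarrow>
        (Idn K A \<boxdot> LUnit K B) \<cdot> Assoc K A (UnitO K) B = RUnit K A \<boxdot> Idn K B"

text \<open>Exactness of the bifunctor \<open>\<otimes>\<close> means exactness in each variable separately.\<close>

locale monoidal_triangulated_category = triangulated_category + monoidal_category +
  assumes tensor_left_exact: "A \<in> Obj K \<Longrightarrow>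
        exact_endofunctor K (\<lambda>B. A \<boxtimes> B) (\<lambda>f. Idn K A \<boxdot> f)"
    and tensor_right_exact: "A \<in> Obj K \<Longrightarrow>
        exact_endofunctor K (\<lambda>B. B \<boxtimes> A) (\<lambda>f. f \<boxdot> Idn K A)"

text \<open>
  \<open>dual_pair K D A\<close>: \<open>D\<close> is a left dual of \<open>A\<close> (and \<open>A\<close> a right dual of \<open>D\<close>), with evaluation
  \<open>D \<otimes> A \<rightarrow> 1\<close> and coevaluation \<open>1 \<rightarrow> A \<otimes> D\<close>.  The two zigzag identities are written with
  the unitors moved to the other side, as equalities of arrows \<open>1 \<otimes> A \<rightarrow> A\<close> and
  \<open>D \<otimes> 1 \<rightarrow> D\<close>; the arrow \<open>\<beta>\<close> is the inverse associator.
\<close>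

definition dual_pair :: "('o, 'm) mtcat \<Rightarrow> 'o \<Rightarrow> 'o \<Rightarrow> bool" where
  "dual_pair K D A \<longleftrightarrow>
     (\<exists>ev \<in> Hom K (TensorO K D A) (UnitO K). \<exists>coev \<in> Hom K (UnitO K) (TensorO K A D). \<exists>\<beta>.
        inverse_arrows K (TensorO K (TensorO K D A) D) (TensorO K D (TensorO K A D))
          (Assoc K D A D) \<beta> \<and>
        Comp K (RUnit K A) (Comp K (TensorA K (Idn K A) ev)
          (Comp K (Assoc K A D A) (TensorA K coev (Idn K A)))) = LUnit K A \<and>
        Comp K (LUnit K D) (Comp K (TensorA K ev (Idn K D))
          (Comp K \<beta> (TensorA K (Idn K D) coev))) = RUnit K D)"

definition rigid :: "('o, 'm) mtcat \<Rightarrow> 'o \<Rightarrow> bool" where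
  "rigid K A \<longleftrightarrow> (\<exists>D \<in> Obj K. dual_pair K D A) \<and> (\<exists>D \<in> Obj K. dual_pair K A D)"

section \<open>Compact generation\<close>

text \<open>
  The collection of objects of \<open>K\<close> is a HOL set, so the size distinction between sets and
  classes has to be made explicit: a category with coproducts indexed by its own arrows is a
  preorder.  A cardinal \<open>\<kappa>\<close> marks the boundary: sets of cardinality less than \<open>\<kappa>\<close> play the role
  of sets.  All that is required of \<open>\<kappa>\<close> is that it is regular and uncountable, which covers the
  case where \<open>\<kappa>\<close> is the size of a Grothendieck universe.  Every index set of cardinality less
  than \<open>\<kappa>\<close> is in bijection with a subset of the underlying type of \<open>\<kappa>\<close>.
\<close>

definition universe_cardinal :: "'u rel \<Rightarrow> bool" where
  "universe_cardinal \<kappa> \<longleftrightarrow> Card_order \<kappa> \<and> natLeq <o \<kappa> \<and> regularCard \<kappa>"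

definition small :: "'u rel \<Rightarrow> 'a set \<Rightarrow> bool" where
  "small \<kappa> S \<longleftrightarrow> |S| <o \<kappa>"

definition coproduct ::
  "('o, 'm) mtcat \<Rightarrow> 'u set \<Rightarrow> ('u \<Rightarrow> 'o) \<Rightarrow> 'o \<Rightarrow> ('u \<Rightarrow> 'm) \<Rightarrow> bool" where
  "coproduct K I M S \<iota> \<longleftrightarrow> S \<in> Obj K \<and> (\<forall>i\<in>I. M i \<in> Obj K \<and> \<iota> i \<in> Hom K (M i) S) \<and>
     (\<forall>T\<in>Obj K. \<forall>g. (\<forall>i\<in>I. g i \<in> Hom K (M i) T) \<longrightarrow>
        (\<exists>!u. u \<in> Hom K S T \<and> (\<forall>i\<in>I. Comp K u (\<iota> i) = g i)))"

text \<open>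
  \<open>C\<close> is compact when the canonical map from the direct sum of the groups \<open>K(C, M\<^sub>i)\<close> to
  \<open>K(C, \<Oplus> M\<^sub>i)\<close> is an isomorphism; its value on a finitely supported family \<open>(f\<^sub>i)\<close> is the finite
  sum of the composites of \<open>f\<^sub>i\<close> with the coproduct injections.
\<close>

definition compact_object :: "'u rel \<Rightarrow> ('o, 'm) mtcat \<Rightarrow> 'o \<Rightarrow> bool" where
  "compact_object \<kappa> K C \<longleftrightarrow> C \<in> Obj K \<and>
     (\<forall>(I :: 'u set) M S \<iota>. small \<kappa> I \<and> coproduct K I M S \<iota> \<longrightarrow>
        (\<lambda>f. gfinprod (hom_group K C S) (\<lambda>i. Comp K (\<iota> i) (f i)) I)
          \<in> iso (sum_group I (\<lambda>i. hom_group K C (M i))) (hom_group K C S))"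

definition compact_part :: "'u rel \<Rightarrow> ('o, 'm) mtcat \<Rightarrow> ('o, 'm) mtcat" where
  "compact_part \<kappa> K = full_subcategory K {C. compact_object \<kappa> K C}"

text \<open>
  In \<open>hom_small\<close> only arrows out of compact objects are required to form small sets.
  Smallness of all arrow sets would force \<open>\<kappa>\<close> to be a strong limit as soon as \<open>K\<close> is nonzero.
\<close>

locale compactly_generated_mtc = monoidal_triangulated_category K
  for K :: "('o, 'm) mtcat" (structure) +
  fixes \<kappa> :: "'u rel"
  assumes universe: "universe_cardinal \<kappa>"
    and hom_small: "compact_object \<kappa> K C \<Longrightarrow> M \<in> Obj K \<Longrightarrow> small \<kappa> (Hom K C M)"
    and coproduct_exists: "small \<kappa> (I :: 'u set) \<Longrightarrow> (\<And>i. i \<in> I \<Longrightarrow> N i \<in> Obj K) \<Longrightarrow>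
        \<exists>S \<iota>. coproduct K I N S \<iota>"
    and tensor_left_coproduct: "small \<kappa> (I :: 'u set) \<Longrightarrow> coproduct K I N S \<iota> \<Longrightarrow> A \<in> Obj K \<Longrightarrow>
        coproduct K I (\<lambda>i. A \<boxtimes> N i) (A \<boxtimes> S) (\<lambda>i. Idn K A \<boxdot> \<iota> i)"
    and tensor_right_coproduct: "small \<kappa> (I :: 'u set) \<Longrightarrow> coproduct K I N S \<iota> \<Longrightarrow> A \<in> Obj K \<Longrightarrow>
        coproduct K I (\<lambda>i. N i \<boxtimes> A) (S \<boxtimes> A) (\<lambda>i. \<iota> i \<boxdot> Idn K A)"
    and compact_classes_small: "small \<kappa> ({C. compact_object \<kappa> K C} //
        {(A, B). compact_object \<kappa> K A \<and> compact_object \<kappa> K B \<and> isomorphic K A B})"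
    and compact_generate: "M \<in> Obj K \<Longrightarrow> \<not> zero_object K M \<Longrightarrow>
        \<exists>C. compact_object \<kappa> K C \<and> (\<exists>f \<in> Hom K C M. f \<noteq> Null K C M)"
    and compact_tensor: "compact_object \<kappa> K A \<Longrightarrow> compact_object \<kappa> K B \<Longrightarrow>
        compact_object \<kappa> K (A \<boxtimes> B)"
    and compact_unit: "compact_object \<kappa> K (UnitO K)"
    and compact_rigid: "compact_object \<kappa> K C \<Longrightarrow> rigid K C"

section \<open>Thick ideals and the noncommutative Balmer spectrum\<close>

text \<open>
  Closure under isomorphism is part of closure under direct summands, an object isomorphic to
  \<open>A\<close> being a biproduct of \<open>A\<close> and \<open>0\<close>.
\<close>

definition triangulated_subcategory :: "('o, 'm) mtcat \<Rightarrow> 'o set \<Rightarrow> bool" where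
  "triangulated_subcategory T I \<longleftrightarrow> I \<subseteq> Obj T \<and> I \<noteq> {} \<and>
     (\<forall>A\<in>Obj T. A \<in> I \<longleftrightarrow> ShiftO T A \<in> I) \<and>
     (\<forall>A B C f g h. distinguished T A B C f g h \<longrightarrow>
        (A \<in> I \<and> B \<in> I \<longrightarrow> C \<in> I) \<and> (B \<in> I \<and> C \<in> I \<longrightarrow> A \<in> I) \<and>
        (A \<in> I \<and> C \<in> I \<longrightarrow> B \<in> I))"

definition thick_ideal :: "('o, 'm) mtcat \<Rightarrow> 'o set \<Rightarrow> bool" where
  "thick_ideal T I \<longleftrightarrow> triangulated_subcategory T I \<and>
     (\<forall>A B M. biproduct T A B M \<and> M \<in> I \<longrightarrow> A \<in> I \<and> B \<in> I) \<and>
     (\<forall>A\<in>I. \<forall>M\<in>Obj T. TensorO T M A \<in> I \<and> TensorO T A M \<in> I)"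

definition ThickId :: "('o, 'm) mtcat \<Rightarrow> 'o set set" where
  "ThickId T = {I. thick_ideal T I}"

definition generated_ideal :: "('o, 'm) mtcat \<Rightarrow> 'o set \<Rightarrow> 'o set" where
  "generated_ideal T S = \<Inter>{I \<in> ThickId T. S \<subseteq> I}"

definition tensor_set :: "('o, 'm) mtcat \<Rightarrow> 'o set \<Rightarrow> 'o set \<Rightarrow> 'o set" where
  "tensor_set T I J = {TensorO T A B | A B. A \<in> I \<and> B \<in> J}"

definition prime_ideal :: "('o, 'm) mtcat \<Rightarrow> 'o set \<Rightarrow> bool" where
  "prime_ideal T P \<longleftrightarrow> thick_ideal T P \<and> P \<noteq> Obj T \<and>
     (\<forall>I\<in>ThickId T. \<forall>J\<in>ThickId T. tensor_set T I J \<subseteq> P \<longrightarrow> I \<subseteq> P \<or> J \<subseteq> P)"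

definition V_closed :: "('o, 'm) mtcat \<Rightarrow> 'o set \<Rightarrow> 'o set set" where
  "V_closed T S = {P. prime_ideal T P \<and> P \<inter> S = {}}"

text \<open>
  The sets \<open>V(S)\<close> are the closed sets of a topology: \<open>V({})\<close> is everything, \<open>V(Obj T)\<close> is empty,
  \<open>V\<close> turns unions into intersections, and \<open>V(S) \<union> V(S')\<close> is \<open>V\<close> of the collection of all
  direct sums of an object of \<open>S\<close> and an object of \<open>S'\<close>.
\<close>

definition Spc :: "('o, 'm) mtcat \<Rightarrow> 'o set topology" where
  "Spc T = topology (\<lambda>U. \<exists>S \<subseteq> Obj T. U = {P. prime_ideal T P} - V_closed T S)"

section \<open>Zariski spaces and extended weak support data\<close>

definition Noetherian_space :: "'x topology \<Rightarrow> bool" where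
  "Noetherian_space X \<longleftrightarrow>
     (\<forall>W :: nat \<Rightarrow> 'x set. (\<forall>n. closedin X (W n)) \<and> decseq W \<longrightarrow> (\<exists>N. \<forall>n\<ge>N. W n = W N))"

definition irreducible_closedin :: "'x topology \<Rightarrow> 'x set \<Rightarrow> bool" where
  "irreducible_closedin X W \<longleftrightarrow> closedin X W \<and> W \<noteq> {} \<and>
     (\<forall>A B. closedin X A \<and> closedin X B \<and> W = A \<union> B \<longrightarrow> W = A \<or> W = B)"

definition Zariski_space :: "'x topology \<Rightarrow> bool" where
  "Zariski_space X \<longleftrightarrow> Noetherian_space X \<and>
     (\<forall>W. irreducible_closedin X W \<longrightarrow> (\<exists>!x. x \<in> topspace X \<and> X closure_of {x} = W))"

definition specialization_closed :: "'x topology \<Rightarrow> 'x set set" where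
  "specialization_closed X = {\<Union>\<F> | \<F>. \<forall>W\<in>\<F>. closedin X W}"

definition Phi :: "('o \<Rightarrow> 'x set) \<Rightarrow> 'o set \<Rightarrow> 'x set" where
  "Phi \<sigma> S = (\<Union>A\<in>S. \<sigma> A)"

locale extended_weak_support_datum =
  fixes \<kappa> :: "'u rel" and K :: "('o, 'm) mtcat" (structure)
    and X :: "'x topology" and \<sigma> :: "'o \<Rightarrow> 'x set"
  assumes support_subset: "A \<in> Obj K \<Longrightarrow> \<sigma> A \<subseteq> topspace X"
    and support_zero: "zero_object K Z \<Longrightarrow> \<sigma> Z = {}"
    and support_unit: "\<sigma> (UnitO K) = topspace X"
    and support_coproduct: "small \<kappa> (U :: 'u set) \<Longrightarrow> coproduct K U N S \<iota> \<Longrightarrow>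
        \<sigma> S = (\<Union>i\<in>U. \<sigma> (N i))"
    and support_shift: "A \<in> Obj K \<Longrightarrow> \<sigma> (ShiftO K A) = \<sigma> A"
    and support_triangle: "distinguished K A B C f g h \<Longrightarrow> \<sigma> A \<subseteq> \<sigma> B \<union> \<sigma> C"
    and support_tensor: "I \<in> ThickId K \<Longrightarrow> J \<in> ThickId K \<Longrightarrow>
        Phi \<sigma> (tensor_set K I J) = Phi \<sigma> I \<inter> Phi \<sigma> J"

section \<open>Ordered monoids\<close>

definition ordered_monoid :: "'a monoid \<Rightarrow> ('a \<Rightarrow> 'a \<Rightarrow> bool) \<Rightarrow> bool" where
  "ordered_monoid M leM \<longleftrightarrow> Group.monoid M \<and>
     partial_order_on (carrier M) {(a, b). a \<in> carrier M \<and> b \<in> carrier M \<and> leM a b} \<and>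
     (\<forall>a\<in>carrier M. \<forall>b\<in>carrier M. \<forall>c\<in>carrier M. leM a b \<longrightarrow>
        leM (a \<otimes>\<^bsub>M\<^esub> c) (b \<otimes>\<^bsub>M\<^esub> c) \<and> leM (c \<otimes>\<^bsub>M\<^esub> a) (c \<otimes>\<^bsub>M\<^esub> b))"

definition ordered_monoid_iso ::
  "('a \<Rightarrow> 'b) \<Rightarrow> 'a monoid \<Rightarrow> ('a \<Rightarrow> 'a \<Rightarrow> bool) \<Rightarrow> 'b monoid \<Rightarrow> ('b \<Rightarrow> 'b \<Rightarrow> bool) \<Rightarrow> bool"
  where
  "ordered_monoid_iso h M leM N leN \<longleftrightarrow> ordered_monoid M leM \<and> ordered_monoid N leN \<and>
     h \<in> iso M N \<and> h \<one>\<^bsub>M\<^esub> = \<one>\<^bsub>N\<^esub> \<and>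
     (\<forall>a\<in>carrier M. \<forall>b\<in>carrier M. leM a b \<longleftrightarrow> leN (h a) (h b))"

definition ThickId_monoid :: "('o, 'm) mtcat \<Rightarrow> 'o set monoid" where
  "ThickId_monoid T = \<lparr>carrier = ThickId T,
     monoid.mult = (\<lambda>I J. generated_ideal T (tensor_set T I J)), one = Obj T\<rparr>"

definition specialization_closed_monoid :: "'x topology \<Rightarrow> 'x set monoid" where
  "specialization_closed_monoid X =
     \<lparr>carrier = specialization_closed X, monoid.mult = (\<inter>), one = topspace X\<rparr>"

end

theory Submission
  imports Defs
begin

text \<open>
  Let \<open>J\<close> be a thick ideal of compact objects. Attaching cells from \<open>J\<close> to an object \<open>N\<close> infinitely
  often yields a triangle \<open>T \<rightarrow> N \<rightarrow> L\<close> with \<open>T\<close> in the localizing subcategory generated by \<open>J\<close> and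
  no nonzero arrows from \<open>J\<close> to \<open>L\<close>; if \<open>N\<close> is compact and \<open>L = 0\<close>, then \<open>N\<close> belongs to \<open>J\<close>. By
  rigidity \<open>L\<close> is annihilated by the ideal generated by \<open>J\<close>, so the tensor property separates the
  supports of \<open>J\<close> and \<open>L\<close>. If moreover \<open>\<Phi>(N) \<subseteq> \<Phi>(J)\<close>, then the support of \<open>L\<close> also lies in
  \<open>\<Phi>(J)\<close>, so it is empty and \<open>L = 0\<close> by faithfulness. Thus \<open>\<Phi>\<close> reflects inclusions. The monoid laws are
  transported along \<open>\<Phi>\<close>, and a prime ideal \<open>P\<close> corresponds to the generic point of a minimal closed
  set that is not contained in \<open>\<Phi>(P)\<close>.
\<close>

section \<open>Arrows in additive categories\<close>

text \<open>Two obstacles shape the proof. Without a braiding the tensor axiom controls supports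
  only for two-sided thick ideals of \<open>K\<close>, whereas the classification concerns ideals of
  compact objects; and nothing makes a localizing subcategory cut out by a support condition an
  ideal. The link is that compact objects generate \<open>K\<close>: a localizing subcategory
  containing an ideal of compact objects also contains the ideal generated in all of
  \<open>K\<close>, because multiplication from both sides need only be tested on compact objects,
  one side at a time. Hence an ideal and its extension to \<open>K\<close> have the same \<Phi>, and
  the bound on supports holds for the whole ideal generated by \<open>L\<close>, not only for
  \<open>L\<close>. Countably many rounds of cell attachment suffice because compact objects see
  only finite stages; each round uses all arrows from representatives of \<open>J\<close>, a small
  set by the smallness assumptions on compact objects. Rigidity enters through the dual of an object
  of \<open>J\<close>: it is compact, and it lies in \<open>J\<close> as a summand of a product
  containing that object.\<close>

definition Neg :: "('o, 'm) mtcat \<Rightarrow> 'm \<Rightarrow> 'm" where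
  "Neg K f = inv\<^bsub>hom_group K (Dom K f) (Cod K f)\<^esub> f"

context category
begin

lemma HomD:
  assumes "f \<in> Hom K A B"
  shows "f \<in> Arr K" "Dom K f = A" "Cod K f = B" "A \<in> Obj K" "B \<in> Obj K"
  using assms dom_cod by (auto simp: Hom_def)

lemma arr_obj [simp]: "f \<in> Arr K \<Longrightarrow> Dom K f \<in> Obj K" "f \<in> Arr K \<Longrightarrow> Cod K f \<in> Obj K"
  using dom_cod by auto

lemma arr_idn [simp]:
  assumes "A \<in> Obj K"
  shows "Idn K A \<in> Arr K" "Dom K (Idn K A) = A" "Cod K (Idn K A) = A"
  using HomD[OF ide_hom[OF assms]] by auto

lemma arr_comp [simp]:
  assumes "f \<in> Arr K" "g \<in> Arr K" "Cod K f = Dom K g"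
  shows "g \<cdot> f \<in> Arr K" "Dom K (g \<cdot> f) = Dom K f" "Cod K (g \<cdot> f) = Cod K g"
  using HomD[OF comp_hom[of f "Dom K f" "Cod K f" g "Cod K g"]] assms by (auto simp: Hom_def)

lemma comp_assoc' [simp]:
  assumes "f \<in> Arr K" "g \<in> Arr K" "h \<in> Arr K" "Cod K f = Dom K g" "Cod K g = Dom K h"
  shows "(h \<cdot> g) \<cdot> f = h \<cdot> (g \<cdot> f)"
  using comp_assoc[of f "Dom K f" "Cod K f" g "Cod K g" h "Cod K h"] assms by (auto simp: Hom_def)

lemma comp_idn [simp]:
  "f \<in> Arr K \<Longrightarrow> Dom K f = A \<Longrightarrow> f \<cdot> Idn K A = f"
  "f \<in> Arr K \<Longrightarrow> Cod K f = A \<Longrightarrow> Idn K A \<cdot> f = f"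
  using comp_ide_right comp_ide_left by (auto simp: Hom_def)

text \<open>Simplification associates composites to the right, so the left side of an equation
  \<open>g \<cdot> f = h\<close> no longer occurs inside a longer composite; this form rewrites it
  there.\<close>

lemma comp_subst:
  assumes "g \<cdot> f = h" "f \<in> Arr K" "g \<in> Arr K" "Cod K f = Dom K g" "x \<in> Arr K" "Cod K x = Dom K f"
  shows "g \<cdot> (f \<cdot> x) = h \<cdot> x"
  using assms comp_assoc'[of x f g] by simp

lemma isomorphism_Idn: "A \<in> Obj K \<Longrightarrow> isomorphism K A A (Idn K A)"
  unfolding isomorphism_def inverse_arrows_def
  by (rule exI[of _ "Idn K A"]) (auto simp: Hom_def)

lemma isomorphic_refl: "A \<in> Obj K \<Longrightarrow> isomorphic K A A"
  unfolding isomorphic_def using isomorphism_Idn by blast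

lemma isomorphic_sym: "isomorphic K A B \<Longrightarrow> isomorphic K B A"
  unfolding isomorphic_def isomorphism_def inverse_arrows_def by blast

lemma isomorphismE:
  assumes "isomorphism K A B f"
  obtains g where "f \<in> Hom K A B" "g \<in> Hom K B A" "g \<cdot> f = Idn K A" "f \<cdot> g = Idn K B"
  using assms unfolding isomorphism_def inverse_arrows_def by blast

lemma isomorphicE:
  assumes "isomorphic K A B"
  obtains f g where "f \<in> Hom K A B" "g \<in> Hom K B A" "g \<cdot> f = Idn K A" "f \<cdot> g = Idn K B"
  using assms unfolding isomorphic_def isomorphism_def inverse_arrows_def by blast

lemma isomorphicI:
  assumes "f \<in> Hom K A B" "g \<in> Hom K B A" "g \<cdot> f = Idn K A" "f \<cdot> g = Idn K B"
  shows "isomorphic K A B"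
  using assms unfolding isomorphic_def isomorphism_def inverse_arrows_def by blast

lemma isomorphic_trans:
  assumes "isomorphic K A B" "isomorphic K B C"
  shows "isomorphic K A C"
proof -
  obtain f g where fg: "f \<in> Hom K A B" "g \<in> Hom K B A" "g \<cdot> f = Idn K A" "f \<cdot> g = Idn K B"
    using assms(1) by (rule isomorphicE)
  obtain h k where hk: "h \<in> Hom K B C" "k \<in> Hom K C B" "k \<cdot> h = Idn K B" "h \<cdot> k = Idn K C"
    using assms(2) by (rule isomorphicE)
  note D = fg(1,2)[THEN HomD(1)] fg(1,2)[THEN HomD(2)] fg(1,2)[THEN HomD(3)]
    hk(1,2)[THEN HomD(1)] hk(1,2)[THEN HomD(2)] hk(1,2)[THEN HomD(3)]
  show ?thesis
  proof (rule isomorphicI)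
    show "h \<cdot> f \<in> Hom K A C" "g \<cdot> k \<in> Hom K C A"
      using D by (auto simp: Hom_def)
    have "k \<cdot> (h \<cdot> f) = f" "f \<cdot> (g \<cdot> k) = k"
      using D comp_subst[OF hk(3)] comp_subst[OF fg(4)] by auto
    then show "(g \<cdot> k) \<cdot> (h \<cdot> f) = Idn K A" "(h \<cdot> f) \<cdot> (g \<cdot> k) = Idn K C"
      using D fg hk by auto
  qed
qed

end

context additive_category
begin

lemma hom_group_simps [simp]:
  "carrier (hom_group K A B) = Hom K A B" "monoid.mult (hom_group K A B) = Plus K"
  "one (hom_group K A B) = Null K A B"
  by (auto simp: hom_group_def)

lemma arr_null [simp]:
  assumes "A \<in> Obj K" "B \<in> Obj K"
  shows "Null K A B \<in> Arr K" "Dom K (Null K A B) = A" "Cod K (Null K A B) = B"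
proof -
  interpret comm_group "hom_group K A B" using hom_comm_group[OF assms] .
  show "Null K A B \<in> Arr K" "Dom K (Null K A B) = A" "Cod K (Null K A B) = B"
    using one_closed by (auto simp: Hom_def)
qed

lemma Null_hom: "A \<in> Obj K \<Longrightarrow> B \<in> Obj K \<Longrightarrow> Null K A B \<in> Hom K A B"
  by (simp add: Hom_def)

lemma arr_plus [simp]:
  assumes "f \<in> Arr K" "g \<in> Arr K" "Dom K f = Dom K g" "Cod K f = Cod K g"
  shows "f \<boxplus> g \<in> Arr K" "Dom K (f \<boxplus> g) = Dom K g" "Cod K (f \<boxplus> g) = Cod K g"
proof -
  interpret comm_group "hom_group K (Dom K g) (Cod K g)" using hom_comm_group assms by auto
  show "f \<boxplus> g \<in> Arr K" "Dom K (f \<boxplus> g) = Dom K g" "Cod K (f \<boxplus> g) = Cod K g"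
    using m_closed[of f g] assms by (auto simp: Hom_def)
qed

lemma arr_neg [simp]:
  assumes "f \<in> Arr K"
  shows "Neg K f \<in> Arr K" "Dom K (Neg K f) = Dom K f" "Cod K (Neg K f) = Cod K f"
proof -
  interpret comm_group "hom_group K (Dom K f) (Cod K f)" using hom_comm_group assms by auto
  show "Neg K f \<in> Arr K" "Dom K (Neg K f) = Dom K f" "Cod K (Neg K f) = Cod K f"
    using inv_closed[of f] assms by (auto simp: Hom_def Neg_def)
qed

lemma plus_assoc:
  assumes "f \<in> Arr K" "g \<in> Arr K" "h \<in> Arr K" "Dom K f = Dom K g" "Cod K f = Cod K g"
    "Dom K h = Dom K g" "Cod K h = Cod K g"
  shows "(f \<boxplus> g) \<boxplus> h = f \<boxplus> (g \<boxplus> h)"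
proof -
  interpret comm_group "hom_group K (Dom K g) (Cod K g)" using hom_comm_group assms by auto
  show ?thesis using m_assoc[of f g h] assms by (auto simp: Hom_def)
qed

lemma plus_comm:
  assumes "f \<in> Arr K" "g \<in> Arr K" "Dom K f = Dom K g" "Cod K f = Cod K g"
  shows "f \<boxplus> g = g \<boxplus> f"
proof -
  interpret comm_group "hom_group K (Dom K g) (Cod K g)" using hom_comm_group assms by auto
  show ?thesis using m_comm[of f g] assms by (auto simp: Hom_def)
qed

lemma plus_null [simp]:
  assumes "f \<in> Arr K" "Dom K f = A" "Cod K f = B"
  shows "f \<boxplus> Null K A B = f" "Null K A B \<boxplus> f = f"
proof -
  interpret comm_group "hom_group K A B" using hom_comm_group assms by auto
  show "f \<boxplus> Null K A B = f" "Null K A B \<boxplus> f = f" 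
    using r_one[of f] l_one[of f] assms by (auto simp: Hom_def)
qed

lemma plus_neg [simp]:
  assumes "f \<in> Arr K"
  shows "f \<boxplus> Neg K f = Null K (Dom K f) (Cod K f)" "Neg K f \<boxplus> f = Null K (Dom K f) (Cod K f)"
proof -
  interpret comm_group "hom_group K (Dom K f) (Cod K f)" using hom_comm_group assms by auto
  show "f \<boxplus> Neg K f = Null K (Dom K f) (Cod K f)" "Neg K f \<boxplus> f = Null K (Dom K f) (Cod K f)"
    using r_inv[of f] l_inv[of f] assms by (auto simp: Hom_def Neg_def)
qed

lemma neg_hom: "f \<in> Hom K A B \<Longrightarrow> Neg K f \<in> Hom K A B"
  by (simp add: Hom_def)

lemma plus_hom: "f \<in> Hom K A B \<Longrightarrow> g \<in> Hom K A B \<Longrightarrow> f \<boxplus> g \<in> Hom K A B"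
  by (simp add: Hom_def)

lemma plus_right_cancel:
  assumes "f \<in> Hom K A B" "g \<in> Hom K A B" "h \<in> Hom K A B" "f \<boxplus> h = g \<boxplus> h"
  shows "f = g"
proof -
  interpret comm_group "hom_group K A B" using hom_comm_group assms HomD by metis
  show ?thesis using right_cancel[of h f g] assms by auto
qed

lemma eq_if_diff_null:
  assumes "f \<in> Hom K A B" "g \<in> Hom K A B" "f \<boxplus> Neg K g = Null K A B"
  shows "f = g"
proof (rule plus_right_cancel)
  show "f \<boxplus> Neg K g = g \<boxplus> Neg K g" using assms HomD[OF assms(2)] by simp
qed (use assms neg_hom in auto)

text \<open>Cancellation in the hom group. It is the standard way below to see that an additive
  operation preserves zero arrows.\<close>

lemma plus_idem_null:
  assumes "f \<in> Hom K A B" "f \<boxplus> f = f"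
  shows "f = Null K A B"
  by (rule plus_right_cancel[where h = f])
    (use assms HomD[OF assms(1)] Null_hom in auto)

lemma comp_plus [simp]:
  assumes "f \<in> Arr K" "f' \<in> Arr K" "g \<in> Arr K" "Dom K f = Dom K f'" "Cod K f = Cod K f'"
    "Cod K f' = Dom K g"
  shows "g \<cdot> (f \<boxplus> f') = (g \<cdot> f) \<boxplus> (g \<cdot> f')"
  using comp_plus_right[of f "Dom K f" "Cod K f" f' g "Cod K g"] assms by (auto simp: Hom_def)

lemma plus_comp [simp]:
  assumes "g \<in> Arr K" "g' \<in> Arr K" "f \<in> Arr K" "Dom K g = Dom K g'" "Cod K g = Cod K g'"
    "Cod K f = Dom K g'"
  shows "(g \<boxplus> g') \<cdot> f = (g \<cdot> f) \<boxplus> (g' \<cdot> f)"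
  using comp_plus_left[of f "Dom K f" "Cod K f" g "Cod K g" g'] assms by (auto simp: Hom_def)

lemma comp_null [simp]:
  assumes "g \<in> Arr K" "Dom K g = B" "A \<in> Obj K"
  shows "g \<cdot> Null K A B = Null K A (Cod K g)"
proof (rule plus_idem_null)
  show "g \<cdot> Null K A B \<in> Hom K A (Cod K g)" using assms by (auto simp: Hom_def)
  have "g \<cdot> (Null K A B \<boxplus> Null K A B) = (g \<cdot> Null K A B) \<boxplus> (g \<cdot> Null K A B)"
    using assms by (intro comp_plus) auto
  then show "(g \<cdot> Null K A B) \<boxplus> (g \<cdot> Null K A B) = g \<cdot> Null K A B"
    using assms by auto
qed

lemma null_comp [simp]:
  assumes "g \<in> Arr K" "Cod K g = A" "B \<in> Obj K"
  shows "Null K A B \<cdot> g = Null K (Dom K g) B"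
proof (rule plus_idem_null)
  show "Null K A B \<cdot> g \<in> Hom K (Dom K g) B" using assms by (auto simp: Hom_def)
  have "(Null K A B \<boxplus> Null K A B) \<cdot> g = (Null K A B \<cdot> g) \<boxplus> (Null K A B \<cdot> g)"
    using assms by (intro plus_comp) auto
  then show "(Null K A B \<cdot> g) \<boxplus> (Null K A B \<cdot> g) = Null K A B \<cdot> g"
    using assms by auto
qed

lemma neg_unique:
  assumes "f \<in> Hom K A B" "g \<in> Hom K A B" "f \<boxplus> g = Null K A B"
  shows "f = Neg K g"
  by (rule plus_right_cancel[where h = g])
    (use assms neg_hom HomD[OF assms(2)] in auto)

lemma comp_neg [simp]:
  assumes "f \<in> Arr K" "g \<in> Arr K" "Cod K f = Dom K g"
  shows "g \<cdot> Neg K f = Neg K (g \<cdot> f)"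
proof (rule neg_unique)
  have "(g \<cdot> Neg K f) \<boxplus> (g \<cdot> f) = g \<cdot> (Neg K f \<boxplus> f)"
    using assms by (intro comp_plus[symmetric]) auto
  then show "(g \<cdot> Neg K f) \<boxplus> (g \<cdot> f) = Null K (Dom K f) (Cod K g)" using assms by auto
qed (use assms in \<open>auto simp: Hom_def\<close>)

lemma neg_comp [simp]:
  assumes "f \<in> Arr K" "g \<in> Arr K" "Cod K f = Dom K g"
  shows "Neg K g \<cdot> f = Neg K (g \<cdot> f)"
proof (rule neg_unique)
  have "(Neg K g \<cdot> f) \<boxplus> (g \<cdot> f) = (Neg K g \<boxplus> g) \<cdot> f"
    using assms by (intro plus_comp[symmetric]) auto
  then show "(Neg K g \<cdot> f) \<boxplus> (g \<cdot> f) = Null K (Dom K f) (Cod K g)" using assms by auto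
qed (use assms in \<open>auto simp: Hom_def\<close>)

lemma neg_null [simp]:
  assumes "A \<in> Obj K" "B \<in> Obj K"
  shows "Neg K (Null K A B) = Null K A B"
  using neg_unique[of "Null K A B" A B "Null K A B"] assms Null_hom by auto

lemma neg_neg [simp]:
  assumes "f \<in> Arr K"
  shows "Neg K (Neg K f) = f"
  using neg_unique[of f "Dom K f" "Cod K f" "Neg K f"] assms by (auto simp: Hom_def)

lemma neg_eq_null:
  assumes "f \<in> Hom K A B" "Neg K f = Null K A B"
  shows "f = Null K A B"
  using assms neg_neg[of f] HomD[OF assms(1)] by auto

text \<open>The rotation axiom names the hom group of its inverse explicitly, whereas
  \<open>Neg\<close> reads it off the arrow, which suits simplification.\<close>

lemma neg_inv:
  assumes "f \<in> Hom K A B"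
  shows "inv\<^bsub>hom_group K A B\<^esub> f = Neg K f"
  using HomD[OF assms] by (simp add: Neg_def)

text \<open>Every arrow into or out of \<open>Z\<close> absorbs \<open>Idn K Z\<close>, so it
  vanishes once this identity does. In equational form the condition passes along additive functors
  and retracts.\<close>

lemma zero_object_iff:
  "zero_object K Z \<longleftrightarrow> Z \<in> Obj K \<and> Idn K Z = Null K Z Z"
proof
  assume "zero_object K Z"
  then show "Z \<in> Obj K \<and> Idn K Z = Null K Z Z"
    unfolding zero_object_def using ide_hom Null_hom by blast
next
  assume Z: "Z \<in> Obj K \<and> Idn K Z = Null K Z Z"
  have 1: "f = Null K Z A" if f: "f \<in> Hom K Z A" for f A
  proof -
    have "f = f \<cdot> Idn K Z" using HomD[OF f] by auto
    then show ?thesis using Z HomD[OF f] by auto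
  qed
  have 2: "f = Null K A Z" if f: "f \<in> Hom K A Z" for f A
  proof -
    have "f = Idn K Z \<cdot> f" using HomD[OF f] by auto
    then show ?thesis using Z HomD[OF f] by auto
  qed
  show "zero_object K Z"
    unfolding zero_object_def using Z 1 2 Null_hom by blast
qed

lemma zero_object_obj: "zero_object K Z \<Longrightarrow> Z \<in> Obj K"
  by (simp add: zero_object_def)

lemma hom_from_zero: "zero_object K Z \<Longrightarrow> f \<in> Hom K Z A \<Longrightarrow> f = Null K Z A"
  using Null_hom HomD unfolding zero_object_def by metis

lemma hom_to_zero: "zero_object K Z \<Longrightarrow> f \<in> Hom K A Z \<Longrightarrow> f = Null K A Z"
  using Null_hom HomD unfolding zero_object_def by metis

lemma zero_object_retract:
  assumes "zero_object K M" "i \<in> Hom K A M" "p \<in> Hom K M A" "p \<cdot> i = Idn K A"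
  shows "zero_object K A"
  using assms hom_to_zero[OF assms(1,2)] HomD[OF assms(2)] HomD[OF assms(3)]
  unfolding zero_object_iff by auto

text \<open>The definition does not list the mixed composites \<open>q \<cdot> i\<close> and
  \<open>p \<cdot> j\<close>; their vanishing follows from the three equations that it
  contains.\<close>

lemma biproductE:
  assumes "biproduct K A B M"
  obtains i j p q where "i \<in> Hom K A M" "j \<in> Hom K B M" "p \<in> Hom K M A" "q \<in> Hom K M B"
    "p \<cdot> i = Idn K A" "q \<cdot> j = Idn K B" "(i \<cdot> p) \<boxplus> (j \<cdot> q) = Idn K M"
    "q \<cdot> i = Null K A B" "p \<cdot> j = Null K B A"
proof -
  obtain i j p q where h: "i \<in> Hom K A M" "j \<in> Hom K B M" "p \<in> Hom K M A" "q \<in> Hom K M B"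
    and e: "p \<cdot> i = Idn K A" "q \<cdot> j = Idn K B" "(i \<cdot> p) \<boxplus> (j \<cdot> q) = Idn K M"
    using assms unfolding biproduct_def by blast
  note D = h[THEN HomD(1)] h[THEN HomD(2)] h[THEN HomD(3)]
  have O: "A \<in> Obj K" "B \<in> Obj K" "M \<in> Obj K" using h HomD by blast+
  have 1: "q \<cdot> i = Null K A B"
  proof (rule plus_idem_null)
    show "q \<cdot> i \<in> Hom K A B" using D by (auto simp: Hom_def)
    \<comment> \<open>The identity of \<open>M\<close>, written as a sum, is inserted between
      \<open>q\<close> and \<open>i\<close>; both summands reduce to \<open>q \<cdot> i\<close>, so
      this arrow is its own double.\<close>
    have "q \<cdot> i = (q \<cdot> ((i \<cdot> p) \<boxplus> (j \<cdot> q))) \<cdot> i" using D e(3) O by simp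
    also have "\<dots> = q \<cdot> i \<cdot> p \<cdot> i \<boxplus> q \<cdot> j \<cdot> q \<cdot> i" using D by simp
    also have "q \<cdot> j \<cdot> q \<cdot> i = q \<cdot> i" using D comp_subst[OF e(2), of "q \<cdot> i"] by simp
    also have "q \<cdot> i \<cdot> p \<cdot> i = q \<cdot> i" using D e by simp
    finally show "(q \<cdot> i) \<boxplus> (q \<cdot> i) = q \<cdot> i" by simp
  qed
  have 2: "p \<cdot> j = Null K B A"
  proof (rule plus_idem_null)
    show "p \<cdot> j \<in> Hom K B A" using D by (auto simp: Hom_def)
    have "p \<cdot> j = (p \<cdot> ((i \<cdot> p) \<boxplus> (j \<cdot> q))) \<cdot> j" using D e(3) O by simp
    also have "\<dots> = p \<cdot> i \<cdot> p \<cdot> j \<boxplus> p \<cdot> j \<cdot> q \<cdot> j" using D by simp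
    also have "p \<cdot> i \<cdot> p \<cdot> j = p \<cdot> j" using D comp_subst[OF e(1), of "p \<cdot> j"] by simp
    also have "p \<cdot> j \<cdot> q \<cdot> j = p \<cdot> j" using D e by simp
    finally show "(p \<cdot> j) \<boxplus> (p \<cdot> j) = p \<cdot> j" by simp
  qed
  show ?thesis using that h e 1 2 by blast
qed

end

section \<open>Triangles\<close>

context additive_category
begin

lemma additive_endofunctorD:
  assumes "additive_endofunctor K Fo Fa"
  shows "A \<in> Obj K \<Longrightarrow> Fo A \<in> Obj K" "A \<in> Obj K \<Longrightarrow> Fa (Idn K A) = Idn K (Fo A)"
    "f \<in> Hom K A B \<Longrightarrow> Fa f \<in> Hom K (Fo A) (Fo B)"
    "f \<in> Hom K A B \<Longrightarrow> g \<in> Hom K B C \<Longrightarrow> Fa (g \<cdot> f) = Fa g \<cdot> Fa f"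
    "f \<in> Hom K A B \<Longrightarrow> f' \<in> Hom K A B \<Longrightarrow> Fa (f \<boxplus> f') = Fa f \<boxplus> Fa f'"
  using assms unfolding additive_endofunctor_def by blast+

lemma additive_endofunctor_null:
  assumes "additive_endofunctor K Fo Fa" "A \<in> Obj K" "B \<in> Obj K"
  shows "Fa (Null K A B) = Null K (Fo A) (Fo B)"
proof (rule plus_idem_null)
  note F = additive_endofunctorD[OF assms(1)]
  show "Fa (Null K A B) \<in> Hom K (Fo A) (Fo B)" using F(3) Null_hom assms by blast
  show "Fa (Null K A B) \<boxplus> Fa (Null K A B) = Fa (Null K A B)"
    using F(5)[of "Null K A B" A B "Null K A B"] Null_hom assms by auto
qed

end

context triangulated_category
begin

lemma shift_functor: "additive_endofunctor K (ShiftO K) (ShiftA K)"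
  using shift_autoequivalence unfolding autoequivalence_def by blast

lemma shift_obj [simp]: "A \<in> Obj K \<Longrightarrow> ShiftO K A \<in> Obj K"
  using additive_endofunctorD[OF shift_functor] by blast

lemma shift_arr [simp]:
  assumes "f \<in> Arr K"
  shows "ShiftA K f \<in> Arr K" "Dom K (ShiftA K f) = ShiftO K (Dom K f)"
    "Cod K (ShiftA K f) = ShiftO K (Cod K f)"
  using additive_endofunctorD(3)[OF shift_functor, of f "Dom K f" "Cod K f"] assms
  by (auto simp: Hom_def)

lemma shift_hom: "f \<in> Hom K A B \<Longrightarrow> ShiftA K f \<in> Hom K (ShiftO K A) (ShiftO K B)"
  by (auto simp: Hom_def)

lemma shift_comp [simp]:
  assumes "f \<in> Arr K" "g \<in> Arr K" "Cod K f = Dom K g"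
  shows "ShiftA K (g \<cdot> f) = ShiftA K g \<cdot> ShiftA K f"
  using additive_endofunctorD(4)[OF shift_functor, of f "Dom K f" "Cod K f" g "Cod K g"] assms
  by (auto simp: Hom_def)

lemma shift_idn [simp]: "A \<in> Obj K \<Longrightarrow> ShiftA K (Idn K A) = Idn K (ShiftO K A)"
  using additive_endofunctorD(2)[OF shift_functor] by blast

lemma shift_null [simp]:
  "A \<in> Obj K \<Longrightarrow> B \<in> Obj K \<Longrightarrow> ShiftA K (Null K A B) = Null K (ShiftO K A) (ShiftO K B)"
  using additive_endofunctor_null[OF shift_functor] by blast

lemma shift_plus [simp]:
  assumes "f \<in> Arr K" "g \<in> Arr K" "Dom K f = Dom K g" "Cod K f = Cod K g"
  shows "ShiftA K (f \<boxplus> g) = ShiftA K f \<boxplus> ShiftA K g"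
  using additive_endofunctorD(5)[OF shift_functor, of f "Dom K f" "Cod K f" g] assms
  by (auto simp: Hom_def)

lemma shift_neg [simp]:
  assumes "f \<in> Arr K"
  shows "ShiftA K (Neg K f) = Neg K (ShiftA K f)"
proof (rule neg_unique)
  show "ShiftA K (Neg K f) \<boxplus> ShiftA K f = Null K (ShiftO K (Dom K f)) (ShiftO K (Cod K f))"
    using assms shift_plus[of "Neg K f" f] by simp
qed (use assms in \<open>auto simp: Hom_def\<close>)

lemma shift_full:
  assumes "A \<in> Obj K" "B \<in> Obj K" "h \<in> Hom K (ShiftO K A) (ShiftO K B)"
  obtains f where "f \<in> Hom K A B" "ShiftA K f = h"
proof -
  have "bij_betw (ShiftA K) (Hom K A B) (Hom K (ShiftO K A) (ShiftO K B))"
    using shift_autoequivalence assms unfolding autoequivalence_def by blast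
  then have "h \<in> ShiftA K ` Hom K A B" using assms(3) by (simp add: bij_betw_def)
  then show ?thesis using that by auto
qed

lemma shift_faithful:
  assumes "f \<in> Hom K A B" "g \<in> Hom K A B" "ShiftA K f = ShiftA K g"
  shows "f = g"
proof -
  have "bij_betw (ShiftA K) (Hom K A B) (Hom K (ShiftO K A) (ShiftO K B))"
    using shift_autoequivalence HomD[OF assms(1)] unfolding autoequivalence_def by blast
  then show ?thesis using assms unfolding bij_betw_def by (meson inj_onD)
qed

lemma shift_null_imp:
  assumes "f \<in> Hom K A B" "ShiftA K f = Null K (ShiftO K A) (ShiftO K B)"
  shows "f = Null K A B"
  using shift_faithful[OF assms(1) Null_hom] assms HomD[OF assms(1)] by auto

lemma shift_ess_surj:
  assumes "B \<in> Obj K"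
  obtains A where "A \<in> Obj K" "isomorphic K (ShiftO K A) B"
  using shift_autoequivalence assms unfolding autoequivalence_def by blast

lemma zero_shift:
  assumes "zero_object K Z"
  shows "zero_object K (ShiftO K Z)"
  using assms unfolding zero_object_iff by (metis shift_idn shift_null shift_obj)

lemma zero_unshift:
  assumes "zero_object K (ShiftO K Z)" "Z \<in> Obj K"
  shows "zero_object K Z"
  using assms shift_null_imp[of "Idn K Z" Z Z] ide_hom unfolding zero_object_iff by auto

lemma triangleD:
  assumes "distinguished K A B C f g h"
  shows "f \<in> Hom K A B" "g \<in> Hom K B C" "h \<in> Hom K C (ShiftO K A)"
    "f \<in> Arr K" "Dom K f = A" "Cod K f = B"
    "g \<in> Arr K" "Dom K g = B" "Cod K g = C"
    "h \<in> Arr K" "Dom K h = C" "Cod K h = ShiftO K A"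
    "A \<in> Obj K" "B \<in> Obj K" "C \<in> Obj K"
  using assms HomD unfolding distinguished_def candidate_triangle_def by blast+

lemma triangle_rot:
  assumes "distinguished K A B C f g h"
  shows "distinguished K B C (ShiftO K A) g h (Neg K (ShiftA K f))"
proof -
  have "inv\<^bsub>hom_group K (ShiftO K A) (ShiftO K B)\<^esub> (ShiftA K f) = Neg K (ShiftA K f)"
    by (rule neg_inv) (use triangleD[OF assms] in \<open>simp add: Hom_def\<close>)
  then show ?thesis
    using triangle_rotate[of A B C f g h] assms unfolding distinguished_def by auto
qed

lemma triangle_unrot:
  assumes "distinguished K B C (ShiftO K A) g h (Neg K (ShiftA K f))" "f \<in> Hom K A B"
  shows "distinguished K A B C f g h"
proof -
  have "inv\<^bsub>hom_group K (ShiftO K A) (ShiftO K B)\<^esub> (ShiftA K f) = Neg K (ShiftA K f)"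
    by (rule neg_inv) (use HomD[OF assms(2)] in \<open>simp add: Hom_def\<close>)
  then show ?thesis
    using triangle_rotate[of A B C f g h] assms triangleD[OF assms(1)]
    unfolding candidate_triangle_def by auto
qed

text \<open>The pair \<open>Idn K A\<close>, \<open>f\<close> extends to a map from the triangle on
  the identity of \<open>A\<close>, whose third object is zero; so \<open>g \<cdot> f\<close>
  factors through a zero object.\<close>

lemma triangle_comp_null:
  assumes "distinguished K A B C f g h"
  shows "g \<cdot> f = Null K A C"
proof -
  note D = triangleD[OF assms]
  obtain Z where Z: "zero_object K Z" using zero_object_exists by blast
  note Zo = zero_object_obj[OF Z]
  obtain c where "c \<in> Hom K Z C"
     "triangle_map K (Idn K A, Null K A Z, Null K Z (ShiftO K A)) (f, g, h) (Idn K A) f c"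
    using triangle_map_complete[OF triangle_ide[OF D(13) Z] assms, of "Idn K A" f] D ide_hom by auto
  then show ?thesis using D Zo HomD[of c Z C] unfolding triangle_map_def by auto
qed

lemma triangle_comp_null':
  assumes "distinguished K A B C f g h"
  shows "h \<cdot> g = Null K B (ShiftO K A)" "ShiftA K f \<cdot> h = Null K C (ShiftO K B)"
proof -
  note D = triangleD[OF assms]
  note r = triangle_rot[OF assms]
  show "h \<cdot> g = Null K B (ShiftO K A)" using triangle_comp_null[OF r] .
  have "Neg K (ShiftA K f) \<cdot> h = Null K C (ShiftO K B)"
    using triangle_comp_null[OF triangle_rot[OF r]] .
  then show "ShiftA K f \<cdot> h = Null K C (ShiftO K B)"
    using D by - (rule neg_eq_null, auto simp: Hom_def)
qed

text \<open>Exactness of the covariant hom functor. Since the completion axiom supplies third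
  arrows, both triangles are rotated: \<open>x\<close> and a zero arrow are completed by an arrow
  between shifts, and fullness of the shift takes it back to \<open>y\<close>.\<close>

lemma triangle_lift:
  assumes T: "distinguished K A B C f g h" and x: "x \<in> Hom K X B" "g \<cdot> x = Null K X C"
  obtains y where "y \<in> Hom K X A" "x = f \<cdot> y"
proof -
  note D = triangleD[OF T] and X = HomD[OF x(1)]
  obtain Z where Z: "zero_object K Z" using zero_object_exists by blast
  note Zo = zero_object_obj[OF Z]
  have T1: "distinguished K X Z (ShiftO K X) (Null K X Z) (Null K Z (ShiftO K X))
     (Neg K (Idn K (ShiftO K X)))"
    using triangle_rot[OF triangle_ide[OF X(4) Z]] X by simp
  obtain c where c: "c \<in> Hom K (ShiftO K X) (ShiftO K A)" and
    m: "triangle_map K (Null K X Z, Null K Z (ShiftO K X), Neg K (Idn K (ShiftO K X)))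
      (g, h, Neg K (ShiftA K f)) x (Null K Z C) c"
    using triangle_map_complete[OF T1 triangle_rot[OF T], of x "Null K Z C"] x X D Zo Null_hom
    by auto
  obtain y where y: "y \<in> Hom K X A" "ShiftA K y = c"
    using shift_full[OF X(4) D(13) c] .
  note Y = HomD[OF y(1)]
  \<comment> \<open>Both connecting arrows carry a sign from the rotation, and the signs
    cancel.\<close>
  have "Neg K (ShiftA K x) = Neg K (ShiftA K f \<cdot> c)"
    using m D X HomD[OF c] unfolding triangle_map_def by auto
  then have "ShiftA K x = ShiftA K f \<cdot> c"
    using neg_neg[of "ShiftA K x"] neg_neg[of "ShiftA K f \<cdot> c"] D(4,5,6) X(1) HomD(1,3)[OF c]
    by (metis arr_comp(1) shift_arr)
  also have "c = ShiftA K y" using y by simp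
  also have "ShiftA K f \<cdot> ShiftA K y = ShiftA K (f \<cdot> y)" using D(4,5) Y(1,3) by simp
  finally have "ShiftA K x = ShiftA K (f \<cdot> y)" .
  then have "x = f \<cdot> y" using x D Y by - (rule shift_faithful, auto simp: Hom_def)
  then show ?thesis using that y by blast
qed

text \<open>Exactness of the contravariant hom functor: the arrow is completed towards a triangle
  \<open>Z \<rightarrow> X \<rightarrow> X\<close> with \<open>Z\<close> zero, obtained by rotating
  the identity triangle back.\<close>

lemma triangle_extend:
  assumes T: "distinguished K A B C f g h" and x: "x \<in> Hom K B X" "x \<cdot> f = Null K A X"
  obtains y where "y \<in> Hom K C X" "x = y \<cdot> g"
proof -
  note D = triangleD[OF T] and X = HomD[OF x(1)]
  obtain Z where Z: "zero_object K Z" using zero_object_exists by blast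
  note Zo = zero_object_obj[OF Z]
  have T1: "distinguished K Z X X (Null K Z X) (Idn K X) (Null K X (ShiftO K Z))"
  proof (rule triangle_unrot)
    have "Neg K (ShiftA K (Null K Z X)) = Null K (ShiftO K Z) (ShiftO K X)"
      using Zo X by simp
    then show "distinguished K X X (ShiftO K Z) (Idn K X) (Null K X (ShiftO K Z))
       (Neg K (ShiftA K (Null K Z X)))"
      using triangle_ide[OF X(5) zero_shift[OF Z]] by simp
  qed (use Null_hom Zo X in auto)
  obtain c where c: "c \<in> Hom K C X" and
    m: "triangle_map K (f, g, h) (Null K Z X, Idn K X, Null K X (ShiftO K Z)) (Null K A Z) x c"
    using triangle_map_complete[OF T T1, of "Null K A Z" x] x X D Zo Null_hom by auto
  have "x = c \<cdot> g" using m X unfolding triangle_map_def by auto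
  then show ?thesis using that c by blast
qed

lemma triangle_lift':
  assumes T: "distinguished K A B C f g h" and x: "x \<in> Hom K X C" "h \<cdot> x = Null K X (ShiftO K A)"
  obtains y where "y \<in> Hom K X B" "x = g \<cdot> y"
  using triangle_lift[OF triangle_rot[OF T] x] by blast

lemma triangle_extend':
  assumes T: "distinguished K A B C f g h" and x: "x \<in> Hom K C X" "x \<cdot> g = Null K B X"
  obtains y where "y \<in> Hom K (ShiftO K A) X" "x = y \<cdot> h"
  using triangle_extend[OF triangle_rot[OF T] x] by blast

text \<open>The axioms complete an arrow only in first position. The third object \<open>D\<close>
  of that completion is replaced by an isomorphic shift, the shift being surjective on objects only
  up to isomorphism, and the result is rotated back.\<close>

lemma triangle_fiber:
  assumes g: "g \<in> Hom K B C"
  obtains A f h where "distinguished K A B C f g h"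
proof -
  obtain D u v where T: "distinguished K B C D g u v" using triangle_complete[OF g] by blast
  note D = triangleD[OF T]
  obtain A where A: "A \<in> Obj K" "isomorphic K (ShiftO K A) D" using shift_ess_surj[OF D(15)] by blast
  obtain a b where ab: "a \<in> Hom K (ShiftO K A) D" "b \<in> Hom K D (ShiftO K A)"
    "b \<cdot> a = Idn K (ShiftO K A)" "a \<cdot> b = Idn K D"
    using A(2) by (rule isomorphicE)
  note AB = HomD[OF ab(1)] HomD[OF ab(2)]
  have va: "v \<cdot> a \<in> Hom K (ShiftO K A) (ShiftO K B)" using D AB by (auto simp: Hom_def)
  obtain f where f: "f \<in> Hom K A B" "ShiftA K f = v \<cdot> a" using shift_full[OF A(1) D(13) va] .
  note F = HomD[OF f(1)]
  have "distinguished K B C (ShiftO K A) g (b \<cdot> u) (v \<cdot> a)"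
  proof (rule triangle_iso[OF T])
    show "candidate_triangle K B C (ShiftO K A) g (b \<cdot> u) (v \<cdot> a)"
      unfolding candidate_triangle_def using D AB by (auto simp: Hom_def)
    show "isomorphism K D (ShiftO K A) b"
      using ab unfolding isomorphism_def inverse_arrows_def by blast
    show "triangle_map K (g, u, v) (g, b \<cdot> u, v \<cdot> a) (Idn K B) (Idn K C) b"
      using D AB ab unfolding triangle_map_def by auto
  qed (use isomorphism_Idn D in auto)
  \<comment> \<open>Rotating back introduces a sign, so the first arrow of the triangle is the
    negative of \<open>f\<close>.\<close>
  moreover have "v \<cdot> a = Neg K (ShiftA K (Neg K f))"
    by (metis neg_neg shift_neg shift_arr(1) f(2) F(1))
  ultimately have "distinguished K A B C (Neg K f) g (b \<cdot> u)"
    using triangle_unrot[OF _ neg_hom[OF f(1)]] by metis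
  then show ?thesis using that by blast
qed

lemma triangle_of_iso:
  assumes f: "isomorphism K A B f" and Z: "zero_object K Z"
  shows "distinguished K A B Z f (Null K B Z) (Null K Z (ShiftO K A))"
proof -
  obtain g where g: "f \<in> Hom K A B" "g \<in> Hom K B A" "g \<cdot> f = Idn K A" "f \<cdot> g = Idn K B"
    using f by (rule isomorphismE)
  note F = HomD[OF g(1)] and Zo = zero_object_obj[OF Z]
  show ?thesis
  proof (rule triangle_iso[OF triangle_ide[OF F(4) Z]])
    show "candidate_triangle K A B Z f (Null K B Z) (Null K Z (ShiftO K A))"
      unfolding candidate_triangle_def using g Null_hom F Zo by auto
    show "triangle_map K (Idn K A, Null K A Z, Null K Z (ShiftO K A))
     (f, Null K B Z, Null K Z (ShiftO K A)) (Idn K A) f (Idn K Z)"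
      unfolding triangle_map_def using F Zo by auto
  qed (use isomorphism_Idn F f Zo in auto)
qed

text \<open>A split monomorphism has its cone as a complement. Thick subcategories are defined
  through biproducts while the arguments below produce retracts; this lemma passes between the
  two.\<close>

lemma retract_biproduct:
  assumes i: "i \<in> Hom K A M" and p: "p \<in> Hom K M A" and pi: "p \<cdot> i = Idn K A"
  obtains B f g where "distinguished K A M B i f g" "biproduct K A B M"
proof -
  obtain B f g where T: "distinguished K A M B i f g" using triangle_complete[OF i] by blast
  note D = triangleD[OF T] and P = HomD[OF p]
  \<comment> \<open>\<open>ShiftA K i\<close> is split by \<open>ShiftA K p\<close> and composes
    with \<open>g\<close> to zero, so the connecting arrow vanishes.\<close>
  have "g = Null K B (ShiftO K A)"
  proof -
    have "ShiftA K p \<cdot> ShiftA K i = Idn K (ShiftO K A)"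
      using shift_comp[of i p] pi D P by simp
    then have "ShiftA K p \<cdot> ShiftA K i \<cdot> g = Idn K (ShiftO K A) \<cdot> g"
      using D P by (intro comp_subst) auto
    then show ?thesis using triangle_comp_null'(2)[OF T] D P by simp
  qed
  note g = this
  have epi: "y = Null K B Y" if y: "y \<in> Hom K B Y" "y \<cdot> f = Null K M Y" for y Y
  proof -
    obtain z where "z \<in> Hom K (ShiftO K A) Y" "y = z \<cdot> g" using triangle_extend'[OF T y] .
    then show ?thesis using g HomD[of z] D by auto
  qed
  \<comment> \<open>The complementary idempotent kills \<open>i\<close>, hence factors as
    \<open>z \<cdot> f\<close>; since \<open>f\<close> is epic by \<open>epi\<close>, the arrow
    \<open>z\<close> includes the complement.\<close>
  define e where "e = Idn K M \<boxplus> Neg K (i \<cdot> p)"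
  have e: "e \<in> Hom K M M" unfolding e_def using D P by (auto simp: Hom_def)
  have "e \<cdot> i = i \<boxplus> Neg K i" unfolding e_def using D P pi by simp
  then have ei: "e \<cdot> i = Null K A M" using D by simp
  obtain z where z: "z \<in> Hom K B M" "e = z \<cdot> f" using triangle_extend[OF T e ei] .
  note Z = HomD[OF z(1)]
  have "f \<cdot> e = f"
    unfolding e_def using D P comp_subst[OF triangle_comp_null[OF T], of p] by simp
  then have "((f \<cdot> z) \<boxplus> Neg K (Idn K B)) \<cdot> f = f \<boxplus> Neg K f"
    using D Z z by simp
  then have "((f \<cdot> z) \<boxplus> Neg K (Idn K B)) = Null K B B"
    using D Z by - (rule epi, auto simp: Hom_def)
  then have fz: "f \<cdot> z = Idn K B" using D Z by - (rule eq_if_diff_null, auto simp: Hom_def)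
  have "i \<cdot> p \<boxplus> z \<cdot> f = (z \<cdot> f) \<boxplus> (i \<cdot> p)" using D P Z by (intro plus_comm) auto
  also have "\<dots> = Idn K M \<boxplus> (Neg K (i \<cdot> p) \<boxplus> (i \<cdot> p))"
    unfolding z(2)[symmetric] e_def using D P by (intro plus_assoc) auto
  also have "\<dots> = Idn K M" using D P by simp
  finally have "biproduct K A B M"
    unfolding biproduct_def using i p pi z fz D by blast
  then show ?thesis using that T by blast
qed

end

section \<open>Triangulated subcategories\<close>

text \<open>The part of a thick ideal that does not mention the tensor product. It serves equally
  for compact objects, localizing subcategories, and the ideals of \<open>K\<close> and of its
  compact part.\<close>

definition thick_subcategory :: "('o, 'm) mtcat \<Rightarrow> 'o set \<Rightarrow> bool" where
  "thick_subcategory K I \<longleftrightarrow> triangulated_subcategory K I \<and>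
     (\<forall>A B M. biproduct K A B M \<and> M \<in> I \<longrightarrow> A \<in> I \<and> B \<in> I)"

context triangulated_category
begin

lemma thick_subcategoryD:
  assumes "thick_subcategory K I"
  shows "A \<in> I \<Longrightarrow> A \<in> Obj K" "A \<in> Obj K \<Longrightarrow> ShiftO K A \<in> I \<longleftrightarrow> A \<in> I"
    "distinguished K A B C f g h \<Longrightarrow> A \<in> I \<Longrightarrow> B \<in> I \<Longrightarrow> C \<in> I"
    "distinguished K A B C f g h \<Longrightarrow> B \<in> I \<Longrightarrow> C \<in> I \<Longrightarrow> A \<in> I"
    "distinguished K A B C f g h \<Longrightarrow> A \<in> I \<Longrightarrow> C \<in> I \<Longrightarrow> B \<in> I"
    "biproduct K A B M \<Longrightarrow> M \<in> I \<Longrightarrow> A \<in> I" "biproduct K A B M \<Longrightarrow> M \<in> I \<Longrightarrow> B \<in> I"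
  using assms unfolding thick_subcategory_def triangulated_subcategory_def by blast+

lemma thick_zero:
  assumes "thick_subcategory K I" "zero_object K Z"
  shows "Z \<in> I"
proof -
  obtain A where A: "A \<in> I"
    using assms(1) unfolding thick_subcategory_def triangulated_subcategory_def by blast
  then have "A \<in> Obj K" using thick_subcategoryD(1)[OF assms(1)] by blast
  then show ?thesis
    using thick_subcategoryD(3)[OF assms(1) triangle_ide[OF _ assms(2)]] A by blast
qed

lemma thick_iso:
  assumes "thick_subcategory K I" "isomorphic K A B" "A \<in> I"
  shows "B \<in> I"
proof -
  obtain f where f: "isomorphism K A B f" using assms(2) unfolding isomorphic_def by blast
  obtain Z where Z: "zero_object K Z" using zero_object_exists by blast
  show ?thesis
    using thick_subcategoryD(5)[OF assms(1) triangle_of_iso[OF f Z] assms(3) thick_zero[OF assms(1) Z]] .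
qed

lemma thick_retract:
  assumes "thick_subcategory K I" "i \<in> Hom K A M" "p \<in> Hom K M A" "p \<cdot> i = Idn K A" "M \<in> I"
  shows "A \<in> I"
  using retract_biproduct[OF assms(2-4)] thick_subcategoryD(6)[OF assms(1)] assms(5) by metis

text \<open>Closure under cones and shifts gives two out of three, because rotation turns each of
  the other two objects into a cone up to shift.\<close>

lemma thick_subcategoryI:
  assumes "I \<subseteq> Obj K" "\<And>Z. zero_object K Z \<Longrightarrow> Z \<in> I"
    and "\<And>A. A \<in> Obj K \<Longrightarrow> ShiftO K A \<in> I \<longleftrightarrow> A \<in> I"
    and cone: "\<And>A B C f g h. distinguished K A B C f g h \<Longrightarrow> A \<in> I \<Longrightarrow> B \<in> I \<Longrightarrow> C \<in> I"
    and "\<And>A M i p. M \<in> I \<Longrightarrow> i \<in> Hom K A M \<Longrightarrow> p \<in> Hom K M A \<Longrightarrow> p \<cdot> i = Idn K A \<Longrightarrow> A \<in> I"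
  shows "thick_subcategory K I"
  unfolding thick_subcategory_def triangulated_subcategory_def
proof (intro conjI allI impI ballI)
  show "I \<noteq> {}" using assms(2) zero_object_exists by blast
  show "A \<in> I \<longleftrightarrow> ShiftO K A \<in> I" if "A \<in> Obj K" for A using assms(3) that by blast
next
  fix A B C f g h assume T: "distinguished K A B C f g h"
  show "C \<in> I" if "A \<in> I \<and> B \<in> I" using cone T that by blast
  show "A \<in> I" if "B \<in> I \<and> C \<in> I"
    using cone[OF triangle_rot[OF T]] assms(3) triangleD(13)[OF T] that by blast
  show "B \<in> I" if "A \<in> I \<and> C \<in> I"
    using cone[OF triangle_rot[OF triangle_rot[OF T]]] assms(3) triangleD(13,14)[OF T] that by blast
next
  fix A B M assume "biproduct K A B M \<and> M \<in> I"
  then show "A \<in> I" "B \<in> I" using assms(5) unfolding biproduct_def by blast+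
qed (use assms(1) in blast)

lemma thick_Inter:
  assumes "\<S> \<noteq> {}" "\<And>I. I \<in> \<S> \<Longrightarrow> thick_subcategory K I"
  shows "thick_subcategory K (\<Inter>\<S>)"
proof (rule thick_subcategoryI)
  show "\<Inter>\<S> \<subseteq> Obj K" using assms thick_subcategoryD(1) by blast
  show "Z \<in> \<Inter>\<S>" if "zero_object K Z" for Z using thick_zero that assms(2) by blast
  show "ShiftO K A \<in> \<Inter>\<S> \<longleftrightarrow> A \<in> \<Inter>\<S>" if "A \<in> Obj K" for A
    using thick_subcategoryD(2)[OF assms(2) that] by blast
  show "C \<in> \<Inter>\<S>" if "distinguished K A B C f g h" "A \<in> \<Inter>\<S>" "B \<in> \<Inter>\<S>" for A B C f g h
    using thick_subcategoryD(3)[OF assms(2) that(1)] that(2,3) by blast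
  show "A \<in> \<Inter>\<S>" if "M \<in> \<Inter>\<S>" "i \<in> Hom K A M" "p \<in> Hom K M A" "p \<cdot> i = Idn K A" for A M i p
    using thick_retract[OF assms(2) that(2-4)] that(1) by blast
qed

text \<open>By the octahedral axiom the cone of a composite is an extension of the two
  cones.\<close>

lemma thick_cone_comp:
  assumes I: "thick_subcategory K I" and "distinguished K A B D f u u'" "distinguished K B C F g v v'"
    "D \<in> I" "F \<in> I"
  obtains E w w' where "distinguished K A C E (g \<cdot> f) w w'" "E \<in> I"
proof -
  have "g \<cdot> f \<in> Hom K A C" using triangleD[OF assms(2)] triangleD[OF assms(3)] by (simp add: Hom_def)
  then obtain E w w' where T: "distinguished K A C E (g \<cdot> f) w w'" using triangle_complete by blast
  then show ?thesis
    using octahedral[OF assms(2,3) T] thick_subcategoryD(5)[OF I] assms(4,5) that by blast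
qed

lemma zero_thick: "thick_subcategory K {Z. zero_object K Z}"
proof (rule thick_subcategoryI)
  fix A B C f g h assume T: "distinguished K A B C f g h" and "A \<in> {Z. zero_object K Z}"
    "B \<in> {Z. zero_object K Z}"
  then have A: "zero_object K A" and B: "zero_object K B" by auto
  note D = triangleD[OF T]
  \<comment> \<open>As \<open>g\<close> vanishes, the identity of \<open>C\<close> factors through
    \<open>h\<close>, hence through the zero object \<open>ShiftO K A\<close>.\<close>
  have "g = Null K B C" using hom_from_zero[OF B D(2)] .
  then have "Idn K C \<cdot> g = Null K B C" using D by simp
  then obtain k where k: "k \<in> Hom K (ShiftO K A) C" "Idn K C = k \<cdot> h"
    using triangle_extend'[OF T ide_hom[OF D(15)]] by blast
  have "k = Null K (ShiftO K A) C" using hom_from_zero[OF zero_shift[OF A] k(1)] .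
  then show "C \<in> {Z. zero_object K Z}" using k D unfolding zero_object_iff by simp
next
  show "A \<in> {Z. zero_object K Z}" if "M \<in> {Z. zero_object K Z}" "i \<in> Hom K A M" "p \<in> Hom K M A"
    "p \<cdot> i = Idn K A" for A M i p
    using that zero_object_retract by blast
  show "ShiftO K A \<in> {Z. zero_object K Z} \<longleftrightarrow> A \<in> {Z. zero_object K Z}" if "A \<in> Obj K" for A
    using that zero_shift zero_unshift by blast
qed (use zero_object_obj in blast)+

end

section \<open>Coproducts and compact objects\<close>

text \<open>\<open>x\<close> factors through the part of the coproduct \<open>S\<close> indexed by \<open>F\<close>, expressed by testing
  against arrows out of \<open>S\<close> in order to avoid finite sums of arrows.\<close>

definition supported_on ::
  "('o, 'm) mtcat \<Rightarrow> 'o \<Rightarrow> ('i \<Rightarrow> 'm) \<Rightarrow> 'i set \<Rightarrow> 'm \<Rightarrow> bool" where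
  "supported_on K S \<iota> F x \<longleftrightarrow> (\<forall>T. \<forall>u \<in> Hom K S T.
     (\<forall>i\<in>F. Comp K u (\<iota> i) = Null K (Dom K (\<iota> i)) T) \<longrightarrow> Comp K u x = Null K (Dom K x) T)"

context category
begin

lemma comp_subst_hom:
  assumes "g \<cdot> f = h" "f \<in> Hom K A B" "g \<in> Hom K B C" "x \<in> Hom K X A"
  shows "g \<cdot> (f \<cdot> x) = h \<cdot> x"
  using comp_assoc[OF assms(4,2,3)] assms(1) by simp

end

context additive_category
begin

lemma coproductD:
  assumes "coproduct K I M S \<iota>"
  shows "S \<in> Obj K" "i \<in> I \<Longrightarrow> M i \<in> Obj K" "i \<in> I \<Longrightarrow> \<iota> i \<in> Hom K (M i) S"
    "i \<in> I \<Longrightarrow> \<iota> i \<in> Arr K" "i \<in> I \<Longrightarrow> Dom K (\<iota> i) = M i" "i \<in> I \<Longrightarrow> Cod K (\<iota> i) = S"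
  using assms HomD unfolding coproduct_def by blast+

lemma coproduct_desc:
  assumes "coproduct K I M S \<iota>" "T \<in> Obj K" "\<And>i. i \<in> I \<Longrightarrow> g i \<in> Hom K (M i) T"
  obtains u where "u \<in> Hom K S T" "\<And>i. i \<in> I \<Longrightarrow> u \<cdot> \<iota> i = g i"
  using assms unfolding coproduct_def by blast

lemma coproduct_ext:
  assumes C: "coproduct K I M S \<iota>" and "u \<in> Hom K S T" "v \<in> Hom K S T"
    "\<And>i. i \<in> I \<Longrightarrow> u \<cdot> \<iota> i = v \<cdot> \<iota> i"
  shows "u = v"
proof -
  have "T \<in> Obj K" using assms(2) HomD by blast
  then have "\<forall>g. (\<forall>i\<in>I. g i \<in> Hom K (M i) T) \<longrightarrow>
      (\<exists>!w. w \<in> Hom K S T \<and> (\<forall>i\<in>I. w \<cdot> \<iota> i = g i))"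
    using C unfolding coproduct_def by blast
  from this[rule_format, of "\<lambda>i. u \<cdot> \<iota> i"]
  have "\<exists>!w. w \<in> Hom K S T \<and> (\<forall>i\<in>I. w \<cdot> \<iota> i = u \<cdot> \<iota> i)"
    using coproductD(3)[OF C] assms(2) comp_hom by blast
  moreover have "\<forall>i\<in>I. v \<cdot> \<iota> i = u \<cdot> \<iota> i" using assms(4) by simp
  ultimately show ?thesis using assms(2,3) by blast
qed

lemma coproductI:
  assumes "S \<in> Obj K" "\<And>i. i \<in> I \<Longrightarrow> \<iota> i \<in> Hom K (M i) S"
    and "\<And>T g. T \<in> Obj K \<Longrightarrow> \<forall>i\<in>I. g i \<in> Hom K (M i) T \<Longrightarrow>
        \<exists>u \<in> Hom K S T. \<forall>i\<in>I. u \<cdot> \<iota> i = g i"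
    and "\<And>T u v. u \<in> Hom K S T \<Longrightarrow> v \<in> Hom K S T \<Longrightarrow> \<forall>i\<in>I. u \<cdot> \<iota> i = v \<cdot> \<iota> i \<Longrightarrow> u = v"
  shows "coproduct K I M S \<iota>"
  unfolding coproduct_def
proof (intro conjI ballI allI impI)
  fix i assume "i \<in> I" then show "M i \<in> Obj K" using assms(2) HomD by blast
next
  fix T g assume "T \<in> Obj K" and g: "\<forall>i\<in>I. g i \<in> Hom K (M i) T"
  then obtain u where u: "u \<in> Hom K S T" "\<forall>i\<in>I. u \<cdot> \<iota> i = g i" using assms(3) by blast
  show "\<exists>!u. u \<in> Hom K S T \<and> (\<forall>i\<in>I. u \<cdot> \<iota> i = g i)"
  proof (rule ex1I[of _ u])
    show "v = u" if "v \<in> Hom K S T \<and> (\<forall>i\<in>I. v \<cdot> \<iota> i = g i)" for v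
      using assms(4)[of v T u] u that by simp
  qed (use u in blast)
qed (use assms(1,2) in blast)+

lemma coproduct_reindex:
  assumes "bij_betw \<phi> J I" "coproduct K I M S \<iota>"
  shows "coproduct K J (\<lambda>j. M (\<phi> j)) S (\<lambda>j. \<iota> (\<phi> j))"
proof (rule coproductI)
  have \<phi>: "\<phi> j \<in> I" if "j \<in> J" for j using assms(1) that by (auto simp: bij_betw_def)
  show "S \<in> Obj K" using coproductD[OF assms(2)] by blast
  show "\<iota> (\<phi> j) \<in> Hom K (M (\<phi> j)) S" if "j \<in> J" for j using coproductD(3)[OF assms(2)] \<phi> that by blast
next
  fix T g assume T: "T \<in> Obj K" and g: "\<forall>j\<in>J. g j \<in> Hom K (M (\<phi> j)) T"
  let ?\<psi> = "inv_into J \<phi>"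
  have \<psi>: "?\<psi> i \<in> J" "\<phi> (?\<psi> i) = i" if "i \<in> I" for i
    using assms(1) that by (auto simp: bij_betw_def inv_into_into f_inv_into_f)
  have "g (?\<psi> i) \<in> Hom K (M i) T" if "i \<in> I" for i using g \<psi>[OF that] by metis
  then obtain u where u: "u \<in> Hom K S T" "\<And>i. i \<in> I \<Longrightarrow> u \<cdot> \<iota> i = g (?\<psi> i)"
    using coproduct_desc[OF assms(2) T, of "\<lambda>i. g (?\<psi> i)"] by blast
  have "u \<cdot> \<iota> (\<phi> j) = g j" if "j \<in> J" for j
  proof -
    have "\<phi> j \<in> I" "?\<psi> (\<phi> j) = j" using assms(1) that by (auto simp: bij_betw_def)
    then show ?thesis using u(2) by metis
  qed
  then show "\<exists>u\<in>Hom K S T. \<forall>j\<in>J. u \<cdot> \<iota> (\<phi> j) = g j" using u by blast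
next
  fix T u v assume "u \<in> Hom K S T" "v \<in> Hom K S T" "\<forall>j\<in>J. u \<cdot> \<iota> (\<phi> j) = v \<cdot> \<iota> (\<phi> j)"
  then show "u = v"
    using coproduct_ext[OF assms(2), of u T v] assms(1) by (auto simp: bij_betw_def)
qed

lemma coproduct_cong:
  assumes "\<And>i. i \<in> I \<Longrightarrow> M i = M' i" "\<And>i. i \<in> I \<Longrightarrow> \<iota> i = \<iota>' i"
  shows "coproduct K I M S \<iota> \<longleftrightarrow> coproduct K I M' S \<iota>'"
  using assms unfolding coproduct_def by simp

lemma coproduct_proj:
  assumes C: "coproduct K I M S \<iota>"
  obtains p where "\<And>i. i \<in> I \<Longrightarrow> p i \<in> Hom K S (M i)" "\<And>i. i \<in> I \<Longrightarrow> p i \<cdot> \<iota> i = Idn K (M i)"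
    "\<And>i j. i \<in> I \<Longrightarrow> j \<in> I \<Longrightarrow> i \<noteq> j \<Longrightarrow> p i \<cdot> \<iota> j = Null K (M j) (M i)"
proof -
  have "\<exists>u \<in> Hom K S (M i). \<forall>j\<in>I. u \<cdot> \<iota> j = (if i = j then Idn K (M i) else Null K (M j) (M i))"
    if "i \<in> I" for i
    by (rule coproduct_desc[OF C coproductD(2)[OF C that],
         of "\<lambda>j. if i = j then Idn K (M i) else Null K (M j) (M i)"])
       (use coproductD(2)[OF C] that in \<open>auto simp: Hom_def\<close>)
  then obtain p where "\<And>i. i \<in> I \<Longrightarrow> p i \<in> Hom K S (M i) \<and>
     (\<forall>j\<in>I. p i \<cdot> \<iota> j = (if i = j then Idn K (M i) else Null K (M j) (M i)))" by metis
  then show ?thesis using that[of p] by simp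
qed

section \<open>Arrows into a coproduct that have finite support\<close>

lemma supported_onD:
  assumes "supported_on K S \<iota> F x" "u \<in> Hom K S T" "x \<in> Hom K C S"
    "\<And>i. i \<in> F \<Longrightarrow> u \<cdot> \<iota> i = Null K (Dom K (\<iota> i)) T"
  shows "u \<cdot> x = Null K C T"
  using assms HomD(2)[OF assms(3)] unfolding supported_on_def by blast

lemma supported_onI:
  assumes "x \<in> Hom K C S"
    "\<And>T u. u \<in> Hom K S T \<Longrightarrow> \<forall>i\<in>F. u \<cdot> \<iota> i = Null K (Dom K (\<iota> i)) T \<Longrightarrow> u \<cdot> x = Null K C T"
  shows "supported_on K S \<iota> F x"
  using assms HomD(2)[OF assms(1)] unfolding supported_on_def by blast

lemma supported_on_comp:
  assumes "supported_on K S \<iota> F x" "x \<in> Hom K C S" "y \<in> Hom K B C"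
  shows "supported_on K S \<iota> F (x \<cdot> y)"
proof (rule supported_onI)
  note D = HomD[OF assms(2)] HomD[OF assms(3)]
  show "x \<cdot> y \<in> Hom K B S" using D by (auto simp: Hom_def)
  fix T u assume u: "u \<in> Hom K S T" "\<forall>i\<in>F. u \<cdot> \<iota> i = Null K (Dom K (\<iota> i)) T"
  have "u \<cdot> x = Null K C T" using supported_onD[OF assms(1) u(1) assms(2)] u(2) by blast
  then show "u \<cdot> x \<cdot> y = Null K B T" using comp_subst[of u x "Null K C T" y] D HomD[OF u(1)] by simp
qed

lemma supported_on_plus:
  assumes "supported_on K S \<iota> F x" "x \<in> Hom K C S" "supported_on K S \<iota> F y" "y \<in> Hom K C S"
  shows "supported_on K S \<iota> F (x \<boxplus> y)"
proof (rule supported_onI)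
  note D = HomD[OF assms(2)] HomD[OF assms(4)]
  show "x \<boxplus> y \<in> Hom K C S" using D by (auto simp: Hom_def)
  fix T u assume u: "u \<in> Hom K S T" "\<forall>i\<in>F. u \<cdot> \<iota> i = Null K (Dom K (\<iota> i)) T"
  have "u \<cdot> x = Null K C T" "u \<cdot> y = Null K C T"
    using supported_onD[OF assms(1) u(1) assms(2)] supported_onD[OF assms(3) u(1) assms(4)] u(2)
    by blast+
  then show "u \<cdot> (x \<boxplus> y) = Null K C T" using D HomD[OF u(1)] by simp
qed

lemma supported_on_neg:
  assumes "supported_on K S \<iota> F x" "x \<in> Hom K C S"
  shows "supported_on K S \<iota> F (Neg K x)"
proof (rule supported_onI)
  note D = HomD[OF assms(2)]
  show "Neg K x \<in> Hom K C S" using D by (auto simp: Hom_def)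
  fix T u assume u: "u \<in> Hom K S T" "\<forall>i\<in>F. u \<cdot> \<iota> i = Null K (Dom K (\<iota> i)) T"
  have "u \<cdot> x = Null K C T"
    using supported_onD[OF assms(1) u(1) assms(2)] u(2) by blast
  then show "u \<cdot> Neg K x = Null K C T" using D HomD[OF u(1)] by simp
qed

lemma supported_on_inj:
  assumes "i \<in> F" "\<iota> i \<in> Hom K M S" "y \<in> Hom K C M"
  shows "supported_on K S \<iota> F (\<iota> i \<cdot> y)"
proof (rule supported_onI)
  note D = HomD[OF assms(2)] HomD[OF assms(3)]
  show "\<iota> i \<cdot> y \<in> Hom K C S" using D by (auto simp: Hom_def)
  fix T u assume u: "u \<in> Hom K S T" "\<forall>i\<in>F. u \<cdot> \<iota> i = Null K (Dom K (\<iota> i)) T"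
  have "u \<cdot> \<iota> i = Null K M T" using u(2) assms(1) D by simp
  then show "u \<cdot> \<iota> i \<cdot> y = Null K C T"
    using comp_subst[of u "\<iota> i" "Null K M T" y] D HomD[OF u(1)] by simp
qed

lemma supported_on_mono: "supported_on K S \<iota> F x \<Longrightarrow> F \<subseteq> G \<Longrightarrow> supported_on K S \<iota> G x"
  unfolding supported_on_def by blast

lemma supported_on_empty:
  assumes "supported_on K S \<iota> {} x" "x \<in> Hom K C S"
  shows "x = Null K C S"
proof -
  note D = HomD[OF assms(2)]
  have "Idn K S \<cdot> x = Null K C S"
    by (rule supported_onD[OF assms(1) _ assms(2)]) (use D ide_hom in auto)
  then show ?thesis using D by simp
qed

text \<open>A test arrow \<open>u\<close> that kills the injections in \<open>F\<close> is replaced by \<open>u - u \<iota>\<^sub>i p\<close>.\<close>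

lemma supported_on_drop:
  assumes x: "supported_on K S \<iota> (insert i F) x" "x \<in> Hom K C S" and "i \<notin> F"
    and \<iota>: "\<And>j. j \<in> insert i F \<Longrightarrow> \<iota> j \<in> Hom K (M j) S"
    and p: "p \<in> Hom K S (M i)" "p \<cdot> \<iota> i = Idn K (M i)"
      "\<And>j. j \<in> F \<Longrightarrow> p \<cdot> \<iota> j = Null K (M j) (M i)"
    and px: "p \<cdot> x = Null K C (M i)"
  shows "supported_on K S \<iota> F x"
proof (rule supported_onI[OF x(2)])
  note X = HomD[OF x(2)] and P = HomD[OF p(1)] and \<iota>i = HomD[OF \<iota>[of i, simplified]]
  fix T u assume u: "u \<in> Hom K S T" "\<forall>i\<in>F. u \<cdot> \<iota> i = Null K (Dom K (\<iota> i)) T"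
  note U = HomD[OF u(1)]
  define v where "v = u \<boxplus> Neg K (u \<cdot> \<iota> i \<cdot> p)"
  have v: "v \<in> Hom K S T" unfolding v_def using U P \<iota>i by (auto simp: Hom_def)
  have "v \<cdot> \<iota> j = Null K (Dom K (\<iota> j)) T" if "j \<in> insert i F" for j
  proof (cases "j = i")
    case True
    then show ?thesis unfolding v_def using U P \<iota>i p(2) by simp
  next
    case False
    then have j: "j \<in> F" using that by simp
    note J = HomD[OF \<iota>[OF that]]
    show ?thesis unfolding v_def using U P \<iota>i J p(3)[OF j] u(2) j by simp
  qed
  then have "v \<cdot> x = Null K C T" by (rule supported_onD[OF x(1) v x(2)])
  then show "u \<cdot> x = Null K C T" unfolding v_def using U P \<iota>i px X by simp
qed

text \<open>The projections of an infinite coproduct need not be jointly monic; a finite support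
  lets the coordinates be removed one at a time until nothing remains.\<close>

lemma supported_on_zero:
  assumes C: "coproduct K I M S \<iota>" and "finite F" "F \<subseteq> I" "supported_on K S \<iota> F x" "x \<in> Hom K C S"
    and p: "\<And>i. i \<in> I \<Longrightarrow> p i \<in> Hom K S (M i)" "\<And>i. i \<in> I \<Longrightarrow> p i \<cdot> \<iota> i = Idn K (M i)"
    "\<And>i j. i \<in> I \<Longrightarrow> j \<in> I \<Longrightarrow> i \<noteq> j \<Longrightarrow> p i \<cdot> \<iota> j = Null K (M j) (M i)"
    and px: "\<And>i. i \<in> F \<Longrightarrow> p i \<cdot> x = Null K C (M i)"
  shows "x = Null K C S"
  using assms(2-4) px
proof (induction F rule: finite_induct)
  case empty
  then show ?case using supported_on_empty assms(5) by blast
next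
  case (insert i F)
  have i: "i \<in> I" "F \<subseteq> I" using insert.prems(1) by auto
  have "p i \<cdot> \<iota> j = Null K (M j) (M i)" if "j \<in> F" for j
    using p(3)[of i j] i insert.hyps(2) that by blast
  then have "supported_on K S \<iota> F x"
    using supported_on_drop[OF insert.prems(2) assms(5) insert.hyps(2), of M "p i"] i
      coproductD(3)[OF C] p(1,2)[of i] insert.prems(3)[of i] by blast
  then show ?case using insert.IH i insert.prems(3) by blast
qed

text \<open>The hom groups are written multiplicatively, so \<open>finprod\<close> stands for a
  finite sum of arrows.\<close>

lemma comp_finprod:
  assumes "finite F" "S \<in> Obj K" "C \<in> Obj K" "h \<in> F \<rightarrow> Hom K C S" "u \<in> Hom K S T"
  shows "(\<And>i. i \<in> F \<Longrightarrow> u \<cdot> h i = Null K C T) \<Longrightarrow> u \<cdot> finprod (hom_group K C S) h F = Null K C T"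
    and "\<And>j. j \<in> F \<Longrightarrow> (\<And>i. i \<in> F \<Longrightarrow> i \<noteq> j \<Longrightarrow> u \<cdot> h i = Null K C T) \<Longrightarrow>
      u \<cdot> finprod (hom_group K C S) h F = u \<cdot> h j"
proof -
  interpret comm_group "hom_group K C S" using hom_comm_group assms by blast
  note U = HomD[OF assms(5)]
  have 1: "(\<forall>i \<in> G. u \<cdot> h i = Null K C T) \<Longrightarrow> u \<cdot> finprod (hom_group K C S) h G = Null K C T"
    if "G \<subseteq> F" for G
    using finite_subset[OF that assms(1)] that
  proof (induction G rule: finite_induct)
    case empty
    then show ?case using U assms by simp
  next
    case (insert i G)
    then have i: "h i \<in> Hom K C S" "h \<in> G \<rightarrow> Hom K C S" using assms(4) by auto
    then have f: "finprod (hom_group K C S) h G \<in> Hom K C S" using finprod_closed[of h G] by simp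
    show ?case using insert i HomD[OF i(1)] HomD[OF f] U by simp
  qed
  then show "(\<And>i. i \<in> F \<Longrightarrow> u \<cdot> h i = Null K C T) \<Longrightarrow> u \<cdot> finprod (hom_group K C S) h F = Null K C T"
    by blast
  fix j assume j: "j \<in> F" "\<And>i. i \<in> F \<Longrightarrow> i \<noteq> j \<Longrightarrow> u \<cdot> h i = Null K C T"
  have F: "F = insert j (F - {j})" using j by blast
  have h: "h j \<in> Hom K C S" "h \<in> (F - {j}) \<rightarrow> Hom K C S" using assms(4) j by auto
  then have f: "finprod (hom_group K C S) h (F - {j}) \<in> Hom K C S"
    using finprod_closed[of h "F - {j}"] by simp
  have "finprod (hom_group K C S) h F = h j \<boxplus> finprod (hom_group K C S) h (F - {j})"
    using finprod_insert[of "F - {j}" j h] h assms(1) F by simp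
  moreover have "u \<cdot> finprod (hom_group K C S) h (F - {j}) = Null K C T" using 1[of "F - {j}"] j by blast
  ultimately show "u \<cdot> finprod (hom_group K C S) h F = u \<cdot> h j"
    using HomD[OF h(1)] HomD[OF f] U by simp
qed

text \<open>The canonical map from the direct sum is always injective, because projections recover
  the coordinates. So compactness amounts to surjectivity, and an arrow lies in the image exactly
  when it has finite support.\<close>

lemma compact_object_iff:
  "compact_object \<kappa> K C \<longleftrightarrow> C \<in> Obj K \<and>
     (\<forall>(I :: 'u set) M S \<iota>. small (\<kappa> :: 'u rel) I \<and> coproduct K I M S \<iota> \<longrightarrow>
        (\<forall>x \<in> Hom K C S. \<exists>F. finite F \<and> F \<subseteq> I \<and> supported_on K S \<iota> F x))"
proof -
  have "(\<lambda>f. gfinprod (hom_group K C S) (\<lambda>i. \<iota> i \<cdot> f i) I)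
          \<in> iso (sum_group I (\<lambda>i. hom_group K C (M i))) (hom_group K C S) \<longleftrightarrow>
        (\<forall>x \<in> Hom K C S. \<exists>F. finite F \<and> F \<subseteq> I \<and> supported_on K S \<iota> F x)"
    (is "?h \<in> iso ?A ?B \<longleftrightarrow> ?R")
    if C: "C \<in> Obj K" and S: "coproduct K I M S \<iota>" for I :: "'u set" and M S \<iota>
  proof -
    note D = coproductD[OF S]
    interpret comm_group ?B using hom_comm_group C D by blast
    have grp: "group (hom_group K C (M i))" if "i \<in> I" for i
      using hom_comm_group[OF C D(2)[OF that]] comm_group_def by blast
    have car: "carrier ?A = {f \<in> \<Pi>\<^sub>E i\<in>I. Hom K C (M i). finite {i \<in> I. f i \<noteq> Null K C (M i)}}"
      using carrier_sum_group[of I "\<lambda>i. hom_group K C (M i)"] grp by simp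
    have ih: "\<iota> i \<cdot> y \<in> Hom K C S" if "i \<in> I" "y \<in> Hom K C (M i)" for i y
      using comp_hom[OF that(2) D(3)[OF that(1)]] .
    have "(\<lambda>y. \<iota> i \<cdot> y) \<in> hom (hom_group K C (M i)) ?B" if "i \<in> I" for i
    proof -
      have "(\<lambda>y. \<iota> i \<cdot> y) \<in> Hom K C (M i) \<rightarrow> Hom K C S" using ih[OF that] by blast
      moreover have "\<forall>x\<in>Hom K C (M i). \<forall>y\<in>Hom K C (M i). \<iota> i \<cdot> (x \<boxplus> y) = (\<iota> i \<cdot> x) \<boxplus> (\<iota> i \<cdot> y)"
        using comp_plus_right[OF _ _ D(3)[OF that]] by blast
      ultimately show ?thesis unfolding hom_def by simp
    qed
    then have hom: "?h \<in> hom ?A ?B"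
      by (rule hom_group_sum[OF _ grp])
    \<comment> \<open>Over an arbitrary index set \<open>gfinprod\<close> collapses to a product
      over the finitely many nonzero coordinates.\<close>
    have fp: "?h f = finprod ?B (\<lambda>i. \<iota> i \<cdot> f i) {i \<in> I. f i \<noteq> Null K C (M i)}"
      "finite {i \<in> I. f i \<noteq> Null K C (M i)}" if f: "f \<in> carrier ?A" for f
    proof -
      let ?F = "{i \<in> I. f i \<noteq> Null K C (M i)}"
      have f': "f i \<in> Hom K C (M i)" if "i \<in> I" for i using f car that by auto
      show fin: "finite ?F" using f car by auto
      have z: "\<iota> i \<cdot> Null K C (M i) = Null K C S" if "i \<in> I" for i using D(2,4,5,6)[of i] D(1) that C by simp
      have "?h f = gfinprod ?B (\<lambda>i. \<iota> i \<cdot> f i) ?F"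
        by (rule gfinprod_mono_neutral_cong_right) (use fin z f' ih in auto)
      also have "\<dots> = finprod ?B (\<lambda>i. \<iota> i \<cdot> f i) ?F"
        by (rule gfinprod_eq_finprod) (use fin f' ih in auto)
      finally show "?h f = finprod ?B (\<lambda>i. \<iota> i \<cdot> f i) ?F" .
    qed
    obtain p where p: "\<And>i. i \<in> I \<Longrightarrow> p i \<in> Hom K S (M i)"
      "\<And>i. i \<in> I \<Longrightarrow> p i \<cdot> \<iota> i = Idn K (M i)"
      "\<And>i j. i \<in> I \<Longrightarrow> j \<in> I \<Longrightarrow> i \<noteq> j \<Longrightarrow> p i \<cdot> \<iota> j = Null K (M j) (M i)"
      using coproduct_proj[OF S] by blast
    have pi: "p j \<cdot> \<iota> i \<cdot> y = (if i = j then y else Null K C (M j))"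
      if "i \<in> I" "j \<in> I" "y \<in> Hom K C (M i)" for i j y
    proof (cases "i = j")
      case True
      then show ?thesis
        using comp_subst_hom[OF p(2) D(3) p(1) that(3)] that HomD[OF that(3)] by simp
    next
      case False
      then show ?thesis
        using comp_subst_hom[OF p(3) D(3) p(1) that(3)] that HomD[OF that(3)] D(2) by simp
    qed
    have ph: "p j \<cdot> ?h f = f j" if f: "f \<in> carrier ?A" and j: "j \<in> I" for f j
    proof -
      let ?F = "{i \<in> I. f i \<noteq> Null K C (M i)}"
      have f': "f i \<in> Hom K C (M i)" if "i \<in> I" for i using f car that by auto
      have h: "(\<lambda>i. \<iota> i \<cdot> f i) \<in> ?F \<rightarrow> Hom K C S" using ih f' by auto
      note c = comp_finprod[OF fp(2)[OF f] D(1) C h p(1)[OF j]]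
      show ?thesis
      proof (cases "j \<in> ?F")
        case True
        then have "p j \<cdot> ?h f = p j \<cdot> \<iota> j \<cdot> f j"
          using c(2)[OF True] pi j f' unfolding fp(1)[OF f] by auto
        then show ?thesis using pi j f' by simp
      next
        case False
        then have "p j \<cdot> ?h f = Null K C (M j)"
          using c(1) pi j f' unfolding fp(1)[OF f] by force
        then show ?thesis using False j by simp
      qed
    qed
    have inj: "inj_on ?h (carrier ?A)"
    proof (rule inj_onI)
      fix f g assume fg: "f \<in> carrier ?A" "g \<in> carrier ?A" "?h f = ?h g"
      have "f j = g j" if "j \<in> I" for j
        using ph[OF fg(1) that] ph[OF fg(2) that] unfolding fg(3) by (rule trans[OF sym])
      moreover have "f \<in> (\<Pi>\<^sub>E i\<in>I. Hom K C (M i))" "g \<in> (\<Pi>\<^sub>E i\<in>I. Hom K C (M i))"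
        using fg(1,2) unfolding car by blast+
      ultimately show "f = g" using PiE_ext by blast
    qed
    have uz: "u \<cdot> \<iota> i \<cdot> y = Null K C T" if "u \<in> Hom K S T" "u \<cdot> \<iota> i = Null K (Dom K (\<iota> i)) T"
      "i \<in> I" "y \<in> Hom K C (M i)" for u T i y
      using comp_subst_hom[OF that(2) D(3)[OF that(3)] that(1,4)] D(5)[OF that(3)]
        HomD[OF that(4)] HomD[OF that(1)] by simp
    have hC: "?h f \<in> Hom K C S" if "f \<in> carrier ?A" for f using hom that unfolding hom_def by auto
    have sup: "supported_on K S \<iota> {i \<in> I. f i \<noteq> Null K C (M i)} (?h f)" if f: "f \<in> carrier ?A" for f
    proof (rule supported_onI[OF hC[OF f]])
      let ?F = "{i \<in> I. f i \<noteq> Null K C (M i)}"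
      have f': "f i \<in> Hom K C (M i)" if "i \<in> I" for i using f car that by auto
      have h: "(\<lambda>i. \<iota> i \<cdot> f i) \<in> ?F \<rightarrow> Hom K C S" using ih f' by auto
      fix T u assume u: "u \<in> Hom K S T" "\<forall>i\<in>?F. u \<cdot> \<iota> i = Null K (Dom K (\<iota> i)) T"
      show "u \<cdot> ?h f = Null K C T"
        unfolding fp(1)[OF f]
      proof (rule comp_finprod(1)[OF fp(2)[OF f] D(1) C h u(1)])
        fix i assume "i \<in> ?F"
        then show "u \<cdot> \<iota> i \<cdot> f i = Null K C T" using uz[OF u(1)] u(2) f' by blast
      qed
    qed
    have "?h ` carrier ?A = Hom K C S \<longleftrightarrow> ?R"
    proof
      assume im: "?h ` carrier ?A = Hom K C S"
      show ?R
      proof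
        fix x assume x: "x \<in> Hom K C S"
        then have "x \<in> ?h ` carrier ?A" unfolding im .
        then obtain f where f: "f \<in> carrier ?A" "x = ?h f" by (rule imageE)
        show "\<exists>F. finite F \<and> F \<subseteq> I \<and> supported_on K S \<iota> F x"
          using fp(2)[OF f(1)] sup[OF f(1)] unfolding f(2)
          by (intro exI[of _ "{i \<in> I. f i \<noteq> Null K C (M i)}"]) simp
      qed
    next
      assume R: ?R
      show "?h ` carrier ?A = Hom K C S"
      proof
        show "?h ` carrier ?A \<subseteq> Hom K C S" using hom unfolding hom_def by auto
        show "Hom K C S \<subseteq> ?h ` carrier ?A"
        proof
          fix x assume x: "x \<in> Hom K C S"
          then obtain F where F: "finite F" "F \<subseteq> I" "supported_on K S \<iota> F x" using R by blast
          \<comment> \<open>The preimage of \<open>x\<close> consists of its coordinates on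
            \<open>F\<close> and zero on the rest of \<open>I\<close>. The difference between
            \<open>x\<close> and its image is supported on \<open>F\<close> and has all coordinates
            there equal to zero.\<close>
          define f where "f = (\<lambda>i\<in>I. if i \<in> F then p i \<cdot> x else Null K C (M i))"
          have f': "f i \<in> Hom K C (M i)" if "i \<in> I" for i
            unfolding f_def using comp_hom[OF x p(1)] Null_hom C D that by auto
          have fA: "f \<in> carrier ?A" unfolding car
          proof (intro CollectI conjI)
            show "f \<in> (\<Pi>\<^sub>E i\<in>I. Hom K C (M i))" using f' unfolding f_def by auto
            show "finite {i \<in> I. f i \<noteq> Null K C (M i)}"
              by (rule finite_subset[OF _ F(1)]) (auto simp: f_def)
          qed
          have hf: "?h f \<in> Hom K C S" using hC[OF fA] .
          have "{i \<in> I. f i \<noteq> Null K C (M i)} \<subseteq> F" by (auto simp: f_def)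
          with sup[OF fA] have hs: "supported_on K S \<iota> F (?h f)" by (rule supported_on_mono)
          have "x \<boxplus> Neg K (?h f) = Null K C S"
          proof (rule supported_on_zero[OF S F(1,2)])
            show "supported_on K S \<iota> F (x \<boxplus> Neg K (?h f))"
              by (rule supported_on_plus[OF F(3) x supported_on_neg[OF hs hf] neg_hom[OF hf]])
            show "x \<boxplus> Neg K (?h f) \<in> Hom K C S" by (rule plus_hom[OF x neg_hom[OF hf]])
            fix i assume i: "i \<in> F"
            then have "i \<in> I" using F by blast
            have "f i = p i \<cdot> x" using i \<open>i \<in> I\<close> by (simp add: f_def)
            then have pf: "p i \<cdot> ?h f = p i \<cdot> x" using ph[OF fA \<open>i \<in> I\<close>] by (rule trans[rotated])
            note P = HomD[OF p(1)[OF \<open>i \<in> I\<close>]] and Y = HomD[OF hf] and X = HomD[OF x]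
            have "p i \<cdot> (x \<boxplus> Neg K (?h f)) = (p i \<cdot> x) \<boxplus> (p i \<cdot> Neg K (?h f))"
              by (rule comp_plus) (simp_all only: P Y X arr_neg)
            also have "p i \<cdot> Neg K (?h f) = Neg K (p i \<cdot> ?h f)"
              by (rule comp_neg) (simp_all only: P Y)
            also have "(p i \<cdot> x) \<boxplus> Neg K (p i \<cdot> ?h f) = Null K C (M i)"
              unfolding pf using P X by simp
            finally show "p i \<cdot> (x \<boxplus> Neg K (?h f)) = Null K C (M i)" .
          qed (use p in blast)+
          then have "x = ?h f" by (rule eq_if_diff_null[OF x hf])
          then show "x \<in> ?h ` carrier ?A" using fA by (rule image_eqI)
        qed
      qed
    qed
    then show ?thesis using hom inj unfolding iso_def bij_betw_def by simp
  qed
  then show ?thesis unfolding compact_object_def by (auto simp del: ball_simps)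
qed

end

lemma (in category) inverse_cancel:
  assumes "a \<cdot> b = Idn K B" "b \<in> Hom K B A" "a \<in> Hom K A B" "x \<in> Hom K X B"
  shows "a \<cdot> (b \<cdot> x) = x"
  using comp_subst_hom[OF assms] HomD[OF assms(4)] by simp

lemma (in triangulated_category) shift_ess_surj_arrows:
  assumes "B \<in> Obj K"
  obtains A a b where "A \<in> Obj K" "a \<in> Hom K (ShiftO K A) B" "b \<in> Hom K B (ShiftO K A)"
    "b \<cdot> a = Idn K (ShiftO K A)" "a \<cdot> b = Idn K B"
  using shift_ess_surj[OF assms] by (metis isomorphicE)

section \<open>Compactness under shifts, cones and retracts\<close>

context triangulated_category
begin

text \<open>The shift is only an equivalence, so a test object is first replaced by an isomorphic
  shift \<open>ShiftO K T'\<close>; arrows into it can then be desuspended.\<close>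

lemma coproduct_shift:
  assumes C: "coproduct K I M S \<iota>"
  shows "coproduct K I (\<lambda>i. ShiftO K (M i)) (ShiftO K S) (\<lambda>i. ShiftA K (\<iota> i))"
proof (rule coproductI)
  note D = coproductD[OF C]
  show "ShiftO K S \<in> Obj K" using D(1) by simp
  show "ShiftA K (\<iota> i) \<in> Hom K (ShiftO K (M i)) (ShiftO K S)" if "i \<in> I" for i
    using shift_hom D(3) that by blast
next
  note D = coproductD[OF C]
  fix T g assume T: "T \<in> Obj K" and g: "\<forall>i\<in>I. g i \<in> Hom K (ShiftO K (M i)) T"
  obtain T' a b where T': "T' \<in> Obj K" and ab: "a \<in> Hom K (ShiftO K T') T" "b \<in> Hom K T (ShiftO K T')"
    "b \<cdot> a = Idn K (ShiftO K T')" "a \<cdot> b = Idn K T" using shift_ess_surj_arrows[OF T] .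
  have "\<exists>g'. g' \<in> Hom K (M i) T' \<and> ShiftA K g' = b \<cdot> g i" if "i \<in> I" for i
    using shift_full[OF D(2)[OF that] T' comp_hom[OF _ ab(2)]] g that by blast
  then obtain g' where g': "\<And>i. i \<in> I \<Longrightarrow> g' i \<in> Hom K (M i) T'"
    "\<And>i. i \<in> I \<Longrightarrow> ShiftA K (g' i) = b \<cdot> g i" by metis
  obtain u where u: "u \<in> Hom K S T'" "\<And>i. i \<in> I \<Longrightarrow> u \<cdot> \<iota> i = g' i"
    using coproduct_desc[OF C T' g'(1)] by blast
  note U = HomD[OF u(1)] and A = HomD[OF ab(1)]
  have "(a \<cdot> ShiftA K u) \<cdot> ShiftA K (\<iota> i) = g i" if i: "i \<in> I" for i
  proof -
    have "(a \<cdot> ShiftA K u) \<cdot> ShiftA K (\<iota> i) = a \<cdot> ShiftA K (u \<cdot> \<iota> i)"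
      using U A D(4-6)[OF i] by simp
    also have "\<dots> = a \<cdot> b \<cdot> g i" using u g' i by simp
    also have "\<dots> = g i" using inverse_cancel[OF ab(4,2,1)] g i by blast
    finally show ?thesis .
  qed
  moreover have "a \<cdot> ShiftA K u \<in> Hom K (ShiftO K S) T" using U A by (simp add: Hom_def)
  ultimately show "\<exists>u\<in>Hom K (ShiftO K S) T. \<forall>i\<in>I. u \<cdot> ShiftA K (\<iota> i) = g i" by blast
next
  note D = coproductD[OF C]
  fix T u v assume u: "u \<in> Hom K (ShiftO K S) T" and v: "v \<in> Hom K (ShiftO K S) T"
    and e: "\<forall>i\<in>I. u \<cdot> ShiftA K (\<iota> i) = v \<cdot> ShiftA K (\<iota> i)"
  obtain T' a b where T': "T' \<in> Obj K" and ab: "a \<in> Hom K (ShiftO K T') T" "b \<in> Hom K T (ShiftO K T')"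
    "b \<cdot> a = Idn K (ShiftO K T')" "a \<cdot> b = Idn K T" using shift_ess_surj_arrows HomD(5)[OF u] .
  obtain u' where u': "u' \<in> Hom K S T'" "ShiftA K u' = b \<cdot> u"
    using shift_full[OF D(1) T' comp_hom[OF u ab(2)]] .
  obtain v' where v': "v' \<in> Hom K S T'" "ShiftA K v' = b \<cdot> v"
    using shift_full[OF D(1) T' comp_hom[OF v ab(2)]] .
  have "u' \<cdot> \<iota> i = v' \<cdot> \<iota> i" if i: "i \<in> I" for i
  proof (rule shift_faithful)
    show "u' \<cdot> \<iota> i \<in> Hom K (M i) T'" "v' \<cdot> \<iota> i \<in> Hom K (M i) T'"
      using comp_hom[OF D(3)[OF i]] u' v' by blast+
    have "ShiftA K (u' \<cdot> \<iota> i) = (b \<cdot> u) \<cdot> ShiftA K (\<iota> i)"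
      using u'(2) HomD[OF u'(1)] D(4-6)[OF i] by (subst shift_comp) auto
    also have "\<dots> = b \<cdot> (u \<cdot> ShiftA K (\<iota> i))"
      using HomD[OF u] HomD[OF ab(2)] D(4-6)[OF i] by (intro comp_assoc') auto
    also have "\<dots> = b \<cdot> (v \<cdot> ShiftA K (\<iota> i))" using e i by simp
    also have "\<dots> = (b \<cdot> v) \<cdot> ShiftA K (\<iota> i)"
      using HomD[OF v] HomD[OF ab(2)] D(4-6)[OF i] by (intro comp_assoc'[symmetric]) auto
    also have "\<dots> = ShiftA K (v' \<cdot> \<iota> i)"
      using v'(2) HomD[OF v'(1)] D(4-6)[OF i] by (subst shift_comp) auto
    finally show "ShiftA K (u' \<cdot> \<iota> i) = ShiftA K (v' \<cdot> \<iota> i)" .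
  qed
  then have "u' = v'" by (rule coproduct_ext[OF C u'(1) v'(1)])
  then have "a \<cdot> b \<cdot> u = a \<cdot> b \<cdot> v" using u' v' by simp
  then show "u = v" using inverse_cancel[OF ab(4,2,1)] u v by metis
qed

text \<open>Every coproduct is, up to isomorphism, the shift of a coproduct of desuspended objects.
  The isomorphisms on the summands are returned as well, since the injections have to be
  compared.\<close>

lemma coproduct_unshift:
  assumes C: "coproduct K I M S \<iota>"
  obtains T a b M' \<iota>' \<alpha> \<beta> where "coproduct K I M' T \<iota>'"
    "a \<in> Hom K (ShiftO K T) S" "b \<in> Hom K S (ShiftO K T)"
    "b \<cdot> a = Idn K (ShiftO K T)" "a \<cdot> b = Idn K S"
    "\<forall>i\<in>I. \<alpha> i \<in> Hom K (ShiftO K (M' i)) (M i)"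
    "\<forall>i\<in>I. \<beta> i \<in> Hom K (M i) (ShiftO K (M' i))"
    "\<forall>i\<in>I. \<alpha> i \<cdot> \<beta> i = Idn K (M i)"
    "\<forall>i\<in>I. \<beta> i \<cdot> \<alpha> i = Idn K (ShiftO K (M' i))"
    "\<forall>i\<in>I. ShiftA K (\<iota>' i) = b \<cdot> \<iota> i \<cdot> \<alpha> i"
proof -
  note D = coproductD[OF C]
  obtain T a b where T: "T \<in> Obj K" and ab: "a \<in> Hom K (ShiftO K T) S" "b \<in> Hom K S (ShiftO K T)"
    "b \<cdot> a = Idn K (ShiftO K T)" "a \<cdot> b = Idn K S" using shift_ess_surj_arrows[OF D(1)] .
  have "\<exists>M' \<alpha> \<beta>. M' \<in> Obj K \<and> \<alpha> \<in> Hom K (ShiftO K M') (M i) \<and> \<beta> \<in> Hom K (M i) (ShiftO K M') \<and>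
    \<beta> \<cdot> \<alpha> = Idn K (ShiftO K M') \<and> \<alpha> \<cdot> \<beta> = Idn K (M i)" if "i \<in> I" for i
    using shift_ess_surj_arrows[OF D(2)[OF that]] by metis
  then obtain M' \<alpha> \<beta> where M': "\<And>i. i \<in> I \<Longrightarrow> M' i \<in> Obj K"
    and \<alpha>: "\<And>i. i \<in> I \<Longrightarrow> \<alpha> i \<in> Hom K (ShiftO K (M' i)) (M i)"
    and \<beta>: "\<And>i. i \<in> I \<Longrightarrow> \<beta> i \<in> Hom K (M i) (ShiftO K (M' i))"
    and \<beta>\<alpha>: "\<And>i. i \<in> I \<Longrightarrow> \<beta> i \<cdot> \<alpha> i = Idn K (ShiftO K (M' i))"
    and \<alpha>\<beta>: "\<And>i. i \<in> I \<Longrightarrow> \<alpha> i \<cdot> \<beta> i = Idn K (M i)"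
    by metis
  have "\<exists>h. h \<in> Hom K (M' i) T \<and> ShiftA K h = b \<cdot> \<iota> i \<cdot> \<alpha> i" if "i \<in> I" for i
    using shift_full[OF M'[OF that] T comp_hom[OF comp_hom[OF \<alpha>[OF that] D(3)[OF that]] ab(2)]] by blast
  then obtain \<iota>' where \<iota>': "\<And>i. i \<in> I \<Longrightarrow> \<iota>' i \<in> Hom K (M' i) T"
    and s: "\<And>i. i \<in> I \<Longrightarrow> ShiftA K (\<iota>' i) = b \<cdot> \<iota> i \<cdot> \<alpha> i" by metis
  have "coproduct K I M' T \<iota>'"
  proof (rule coproductI[OF T \<iota>'])
    fix U g assume U: "U \<in> Obj K" and g: "\<forall>i\<in>I. g i \<in> Hom K (M' i) U"
    have h: "ShiftA K (g i) \<cdot> \<beta> i \<in> Hom K (M i) (ShiftO K U)" if "i \<in> I" for i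
      using comp_hom[OF \<beta>[OF that] shift_hom] g that by blast
    obtain u where u: "u \<in> Hom K S (ShiftO K U)" "\<And>i. i \<in> I \<Longrightarrow> u \<cdot> \<iota> i = ShiftA K (g i) \<cdot> \<beta> i"
      using coproduct_desc[OF C shift_obj[OF U] h] by blast
    obtain u' where u': "u' \<in> Hom K T U" "ShiftA K u' = u \<cdot> a"
      using shift_full[OF T U comp_hom[OF ab(1) u(1)]] .
    have "u' \<cdot> \<iota>' i = g i" if i: "i \<in> I" for i
    proof (rule shift_faithful)
      show "u' \<cdot> \<iota>' i \<in> Hom K (M' i) U" "g i \<in> Hom K (M' i) U"
        using comp_hom \<iota>'[OF i] u'(1) g i by blast+
      have ia: "\<iota> i \<cdot> \<alpha> i \<in> Hom K (ShiftO K (M' i)) S" using comp_hom \<alpha>[OF i] D(3)[OF i] by blast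
      have "ShiftA K (u' \<cdot> \<iota>' i) = (u \<cdot> a) \<cdot> (b \<cdot> \<iota> i \<cdot> \<alpha> i)"
        using s[OF i] u'(2) HomD[OF u'(1)] HomD[OF \<iota>'[OF i]] by (subst shift_comp) auto
      also have "\<dots> = u \<cdot> (a \<cdot> (b \<cdot> \<iota> i \<cdot> \<alpha> i))"
        using comp_assoc[OF comp_hom[OF ia ab(2)] ab(1) u(1)] by simp
      also have "\<dots> = u \<cdot> \<iota> i \<cdot> \<alpha> i" using inverse_cancel[OF ab(4,2,1) ia] by simp
      also have "\<dots> = (ShiftA K (g i) \<cdot> \<beta> i) \<cdot> \<alpha> i"
        using comp_subst_hom[OF u(2)[OF i] D(3)[OF i] u(1) \<alpha>[OF i]] .
      also have "\<dots> = ShiftA K (g i)"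
        using \<beta>\<alpha>[OF i] HomD[OF \<alpha>[OF i]] HomD[OF \<beta>[OF i]] g[rule_format, OF i, THEN HomD(1)]
          g[rule_format, OF i, THEN HomD(2)] by simp
      finally show "ShiftA K (u' \<cdot> \<iota>' i) = ShiftA K (g i)" .
    qed
    then show "\<exists>u\<in>Hom K T U. \<forall>i\<in>I. u \<cdot> \<iota>' i = g i" using u' by blast
  next
    fix U u v assume u: "u \<in> Hom K T U" and v: "v \<in> Hom K T U" and e: "\<forall>i\<in>I. u \<cdot> \<iota>' i = v \<cdot> \<iota>' i"
    have "(ShiftA K w \<cdot> b) \<cdot> \<iota> i = ShiftA K (w \<cdot> \<iota>' i) \<cdot> \<beta> i" if i: "i \<in> I" and w: "w \<in> Hom K T U" for w i
    proof -
      note H = HomD[OF shift_hom[OF w]] HomD[OF ab(2)] D(4-6)[OF i] HomD[OF \<alpha>[OF i]] HomD[OF \<beta>[OF i]]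
      have "ShiftA K (w \<cdot> \<iota>' i) = ShiftA K w \<cdot> (b \<cdot> \<iota> i \<cdot> \<alpha> i)"
        unfolding s[OF i, symmetric] using HomD[OF w] HomD[OF \<iota>'[OF i]] by simp
      then have "ShiftA K (w \<cdot> \<iota>' i) \<cdot> \<beta> i = ShiftA K w \<cdot> b \<cdot> \<iota> i \<cdot> \<alpha> i \<cdot> \<beta> i" using H by simp
      then show ?thesis using H \<alpha>\<beta>[OF i] by simp
    qed
    then have "ShiftA K u \<cdot> b = ShiftA K v \<cdot> b"
      using coproduct_ext[OF C comp_hom[OF ab(2) shift_hom[OF u]] comp_hom[OF ab(2) shift_hom[OF v]]] u v e
      by simp
    then have "(ShiftA K u \<cdot> b) \<cdot> a = (ShiftA K v \<cdot> b) \<cdot> a" by simp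
    then have "ShiftA K u = ShiftA K v"
      using ab HomD[OF ab(1)] HomD[OF ab(2)] HomD[OF u] HomD[OF v] by simp
    then show "u = v" by (rule shift_faithful[OF u v])
  qed
  then show ?thesis
    by (rule that[OF _ ab]) (intro ballI, rule \<alpha> \<beta> \<alpha>\<beta> \<beta>\<alpha> s, assumption)+
qed

lemma compactD:
  assumes "compact_object (\<kappa> :: 'u rel) K C"
  shows "C \<in> Obj K" "\<And>(I :: 'u set) M S \<iota> x. small \<kappa> I \<Longrightarrow> coproduct K I M S \<iota> \<Longrightarrow> x \<in> Hom K C S \<Longrightarrow>
     \<exists>F. finite F \<and> F \<subseteq> I \<and> supported_on K S \<iota> F x"
  using assms unfolding compact_object_iff by blast+

lemma compactI:
  assumes "C \<in> Obj K" "\<And>(I :: 'u set) M S \<iota> x. small \<kappa> I \<Longrightarrow> coproduct K I M S \<iota> \<Longrightarrow> x \<in> Hom K C S \<Longrightarrow>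
     \<exists>F. finite F \<and> F \<subseteq> I \<and> supported_on K S \<iota> F x"
  shows "compact_object (\<kappa> :: 'u rel) K C"
  using assms unfolding compact_object_iff by blast

lemma compact_unshift:
  assumes "compact_object (\<kappa> :: 'u rel) K (ShiftO K A)" "A \<in> Obj K"
  shows "compact_object \<kappa> K A"
proof (rule compactI[OF assms(2)])
  fix I :: "'u set" and M S \<iota> x
  assume I: "small \<kappa> I" and C: "coproduct K I M S \<iota>" and x: "x \<in> Hom K A S"
  obtain F where F: "finite F" "F \<subseteq> I"
    "supported_on K (ShiftO K S) (\<lambda>i. ShiftA K (\<iota> i)) F (ShiftA K x)"
    using compactD(2)[OF assms(1) I coproduct_shift[OF C] shift_hom[OF x]] by blast
  have "supported_on K S \<iota> F x"
  proof (rule supported_onI[OF x])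
    fix T u assume u: "u \<in> Hom K S T" "\<forall>i\<in>F. u \<cdot> \<iota> i = Null K (Dom K (\<iota> i)) T"
    have "ShiftA K u \<cdot> ShiftA K x = Null K (ShiftO K A) (ShiftO K T)"
    proof (rule supported_onD[OF F(3) shift_hom[OF u(1)] shift_hom[OF x]])
      fix i assume i: "i \<in> F"
      then have "i \<in> I" using F by blast
      note D = coproductD(4-6)[OF C this] HomD[OF u(1)]
      have "ShiftA K u \<cdot> ShiftA K (\<iota> i) = ShiftA K (u \<cdot> \<iota> i)" using D by simp
      also have "\<dots> = ShiftA K (Null K (Dom K (\<iota> i)) T)" using u(2) i by simp
      also have "\<dots> = Null K (Dom K (ShiftA K (\<iota> i))) (ShiftO K T)"
        using D coproductD(2)[OF C \<open>i \<in> I\<close>] by simp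
      finally show "ShiftA K u \<cdot> ShiftA K (\<iota> i) = Null K (Dom K (ShiftA K (\<iota> i))) (ShiftO K T)" .
    qed
    then have "ShiftA K (u \<cdot> x) = Null K (ShiftO K A) (ShiftO K T)" 
      using HomD[OF u(1)] HomD[OF x] by simp
    then show "u \<cdot> x = Null K A T" by (rule shift_null_imp[OF comp_hom[OF x u(1)]])
  qed
  then show "\<exists>F. finite F \<and> F \<subseteq> I \<and> supported_on K S \<iota> F x" using F by blast
qed

text \<open>Desuspending the coproduct turns an arrow out of the shift into one out of
  \<open>A\<close>; its finite support is carried back through the isomorphisms \<open>a\<close>,
  \<open>b\<close> and \<open>\<alpha>\<close>.\<close>

lemma compact_shift:
  assumes "compact_object (\<kappa> :: 'u rel) K A"
  shows "compact_object \<kappa> K (ShiftO K A)"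
proof (rule compactI)
  have A: "A \<in> Obj K" using compactD(1)[OF assms] .
  then show "ShiftO K A \<in> Obj K" by simp
  fix I :: "'u set" and M S \<iota> x
  assume I: "small \<kappa> I" and C: "coproduct K I M S \<iota>" and x: "x \<in> Hom K (ShiftO K A) S"
  obtain T a b M' \<iota>' \<alpha> \<beta> where C': "coproduct K I M' T \<iota>'"
    and ab: "a \<in> Hom K (ShiftO K T) S" "b \<in> Hom K S (ShiftO K T)"
      "b \<cdot> a = Idn K (ShiftO K T)" "a \<cdot> b = Idn K S"
    and "\<forall>i\<in>I. \<alpha> i \<in> Hom K (ShiftO K (M' i)) (M i)"
      "\<forall>i\<in>I. \<beta> i \<in> Hom K (M i) (ShiftO K (M' i))"
      "\<forall>i\<in>I. \<alpha> i \<cdot> \<beta> i = Idn K (M i)"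
      "\<forall>i\<in>I. \<beta> i \<cdot> \<alpha> i = Idn K (ShiftO K (M' i))"
      "\<forall>i\<in>I. ShiftA K (\<iota>' i) = b \<cdot> \<iota> i \<cdot> \<alpha> i"
    by (rule coproduct_unshift[OF C])
  then have \<alpha>: "\<And>i. i \<in> I \<Longrightarrow> \<alpha> i \<in> Hom K (ShiftO K (M' i)) (M i)"
    and s: "\<And>i. i \<in> I \<Longrightarrow> ShiftA K (\<iota>' i) = b \<cdot> \<iota> i \<cdot> \<alpha> i"
    by blast+
  note D = coproductD[OF C] and D' = coproductD[OF C']
  obtain x' where x': "x' \<in> Hom K A T" "ShiftA K x' = b \<cdot> x"
    using shift_full[OF A D'(1) comp_hom[OF x ab(2)]] .
  obtain F where F: "finite F" "F \<subseteq> I" "supported_on K T \<iota>' F x'"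
    using compactD(2)[OF assms I C' x'(1)] by blast
  have "supported_on K S \<iota> F x"
  proof (rule supported_onI[OF x])
    fix U u assume u: "u \<in> Hom K S U" "\<forall>i\<in>F. u \<cdot> \<iota> i = Null K (Dom K (\<iota> i)) U"
    obtain U' c d where U': "U' \<in> Obj K" and cd: "c \<in> Hom K (ShiftO K U') U" "d \<in> Hom K U (ShiftO K U')"
      "d \<cdot> c = Idn K (ShiftO K U')" "c \<cdot> d = Idn K U" using shift_ess_surj_arrows HomD(5)[OF u(1)] .
    obtain u' where u': "u' \<in> Hom K T U'" "ShiftA K u' = d \<cdot> u \<cdot> a"
      using shift_full[OF D'(1) U' comp_hom[OF comp_hom[OF ab(1) u(1)] cd(2)]] .
    note H = HomD[OF ab(1)] HomD[OF ab(2)] HomD[OF cd(1)] HomD[OF cd(2)] HomD[OF u(1)] HomD[OF x]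
    have "u' \<cdot> x' = Null K A U'"
    proof (rule supported_onD[OF F(3) u'(1) x'(1)])
      fix i assume i': "i \<in> F"
      then have i: "i \<in> I" using F by blast
      note Di = D(4-6)[OF i] HomD[OF \<alpha>[OF i]]
      have "ShiftA K (u' \<cdot> \<iota>' i) = (d \<cdot> u \<cdot> a) \<cdot> (b \<cdot> \<iota> i \<cdot> \<alpha> i)"
        using u'(2) s[OF i] HomD[OF u'(1)] D'(4-6)[OF i] by (subst shift_comp) auto
      also have "\<dots> = d \<cdot> u \<cdot> (a \<cdot> (b \<cdot> \<iota> i \<cdot> \<alpha> i))" using H Di by simp
      also have "\<dots> = d \<cdot> u \<cdot> \<iota> i \<cdot> \<alpha> i"
        using inverse_cancel[OF ab(4,2,1) comp_hom[OF \<alpha>[OF i] D(3)[OF i]]] by simp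
      also have "\<dots> = Null K (ShiftO K (M' i)) (ShiftO K U')"
        using comp_subst[OF u(2)[rule_format, OF i'], of "\<alpha> i"] H Di by simp
      finally have "ShiftA K (u' \<cdot> \<iota>' i) = Null K (ShiftO K (M' i)) (ShiftO K U')" .
      then show "u' \<cdot> \<iota>' i = Null K (Dom K (\<iota>' i)) U'"
        using shift_null_imp[OF comp_hom[OF D'(3)[OF i] u'(1)]] D'(5)[OF i] by simp
    qed
    then have "ShiftA K (u' \<cdot> x') = Null K (ShiftO K A) (ShiftO K U')" using A U' by simp
    moreover have "ShiftA K (u' \<cdot> x') = (d \<cdot> u \<cdot> a) \<cdot> (b \<cdot> x)"
      using u'(2) x'(2) HomD[OF u'(1)] HomD[OF x'(1)] by (subst shift_comp) auto
    moreover have "(d \<cdot> u \<cdot> a) \<cdot> (b \<cdot> x) = d \<cdot> u \<cdot> x"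
      using H inverse_cancel[OF ab(4,2,1) x] by simp
    ultimately have "d \<cdot> u \<cdot> x = Null K (ShiftO K A) (ShiftO K U')" by simp
    then have "c \<cdot> d \<cdot> u \<cdot> x = Null K (ShiftO K A) U" using H A by simp
    then show "u \<cdot> x = Null K (ShiftO K A) U"
      using inverse_cancel[OF cd(4,2,1) comp_hom[OF x u(1)]] by simp
  qed
  then show "\<exists>F. finite F \<and> F \<subseteq> I \<and> supported_on K S \<iota> F x" using F by blast
qed

text \<open>A five lemma by hand: \<open>x\<close> is split into a part living on the finite support
  of \<open>x \<cdot> g\<close> and a remainder that factors through \<open>h\<close>, where
  compactness of the shift of \<open>A\<close> applies.\<close>

lemma compact_cone:
  assumes T: "distinguished K A B C f g h" and A: "compact_object (\<kappa> :: 'u rel) K A"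
    and B: "compact_object \<kappa> K B"
  shows "compact_object \<kappa> K C"
proof (rule compactI)
  note D = triangleD[OF T]
  show "C \<in> Obj K" using D by simp
  fix I :: "'u set" and M S \<iota> x
  assume I: "small \<kappa> I" and C: "coproduct K I M S \<iota>" and x: "x \<in> Hom K C S"
  note X = HomD[OF x] and DC = coproductD[OF C]
  obtain F where F: "finite F" "F \<subseteq> I" "supported_on K S \<iota> F (x \<cdot> g)"
    using compactD(2)[OF B I C comp_hom[OF D(2) x]] by blast
  have hom: "(if i \<in> F then \<iota> i else Null K (M i) S) \<in> Hom K (M i) S" if "i \<in> I" for i
    using DC that by (auto simp: Null_hom)
  \<comment> \<open>\<open>e\<close> is the projection onto the summands indexed by
    \<open>F\<close>, built from the universal property and so without a finite sum;
    \<open>d\<close> is the complementary projection.\<close>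
  obtain e where e: "e \<in> Hom K S S" "\<And>i. i \<in> I \<Longrightarrow> e \<cdot> \<iota> i = (if i \<in> F then \<iota> i else Null K (M i) S)"
    using coproduct_desc[OF C DC(1) hom] by blast
  note E = HomD[OF e(1)]
  define d where "d = Idn K S \<boxplus> Neg K e"
  have d: "d \<in> Hom K S S" unfolding d_def using E by (simp add: Hom_def)
  have "d \<cdot> x \<cdot> g = Null K B S"
  proof (rule supported_onD[OF F(3) d comp_hom[OF D(2) x]])
    fix i assume i: "i \<in> F"
    then have "i \<in> I" using F by blast
    then show "d \<cdot> \<iota> i = Null K (Dom K (\<iota> i)) S"
      unfolding d_def using E DC(4-6)[of i] e(2)[of i] i by simp
  qed
  then have "(d \<cdot> x) \<cdot> g = Null K B S" using HomD[OF d] X D by simp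
  then obtain k where k: "k \<in> Hom K (ShiftO K A) S" "d \<cdot> x = k \<cdot> h"
    using triangle_extend'[OF T comp_hom[OF x d]] by blast
  obtain F' where F': "finite F'" "F' \<subseteq> I" "supported_on K S \<iota> F' k"
    using compactD(2)[OF compact_shift[OF A] I C k(1)] by blast
  have "supported_on K S \<iota> (F \<union> F') x"
  proof (rule supported_onI[OF x])
    fix U u assume u: "u \<in> Hom K S U" "\<forall>i\<in>F \<union> F'. u \<cdot> \<iota> i = Null K (Dom K (\<iota> i)) U"
    note U = HomD[OF u(1)]
    \<comment> \<open>A test arrow that kills the injections in \<open>F\<close> kills
      \<open>e\<close>; one that kills those in \<open>F'\<close> kills \<open>k\<close> and hence
      \<open>d \<cdot> x\<close>. Since \<open>x\<close> is the sum of \<open>e \<cdot> x\<close>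
      and \<open>d \<cdot> x\<close>, it is killed too.\<close>
    have "u \<cdot> e = Null K S U"
    proof (rule coproduct_ext[OF C comp_hom[OF e(1) u(1)]])
      show "Null K S U \<in> Hom K S U" using U Null_hom by simp
      fix i assume i: "i \<in> I"
      show "(u \<cdot> e) \<cdot> \<iota> i = Null K S U \<cdot> \<iota> i"
        using U E DC(2,4-6)[OF i] e(2)[OF i] u(2) by (cases "i \<in> F") auto
    qed
    then have ue: "u \<cdot> e \<cdot> x = Null K C U" using comp_subst_hom[OF _ e(1) u(1) x] U X by simp
    have "u \<cdot> k = Null K (ShiftO K A) U"
      by (rule supported_onD[OF F'(3) u(1) k(1)]) (use u(2) in blast)
    then have "u \<cdot> d \<cdot> x = Null K C U"
      unfolding k(2) using comp_subst_hom[OF _ k(1) u(1) D(3)] D U by simp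
    then have "(u \<cdot> x) \<boxplus> Neg K (u \<cdot> e \<cdot> x) = Null K C U" unfolding d_def using U E X by simp
    then show "u \<cdot> x = Null K C U" unfolding ue using U X D by simp
  qed
  then show "\<exists>F. finite F \<and> F \<subseteq> I \<and> supported_on K S \<iota> F x"
    using F F' by (metis finite_UnI le_sup_iff)
qed

lemma compact_thick: "thick_subcategory K {C. compact_object (\<kappa> :: 'u rel) K C}"
proof (rule thick_subcategoryI)
  show "{C. compact_object \<kappa> K C} \<subseteq> Obj K" using compactD(1) by blast
  show "Z \<in> {C. compact_object \<kappa> K C}" if Z: "zero_object K Z" for Z
  proof (intro CollectI compactI)
    show "Z \<in> Obj K" using zero_object_obj[OF Z] .
    fix I :: "'u set" and M S x and \<iota> :: "'u \<Rightarrow> 'b" assume x: "x \<in> Hom K Z S"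
    have "supported_on K S \<iota> {} x"
      by (rule supported_onI[OF x]) (use hom_from_zero[OF Z] comp_hom x in blast)
    then show "\<exists>F. finite F \<and> F \<subseteq> I \<and> supported_on K S \<iota> F x" by blast
  qed
  show "A \<in> {C. compact_object \<kappa> K C}" if M: "M \<in> {C. compact_object \<kappa> K C}"
    and i: "i \<in> Hom K A M" and p: "p \<in> Hom K M A" and pi: "p \<cdot> i = Idn K A" for A M i p
  proof (intro CollectI compactI)
    show "A \<in> Obj K" using HomD[OF i] by simp
    fix I :: "'u set" and N S \<iota> x
    assume I: "small \<kappa> I" and C: "coproduct K I N S \<iota>" and x: "x \<in> Hom K A S"
    obtain F where F: "finite F" "F \<subseteq> I" "supported_on K S \<iota> F (x \<cdot> p)"
      using compactD(2)[OF M[simplified] I C comp_hom[OF p x]] by blast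
    have "(x \<cdot> p) \<cdot> i = x" using pi HomD[OF x] HomD[OF p] HomD[OF i] by simp
    then have "supported_on K S \<iota> F x"
      using supported_on_comp[OF F(3) comp_hom[OF p x] i] by simp
    then show "\<exists>F. finite F \<and> F \<subseteq> I \<and> supported_on K S \<iota> F x" using F by blast
  qed
qed (use compact_shift compact_unshift compact_cone in blast)+

end

section \<open>Small index sets and localizing subcategories\<close>

lemma small_nat: "universe_cardinal \<kappa> \<Longrightarrow> small \<kappa> (UNIV :: nat set)"
  unfolding universe_cardinal_def small_def using card_of_nat ordIso_ordLess_trans by blast

lemma small_finite:
  assumes "universe_cardinal \<kappa>" "finite A"
  shows "small \<kappa> A"
  using assms finite_iff_ordLess_natLeq ordLess_transitive
  unfolding universe_cardinal_def small_def by blast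

lemma small_subset: "small \<kappa> A \<Longrightarrow> B \<subseteq> A \<Longrightarrow> small \<kappa> B"
  unfolding small_def using card_of_mono1 ordLeq_ordLess_trans by blast

lemma small_image: "small \<kappa> A \<Longrightarrow> small \<kappa> (f ` A)"
  unfolding small_def using card_of_image ordLeq_ordLess_trans by blast

text \<open>An infinite regular cardinal is stable, that is, closed under small sums of small sets;
  infinitude comes from \<kappa> being uncountable.\<close>

lemma small_Sigma:
  assumes "universe_cardinal \<kappa>" "small \<kappa> A" "\<And>a. a \<in> A \<Longrightarrow> small \<kappa> (B a)"
  shows "small \<kappa> (Sigma A B)"
proof -
  have "\<not> finite (Field \<kappa>)"
  proof
    assume "finite (Field \<kappa>)"
    then have "|Field \<kappa>| <o natLeq" by (simp add: finite_iff_ordLess_natLeq)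
    then have "\<kappa> <o natLeq"
      using card_of_Field_ordIso assms(1) ordIso_ordLess_trans ordIso_symmetric
      unfolding universe_cardinal_def by blast
    then show False using assms(1) ordLess_transitive ordLess_irreflexive
      unfolding universe_cardinal_def by blast
  qed
  then have "stable \<kappa>" using regularCard_stable assms(1) unfolding universe_cardinal_def by blast
  then show ?thesis using stable_elim assms(2,3) unfolding small_def by blast
qed

text \<open>The axioms on coproducts speak of index sets in the type underlying \<kappa>; this
  replaces any small index set, such as the natural numbers or a set of arrows, by one of that
  kind.\<close>

lemma small_index:
  fixes \<kappa> :: "'u rel"
  assumes "universe_cardinal \<kappa>" "small \<kappa> J"
  obtains I :: "'u set" and \<phi> where "bij_betw \<phi> I J" "small \<kappa> I"
proof -
  have "|J| \<le>o \<kappa>" using assms(2) ordLess_imp_ordLeq unfolding small_def by blast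
  moreover have "\<kappa> =o |Field \<kappa>|"
    using assms(1) card_of_Field_ordIso ordIso_symmetric unfolding universe_cardinal_def by blast
  ultimately have "|J| \<le>o |Field \<kappa>|" using ordLeq_ordIso_trans by blast
  then obtain f where f: "inj_on f J" "f ` J \<subseteq> Field \<kappa>"
    unfolding card_of_ordLeq[symmetric] by (elim exE conjE)
  show ?thesis
  proof
    show "bij_betw (inv_into J f) (f ` J) J" using f(1) by (simp add: inj_on_imp_bij_betw bij_betw_inv_into)
    show "small \<kappa> (f ` J)" using assms(2) small_image by blast
  qed
qed

text \<open>Index sets are subsets of the type underlying \<kappa>, which keeps the definition free
  of further types; other small index sets are reached by reindexing.\<close>

definition localizing :: "'u rel \<Rightarrow> ('o, 'm) mtcat \<Rightarrow> 'o set \<Rightarrow> bool" where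
  "localizing \<kappa> K L \<longleftrightarrow> thick_subcategory K L \<and>
     (\<forall>(I :: 'u set) M S \<iota>. small \<kappa> I \<and> coproduct K I M S \<iota> \<and> (\<forall>i\<in>I. M i \<in> L) \<longrightarrow> S \<in> L)"

lemma localizing_thick: "localizing \<kappa> K L \<Longrightarrow> thick_subcategory K L"
  unfolding localizing_def by blast

context compactly_generated_mtc
begin

lemma coproduct_exists':
  assumes "small \<kappa> J" "\<And>j. j \<in> J \<Longrightarrow> N j \<in> Obj K"
  obtains S \<iota> where "coproduct K J N S \<iota>"
proof -
  obtain I :: "'u set" and \<phi> where \<phi>: "bij_betw \<phi> I J" "small \<kappa> I" using small_index[OF universe assms(1)] .
  have "N (\<phi> i) \<in> Obj K" if "i \<in> I" for i using \<phi>(1) assms(2) that bij_betwE by blast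
  then obtain S \<iota> where C: "coproduct K I (\<lambda>i. N (\<phi> i)) S \<iota>"
    using coproduct_exists[OF \<phi>(2), of "\<lambda>i. N (\<phi> i)"] by blast
  have b: "bij_betw (inv_into I \<phi>) J I" using \<phi>(1) by (rule bij_betw_inv_into)
  have "coproduct K J (\<lambda>j. N (\<phi> (inv_into I \<phi> j))) S (\<lambda>j. \<iota> (inv_into I \<phi> j))"
    using coproduct_reindex[OF b C] .
  moreover have "\<phi> (inv_into I \<phi> j) = j" if "j \<in> J" for j
    using \<phi>(1) that by (simp add: bij_betw_inv_into_right)
  ultimately have "coproduct K J N S (\<lambda>j. \<iota> (inv_into I \<phi> j))"
    using coproduct_cong[of J "\<lambda>j. N (\<phi> (inv_into I \<phi> j))" N] by auto
  then show ?thesis using that by blast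
qed

lemma localizing_coproduct:
  assumes "localizing \<kappa> K L" "small \<kappa> J" "coproduct K J M S \<iota>" "\<And>j. j \<in> J \<Longrightarrow> M j \<in> L"
  shows "S \<in> L"
proof -
  obtain I :: "'u set" and \<phi> where \<phi>: "bij_betw \<phi> I J" "small \<kappa> I" using small_index[OF universe assms(2)] .
  have "M (\<phi> i) \<in> L" if "i \<in> I" for i using \<phi>(1) assms(4) that bij_betwE by blast
  then show ?thesis
    using coproduct_reindex[OF \<phi>(1) assms(3)] \<phi>(2) assms(1) unfolding localizing_def by blast
qed

lemma compact_supported:
  assumes "compact_object \<kappa> K C" "small \<kappa> J" "coproduct K J M S \<iota>" "x \<in> Hom K C S"
  obtains F where "finite F" "F \<subseteq> J" "supported_on K S \<iota> F x"
proof -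
  obtain I :: "'u set" and \<phi> where \<phi>: "bij_betw \<phi> I J" "small \<kappa> I" using small_index[OF universe assms(2)] .
  obtain F where F: "finite F" "F \<subseteq> I" "supported_on K S (\<lambda>i. \<iota> (\<phi> i)) F x"
    using compactD(2)[OF assms(1) \<phi>(2) coproduct_reindex[OF \<phi>(1) assms(3)] assms(4)] by blast
  have "supported_on K S \<iota> (\<phi> ` F) x" using F(3) unfolding supported_on_def by simp
  moreover have "\<phi> ` F \<subseteq> J" using F(2) \<phi>(1) by (auto simp: bij_betw_def)
  ultimately show ?thesis using that F(1) by blast
qed

end

section \<open>Sequential homotopy colimits\<close>

context compactly_generated_mtc
begin

lemma compact_unshift_arrows:
  assumes "compact_object \<kappa> K C"
  obtains C' a b where "compact_object \<kappa> K C'" "a \<in> Hom K (ShiftO K C') C" "b \<in> Hom K C (ShiftO K C')"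
    "b \<cdot> a = Idn K (ShiftO K C')" "a \<cdot> b = Idn K C"
proof -
  obtain C' a b where C': "C' \<in> Obj K" and ab: "a \<in> Hom K (ShiftO K C') C" "b \<in> Hom K C (ShiftO K C')"
    "b \<cdot> a = Idn K (ShiftO K C')" "a \<cdot> b = Idn K C"
    using shift_ess_surj_arrows compactD(1)[OF assms] by blast
  have "isomorphic K C (ShiftO K C')" using isomorphicI[OF ab(2,1,4,3)] .
  then have "compact_object \<kappa> K (ShiftO K C')" using thick_iso[OF compact_thick[of \<kappa>]] assms by blast
  then show ?thesis using that compact_unshift C' ab by blast
qed

text \<open>An arrow fixed by the shift along the tower has zeroth coordinate zero, and each later
  coordinate is the image of the previous one, so all vanish. Compactness of \<open>A\<close> bounds
  the support and turns this into \<open>x = 0\<close>.\<close>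

lemma telescope_injective:
  assumes C: "coproduct K (UNIV :: nat set) F S \<iota>" and t: "\<And>n. t n \<in> Hom K (F n) (F (Suc n))"
    and s: "s \<in> Hom K S S" "\<And>n. s \<cdot> \<iota> n = \<iota> (Suc n) \<cdot> t n"
    and A: "compact_object \<kappa> K A" and x: "x \<in> Hom K A S" "s \<cdot> x = x"
  shows "x = Null K A S"
proof -
  note D = coproductD[OF C, simplified]
  obtain p where p: "\<And>i. p i \<in> Hom K S (F i)" "\<And>i. p i \<cdot> \<iota> i = Idn K (F i)"
    "\<And>i j. i \<noteq> j \<Longrightarrow> p i \<cdot> \<iota> j = Null K (F j) (F i)"
    using coproduct_proj[OF C] by auto
  have p0: "p 0 \<cdot> s = Null K S (F 0)"
  proof (rule coproduct_ext[OF C comp_hom[OF s(1) p(1)]])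
    show "Null K S (F 0) \<in> Hom K S (F 0)" using Null_hom D(1,2) by blast
    show "(p 0 \<cdot> s) \<cdot> \<iota> i = Null K S (F 0) \<cdot> \<iota> i" for i
    proof -
      have "(p 0 \<cdot> s) \<cdot> \<iota> i = p 0 \<cdot> (\<iota> (Suc i) \<cdot> t i)"
        unfolding s(2)[symmetric] by (rule comp_assoc[OF D(3) s(1) p(1), symmetric])
      also have "\<dots> = Null K (F (Suc i)) (F 0) \<cdot> t i"
        by (rule comp_subst_hom[OF p(3) D(3) p(1) t]) simp
      also have "\<dots> = Null K (F i) (F 0)" using HomD[OF t[of i]] D(2) by simp
      finally show ?thesis using D by simp
    qed
  qed
  have pS: "p (Suc n) \<cdot> s = t n \<cdot> p n" for n
  proof (rule coproduct_ext[OF C comp_hom[OF s(1) p(1)] comp_hom[OF p(1) t]])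
    show "(p (Suc n) \<cdot> s) \<cdot> \<iota> i = (t n \<cdot> p n) \<cdot> \<iota> i" for i
    proof -
      have l: "(p (Suc n) \<cdot> s) \<cdot> \<iota> i = p (Suc n) \<cdot> (\<iota> (Suc i) \<cdot> t i)"
        unfolding s(2)[symmetric] by (rule comp_assoc[OF D(3) s(1) p(1), symmetric])
      have r: "(t n \<cdot> p n) \<cdot> \<iota> i = t n \<cdot> (p n \<cdot> \<iota> i)"
        by (rule comp_assoc[OF D(3) p(1) t, symmetric])
      show ?thesis
      proof (cases "i = n")
        case True
        have "p (Suc n) \<cdot> \<iota> (Suc n) \<cdot> t n = t n"
          using comp_subst_hom[OF p(2)[of "Suc n"] D(3) p(1) t] HomD[OF t[of n]] by simp
        then show ?thesis unfolding l r using True p(2)[of n] HomD[OF t[of n]] by simp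
      next
        case False
        then have "p (Suc n) \<cdot> \<iota> (Suc i) \<cdot> t i = Null K (F (Suc i)) (F (Suc n)) \<cdot> t i"
          by (intro comp_subst_hom[OF p(3) D(3) p(1) t]) simp
        moreover have "p n \<cdot> \<iota> i = Null K (F i) (F n)" using False p(3)[of n i] by simp
        ultimately show ?thesis unfolding l r using HomD[OF t[of n]] HomD[OF t[of i]] D(2) by simp
      qed
    qed
  qed
  have px: "p n \<cdot> x = Null K A (F n)" for n
  proof (induction n)
    case 0
    have "p 0 \<cdot> x = p 0 \<cdot> s \<cdot> x" using x by simp
    also have "\<dots> = Null K A (F 0)"
      using comp_subst_hom[OF p0 s(1) p(1) x(1)] HomD[OF x(1)] D(2) by simp
    finally show ?case .
  next
    case (Suc n)
    have "p (Suc n) \<cdot> x = p (Suc n) \<cdot> s \<cdot> x" using x by simp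
    also have "\<dots> = (t n \<cdot> p n) \<cdot> x" using comp_subst_hom[OF pS s(1) p(1) x(1)] .
    also have "\<dots> = t n \<cdot> p n \<cdot> x" by (rule comp_assoc[OF x(1) p(1) t, symmetric])
    also have "\<dots> = Null K A (F (Suc n))" using Suc HomD[OF t[of n]] HomD[OF x(1)] by simp
    finally show ?case .
  qed
  obtain G where G: "finite G" "G \<subseteq> UNIV" "supported_on K S \<iota> G x"
    by (rule compact_supported[OF A small_nat[OF universe] C x(1)])
  show ?thesis
    by (rule supported_on_zero[OF C G x(1), of p]) (rule p(1) p(2) px | (rule p(3), assumption))+
qed

text \<open>The homotopy colimit of a tower. Arrows from compact objects into it come from a stage;
  arrows out of it exist for compatible families, with no claim of uniqueness; and it stays in every
  localizing subcategory that contains the stages.\<close>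

lemma telescope:
  assumes t: "\<And>n. t n \<in> Hom K (F n) (F (Suc n))"
  obtains T j where "\<forall>n. j n \<in> Hom K (F n) T" "\<forall>n. j (Suc n) \<cdot> t n = j n"
    "\<forall>C. compact_object \<kappa> K C \<longrightarrow> (\<forall>y \<in> Hom K C T. \<exists>n. \<exists>y' \<in> Hom K C (F n). y = j n \<cdot> y')"
    "\<forall>E\<in>Obj K. \<forall>p. (\<forall>n. p n \<in> Hom K (F n) E \<and> p (Suc n) \<cdot> t n = p n) \<longrightarrow>
       (\<exists>\<pi> \<in> Hom K T E. \<forall>n. \<pi> \<cdot> j n = p n)"
    "\<forall>L. localizing \<kappa> K L \<and> (\<forall>n. F n \<in> L) \<longrightarrow> T \<in> L"
proof -
  have F: "F n \<in> Obj K" for n using HomD[OF t] by blast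
  obtain S \<iota> where C: "coproduct K (UNIV :: nat set) F S \<iota>"
    using coproduct_exists'[OF small_nat[OF universe]] F by blast
  note D = coproductD[OF C, simplified]
  obtain p where p: "\<And>i. p i \<in> Hom K S (F i)" "\<And>i. p i \<cdot> \<iota> i = Idn K (F i)"
    "\<And>i j. i \<noteq> j \<Longrightarrow> p i \<cdot> \<iota> j = Null K (F j) (F i)"
    using coproduct_proj[OF C] by auto
  have "\<iota> (Suc n) \<cdot> t n \<in> Hom K (F n) S" for n using comp_hom[OF t D(3)] .
  then obtain s where s: "s \<in> Hom K S S" "\<And>n. s \<cdot> \<iota> n = \<iota> (Suc n) \<cdot> t n"
    using coproduct_desc[OF C D(1), of "\<lambda>n. \<iota> (Suc n) \<cdot> t n"] by auto
  \<comment> \<open>\<open>T\<close> is the homotopy colimit, the cone of \<open>1 - s\<close> with \<open>s\<close> the shift along the tower.\<close>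
  define d where "d = Idn K S \<boxplus> Neg K s"
  have d: "d \<in> Hom K S S" unfolding d_def using HomD[OF s(1)] by (simp add: Hom_def)
  obtain T c h where T: "distinguished K S S T d c h" using triangle_complete[OF d] by blast
  note DT = triangleD[OF T]
  define j where "j n = c \<cdot> \<iota> n" for n
  have j: "j n \<in> Hom K (F n) T" for n unfolding j_def using comp_hom[OF D(3) DT(2)] .
  have dz: "u \<cdot> d = u \<boxplus> Neg K (u \<cdot> s)" if "u \<in> Hom K S E" for u E
    unfolding d_def using HomD[OF that] HomD[OF s(1)] by simp
  have jt: "j (Suc n) \<cdot> t n = j n" for n
  proof -
    \<comment> \<open>Vanishing of \<open>c \<cdot> d\<close> says that \<open>c\<close> is
      invariant under \<open>s\<close>, which is compatibility of the arrows \<open>j n\<close> with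
      the tower.\<close>
    have "c \<boxplus> Neg K (c \<cdot> s) = Null K S T" using dz[OF DT(2)] triangle_comp_null[OF T] by simp
    then have "c = c \<cdot> s" using eq_if_diff_null[OF DT(2) comp_hom[OF s(1) DT(2)]] by simp
    then have "j n = (c \<cdot> s) \<cdot> \<iota> n" unfolding j_def by simp
    also have "\<dots> = c \<cdot> \<iota> (Suc n) \<cdot> t n"
      unfolding s(2)[symmetric] by (rule comp_assoc[OF D(3) s(1) DT(2), symmetric])
    also have "\<dots> = j (Suc n) \<cdot> t n" unfolding j_def by (rule comp_assoc[OF t D(3) DT(2)])
    finally show ?thesis by simp
  qed
  \<comment> \<open>Arrows through one stage can be pushed to any later stage, so two of them can be
    brought to a common stage and added there.\<close>
  have move: "\<exists>y' \<in> Hom K C (F (n + k)). j n \<cdot> y = j (n + k) \<cdot> y'" if "y \<in> Hom K C (F n)" for n k C y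
  proof (induction k)
    case 0
    then show ?case using that by auto
  next
    case (Suc k)
    then obtain y' where y': "y' \<in> Hom K C (F (n + k))" "j n \<cdot> y = j (n + k) \<cdot> y'" by blast
    have "j (n + k) \<cdot> y' = (j (Suc (n + k)) \<cdot> t (n + k)) \<cdot> y'" unfolding jt ..
    also have "\<dots> = j (Suc (n + k)) \<cdot> t (n + k) \<cdot> y'" by (rule comp_assoc[OF y'(1) t j, symmetric])
    finally show ?case using y' comp_hom[OF y'(1) t] by auto
  qed
  \<comment> \<open>Induction on the support: the coordinate at \<open>i\<close> is split off from
    \<open>x\<close>, and after composition with \<open>c\<close> both parts come from a
    stage.\<close>
  have fin: "\<exists>n. \<exists>y' \<in> Hom K A (F n). c \<cdot> x = j n \<cdot> y'"
    if "finite G" "x \<in> Hom K A S" "supported_on K S \<iota> G x" for G A x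
    using that
  proof (induction G arbitrary: x rule: finite_induct)
    case empty
    note X = HomD[OF empty(1)]
    have "c \<cdot> x = j 0 \<cdot> Null K A (F 0)"
      using supported_on_empty[OF empty(2,1)] DT X HomD[OF j[of 0]] by simp
    then show ?case using Null_hom[OF X(4) F] by blast
  next
    case (insert i G)
    note X = HomD[OF insert.prems(1)] and P = HomD[OF p(1)[of i]]
    define w where "w = \<iota> i \<cdot> p i \<cdot> x"
    have w: "w \<in> Hom K A S" unfolding w_def using comp_hom[OF comp_hom[OF insert.prems(1) p(1)] D(3)] .
    define x' where "x' = x \<boxplus> Neg K w"
    have x': "x' \<in> Hom K A S" unfolding x'_def using plus_hom[OF insert.prems(1) neg_hom[OF w]] .
    have wi: "supported_on K S \<iota> (insert i G) w"
      unfolding w_def by (rule supported_on_inj[where \<iota> = \<iota> and i = i, OF insertI1 D(3) comp_hom[OF insert.prems(1) p(1)]])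
    have si: "supported_on K S \<iota> (insert i G) x'"
      unfolding x'_def
      by (rule supported_on_plus[OF insert.prems(2,1) supported_on_neg[OF wi w] neg_hom[OF w]])
    have "p i \<cdot> w = p i \<cdot> x"
      unfolding w_def using comp_subst_hom[OF p(2) D(3) p(1) comp_hom[OF insert.prems(1) p(1)]] X P by simp
    then have px': "p i \<cdot> x' = Null K A (F i)"
      unfolding x'_def using X P HomD[OF w] by simp
    have "p i \<cdot> \<iota> k = Null K (F k) (F i)" if "k \<in> G" for k
      by (rule p(3)) (use that insert.hyps(2) in blast)
    note drop = supported_on_drop[where M = F and p = "p i" and \<iota> = \<iota> and i = i,
        OF si x' insert.hyps(2) D(3) p(1,2) this px']
    have "supported_on K S \<iota> G x'" by (rule drop)
    then obtain n y' where y': "y' \<in> Hom K A (F n)" "c \<cdot> x' = j n \<cdot> y'"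
      using insert.IH[OF x'] by blast
    have pix: "p i \<cdot> x \<in> Hom K A (F i)" using comp_hom[OF insert.prems(1) p(1)] .
    obtain a where a: "a \<in> Hom K A (F (n + i))" "j n \<cdot> y' = j (n + i) \<cdot> a" using move[OF y'(1)] by blast
    obtain b where b: "b \<in> Hom K A (F (n + i))" "j i \<cdot> p i \<cdot> x = j (n + i) \<cdot> b"
      using move[OF pix, of n] by (auto simp: add.commute)
    have "x = x' \<boxplus> w"
      unfolding x'_def using plus_assoc[of x "Neg K w" w] X HomD[OF w] by simp
    then have "c \<cdot> x = (c \<cdot> x') \<boxplus> (c \<cdot> w)" using DT HomD[OF x'] HomD[OF w] by simp
    also have "c \<cdot> w = j i \<cdot> p i \<cdot> x"
      unfolding w_def j_def by (rule comp_assoc[OF pix D(3) DT(2)])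
    also have "(c \<cdot> x') \<boxplus> (j i \<cdot> p i \<cdot> x) = j (n + i) \<cdot> (a \<boxplus> b)"
      unfolding y'(2) a(2) b(2) using HomD[OF a(1)] HomD[OF b(1)] HomD[OF j[of "n + i"]] by simp
    finally show ?case using plus_hom[OF a(1) b(1)] by blast
  qed
  \<comment> \<open>The obstruction \<open>h \<cdot> y\<close> to lifting along \<open>c\<close> is
    desuspended to an arrow \<open>z\<close> with \<open>s \<cdot> z = z\<close>, which vanishes by
    \<open>telescope_injective\<close>.\<close>
  have factor: "\<exists>n. \<exists>y' \<in> Hom K A (F n). y = j n \<cdot> y'" if A: "compact_object \<kappa> K A" and y: "y \<in> Hom K A T" for A y
  proof -
    note Y = HomD[OF y]
    obtain A' a b where A': "compact_object \<kappa> K A'" and ab: "a \<in> Hom K (ShiftO K A') A" "b \<in> Hom K A (ShiftO K A')"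
      "b \<cdot> a = Idn K (ShiftO K A')" "a \<cdot> b = Idn K A" using compact_unshift_arrows[OF A] .
    have A'o: "A' \<in> Obj K" using compactD(1)[OF A'] .
    have hya: "h \<cdot> y \<cdot> a \<in> Hom K (ShiftO K A') (ShiftO K S)" using comp_hom[OF comp_hom[OF ab(1) y] DT(3)] .
    obtain z where z: "z \<in> Hom K A' S" "ShiftA K z = h \<cdot> y \<cdot> a" using shift_full[OF A'o D(1) hya] .
    have "ShiftA K (d \<cdot> z) = ShiftA K d \<cdot> h \<cdot> y \<cdot> a"
      using z(2) HomD[OF z(1)] HomD[OF d] by (subst shift_comp) auto
    also have "\<dots> = Null K (ShiftO K A') (ShiftO K S)"
      using comp_subst_hom[OF triangle_comp_null'(2)[OF T] DT(3) shift_hom[OF d] comp_hom[OF ab(1) y]]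
        Y HomD[OF ab(1)] DT by simp
    finally have "d \<cdot> z = Null K A' S" by (rule shift_null_imp[OF comp_hom[OF z(1) d]])
    then have "z \<boxplus> Neg K (s \<cdot> z) = Null K A' S"
      unfolding d_def using HomD[OF z(1)] HomD[OF s(1)] by simp
    then have "s \<cdot> z = z" using eq_if_diff_null[OF z(1) comp_hom[OF z(1) s(1)]] by simp
    then have "z = Null K A' S" using telescope_injective[OF C t s A' z(1)] by simp
    then have "h \<cdot> y \<cdot> a = Null K (ShiftO K A') (ShiftO K S)" using z(2) A'o D(1) by simp
    then have "(h \<cdot> y \<cdot> a) \<cdot> b = Null K A (ShiftO K S)" using HomD[OF ab(2)] D(1) by simp
    then have "h \<cdot> y = Null K A (ShiftO K S)" using DT Y HomD[OF ab(1)] HomD[OF ab(2)] ab(4) by simp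
    then obtain x where x: "x \<in> Hom K A S" "y = c \<cdot> x" using triangle_lift'[OF T y] by blast
    obtain G where "finite G" "G \<subseteq> UNIV" "supported_on K S \<iota> G x"
      by (rule compact_supported[OF A small_nat[OF universe] C x(1)])
    then show ?thesis using fin x by blast
  qed
  have desc: "\<exists>\<pi> \<in> Hom K T E. \<forall>n. \<pi> \<cdot> j n = q n"
    if E: "E \<in> Obj K" and q: "\<forall>n. q n \<in> Hom K (F n) E \<and> q (Suc n) \<cdot> t n = q n" for E q
  proof -
    obtain v where v: "v \<in> Hom K S E" "\<And>n. v \<cdot> \<iota> n = q n"
      using coproduct_desc[OF C E, of q] q by auto
    have "v \<cdot> s = v"
    proof (rule coproduct_ext[OF C comp_hom[OF s(1) v(1)] v(1)])
      show "(v \<cdot> s) \<cdot> \<iota> n = v \<cdot> \<iota> n" for n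
      proof -
        have "(v \<cdot> s) \<cdot> \<iota> n = v \<cdot> \<iota> (Suc n) \<cdot> t n"
          unfolding s(2)[symmetric] by (rule comp_assoc[OF D(3) s(1) v(1), symmetric])
        also have "\<dots> = q (Suc n) \<cdot> t n" using comp_subst_hom[OF v(2) D(3) v(1) t] .
        finally show ?thesis using q v(2) by simp
      qed
    qed
    then have "v \<cdot> d = Null K S E" using dz[OF v(1)] HomD[OF v(1)] by simp
    then obtain \<pi> where \<pi>: "\<pi> \<in> Hom K T E" "v = \<pi> \<cdot> c" using triangle_extend[OF T v(1)] by blast
    have "\<pi> \<cdot> j n = q n" for n
      unfolding j_def using comp_assoc[OF D(3) DT(2) \<pi>(1)] \<pi>(2) v(2) by simp
    then show ?thesis using \<pi>(1) by blast
  qed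
  have loc: "T \<in> L" if L: "localizing \<kappa> K L" and "\<forall>n. F n \<in> L" for L
  proof -
    have "S \<in> L" using localizing_coproduct[OF L small_nat[OF universe] C] that(2) by blast
    then show ?thesis using thick_subcategoryD(3)[OF localizing_thick[OF L] T] by blast
  qed
  show ?thesis
  proof (rule that)
    show "\<forall>n. j n \<in> Hom K (F n) T" "\<forall>n. j (Suc n) \<cdot> t n = j n" using j jt by blast+
    show "\<forall>C. compact_object \<kappa> K C \<longrightarrow> (\<forall>y \<in> Hom K C T. \<exists>n. \<exists>y' \<in> Hom K C (F n). y = j n \<cdot> y')"
      using factor by blast
    show "\<forall>E\<in>Obj K. \<forall>p. (\<forall>n. p n \<in> Hom K (F n) E \<and> p (Suc n) \<cdot> t n = p n) \<longrightarrow>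
       (\<exists>\<pi> \<in> Hom K T E. \<forall>n. \<pi> \<cdot> j n = p n)"
      using desc by blast
    show "\<forall>L. localizing \<kappa> K L \<and> (\<forall>n. F n \<in> L) \<longrightarrow> T \<in> L" using loc by blast
  qed
qed

end

section \<open>Bousfield localization at a thick subcategory of compact objects\<close>

text \<open>This notion replaces Neeman's theorem that the compact objects of the localizing subcategory
  generated by \<open>I\<close> lie in \<open>I\<close>: if \<open>g\<close> is the identity, then \<open>u = 0\<close> exhibits \<open>C\<close> as a summand of \<open>E\<close>.\<close>

definition torsion_object :: "'u rel \<Rightarrow> ('o, 'm) mtcat \<Rightarrow> 'o set \<Rightarrow> 'o \<Rightarrow> bool" where
  "torsion_object \<kappa> K I F \<longleftrightarrow> F \<in> Obj K \<and>
     (\<forall>C. compact_object \<kappa> K C \<longrightarrow> (\<forall>g \<in> Hom K C F.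
        \<exists>D E u v w. distinguished K D C E u v w \<and> E \<in> I \<and> Comp K g u = Null K D F))"

text \<open>Instantiated twice: with an ideal of compact objects, to show that \<Phi> reflects
  inclusions, and with all compact objects, to show that they generate \<open>K\<close> as a
  localizing subcategory.\<close>

locale compact_thick_subcategory = compactly_generated_mtc +
  fixes I
  assumes thick: "thick_subcategory K I" and compact: "\<And>A. A \<in> I \<Longrightarrow> compact_object \<kappa> K A"
begin

lemma fiber_compact:
  assumes "distinguished K D C E u v w" "E \<in> I" "compact_object \<kappa> K C"
  shows "compact_object \<kappa> K D"
  using thick_subcategoryD(4)[OF compact_thick[of \<kappa>] assms(1)] assms compact by blast

text \<open>Two successive restrictions along arrows with cone in \<open>I\<close> amount to one
  such restriction, by the octahedral axiom. An arrow can thus be killed in stages.\<close>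

lemma torsion_compose:
  assumes "distinguished K D C E u v w" "E \<in> I" "distinguished K D' D E' u' v' w'" "E' \<in> I"
    and g: "g \<in> Hom K C F" and "(g \<cdot> u) \<cdot> u' = Null K D' F"
  shows "\<exists>D E u v w. distinguished K D C E u v w \<and> E \<in> I \<and> g \<cdot> u = Null K D F"
proof -
  obtain E'' a b where T: "distinguished K D' C E'' (u \<cdot> u') a b" "E'' \<in> I"
    using thick_cone_comp[OF thick assms(3,1,4,2)] .
  have "g \<cdot> u \<cdot> u' = Null K D' F"
    using assms(6) comp_assoc[OF triangleD(1)[OF assms(3)] triangleD(1)[OF assms(1)] g] by simp
  then show ?thesis using T by blast
qed

text \<open>Restricting \<open>g\<close> to the fiber of its coordinate at \<open>i\<close> kills
  that coordinate, at the cost of the cone \<open>M i\<close> in \<open>I\<close>. As the support is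
  finite, finitely many restrictions kill \<open>g\<close>.\<close>

lemma torsion_coproduct:
  assumes "small \<kappa> J" and S: "coproduct K J M S \<iota>" and M: "\<And>j. j \<in> J \<Longrightarrow> M j \<in> I"
  shows "torsion_object \<kappa> K I S"
proof -
  note DS = coproductD[OF S]
  obtain p where p: "\<And>i. i \<in> J \<Longrightarrow> p i \<in> Hom K S (M i)" "\<And>i. i \<in> J \<Longrightarrow> p i \<cdot> \<iota> i = Idn K (M i)"
    "\<And>i j. i \<in> J \<Longrightarrow> j \<in> J \<Longrightarrow> i \<noteq> j \<Longrightarrow> p i \<cdot> \<iota> j = Null K (M j) (M i)"
    using coproduct_proj[OF S] by blast
  have "\<exists>D E u v w. distinguished K D C E u v w \<and> E \<in> I \<and> g \<cdot> u = Null K D S"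
    if "finite F" "F \<subseteq> J" "compact_object \<kappa> K C" "g \<in> Hom K C S" "supported_on K S \<iota> F g" for F C g
    using that
  \<comment> \<open>The source varies because each step replaces \<open>C\<close> by a fiber, which
    is again compact.\<close>
  proof (induction F arbitrary: C g rule: finite_induct)
    case empty
    obtain Z where Z: "zero_object K Z" using zero_object_exists by blast
    have C: "C \<in> Obj K" using compactD(1)[OF empty(2)] .
    have "g = Null K C S" using supported_on_empty empty by blast
    then have "g \<cdot> Idn K C = Null K C S" using HomD[OF empty(3)] by simp
    then show ?case using triangle_ide[OF C Z] thick_zero[OF thick Z] by blast
  next
    case (insert i F)
    have i: "i \<in> J" "F \<subseteq> J" using insert.prems(1) by auto
    note g = insert.prems(3)
    have pg: "p i \<cdot> g \<in> Hom K C (M i)" using comp_hom[OF g p(1)[OF i(1)]] .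
    obtain D u w where T: "distinguished K D C (M i) u (p i \<cdot> g) w" using triangle_fiber[OF pg] .
    note DT = triangleD[OF T]
    have gu: "g \<cdot> u \<in> Hom K D S" using comp_hom[OF DT(1) g] .
    have "p i \<cdot> g \<cdot> u = Null K D (M i)"
      using triangle_comp_null[OF T] comp_assoc[OF DT(1) g p(1)[OF i(1)]] by simp
    moreover have "\<iota> j \<in> Hom K (M j) S" if "j \<in> insert i F" for j using DS(3) that i by blast
    moreover have "p i \<cdot> \<iota> j = Null K (M j) (M i)" if "j \<in> F" for j
      using p(3)[of i j] i that insert.hyps(2) by blast
    ultimately have "supported_on K S \<iota> F (g \<cdot> u)"
      using supported_on_drop[OF supported_on_comp[OF insert.prems(4) g DT(1)] gu insert.hyps(2), of M "p i"]
        p(1,2)[OF i(1)] by blast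
    then obtain D' E' u' v' w' where "distinguished K D' D E' u' v' w'" "E' \<in> I" "(g \<cdot> u) \<cdot> u' = Null K D' S"
      using insert.IH[OF i(2) fiber_compact[OF T M[OF i(1)] insert.prems(2)] gu] by blast
    then show ?case using torsion_compose[OF T M[OF i(1)] _ _ g] by blast
  qed
  then show ?thesis
    unfolding torsion_object_def using DS(1) compact_supported[OF _ assms(1) S] by metis
qed

text \<open>First the image in \<open>B\<close> is killed, so that the arrow lifts to
  \<open>A\<close>; then the lift is killed on a further fiber.\<close>

lemma torsion_extension:
  assumes T: "distinguished K A F B f g h" and A: "torsion_object \<kappa> K I A" and B: "torsion_object \<kappa> K I B"
  shows "torsion_object \<kappa> K I F"
  unfolding torsion_object_def
proof (intro conjI allI impI ballI)
  note DT = triangleD[OF T]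
  show "F \<in> Obj K" using DT by simp
  fix C x assume C: "compact_object \<kappa> K C" and x: "x \<in> Hom K C F"
  have "g \<cdot> x \<in> Hom K C B" using comp_hom[OF x DT(2)] .
  then obtain D E u v w where U: "distinguished K D C E u v w" "E \<in> I" "(g \<cdot> x) \<cdot> u = Null K D B"
    using B C unfolding torsion_object_def by blast
  note u = triangleD(1)[OF U(1)]
  have xu: "x \<cdot> u \<in> Hom K D F" using comp_hom[OF u x] .
  have "g \<cdot> x \<cdot> u = Null K D B" using U(3) comp_assoc[OF u x DT(2)] by simp
  then obtain y where y: "y \<in> Hom K D A" "x \<cdot> u = f \<cdot> y" using triangle_lift[OF T xu] by blast
  obtain D' E' u' v' w' where U': "distinguished K D' D E' u' v' w'" "E' \<in> I" "y \<cdot> u' = Null K D' A"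
    using A fiber_compact[OF U(1,2) C] y(1) unfolding torsion_object_def by blast
  note u' = triangleD(1)[OF U'(1)]
  have "(x \<cdot> u) \<cdot> u' = f \<cdot> y \<cdot> u'" unfolding y(2) using comp_assoc[OF u' y(1) DT(1)] by simp
  then have "(x \<cdot> u) \<cdot> u' = Null K D' F" using U'(3) DT HomD[OF u'] by simp
  then show "\<exists>D E u v w. distinguished K D C E u v w \<and> E \<in> I \<and> x \<cdot> u = Null K D F"
    using torsion_compose[OF U(1,2) U'(1,2) x] by blast
qed

text \<open>One object is chosen from each isomorphism class of compact objects. As \<open>I\<close>
  is closed under isomorphism, the choices that fall into \<open>I\<close> represent all of its
  objects.\<close>

lemma representatives:
  obtains R where "small \<kappa> R" "R \<subseteq> I" "\<And>C. C \<in> I \<Longrightarrow> \<exists>A\<in>R. isomorphic K C A"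
proof -
  let ?E = "{(A, B). compact_object \<kappa> K A \<and> compact_object \<kappa> K B \<and> isomorphic K A B}"
  let ?Q = "{C. compact_object \<kappa> K C} // ?E"
  let ?R = "(\<lambda>c. SOME A. A \<in> c) ` ?Q \<inter> I"
  show ?thesis
  proof
    show "small \<kappa> ?R"
      using small_subset[OF small_image[OF compact_classes_small, of "\<lambda>c. SOME A. A \<in> c"]] by blast
    show "?R \<subseteq> I" by blast
    fix C assume C: "C \<in> I"
    let ?A = "SOME A. A \<in> ?E `` {C}"
    have "C \<in> ?E `` {C}" using compact[OF C] isomorphic_refl compactD(1) by blast
    then have "?A \<in> ?E `` {C}" by (rule someI)
    then have A: "isomorphic K C ?A" by blast
    moreover have "?A \<in> I" using thick_iso[OF thick A C] .
    moreover have "?E `` {C} \<in> ?Q" using quotientI[of C "{C. compact_object \<kappa> K C}" ?E] compact[OF C] by blast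
    ultimately show "\<exists>A\<in>?R. isomorphic K C A" by blast
  qed
qed

text \<open>\<open>S\<close> is the coproduct of the sources of all arrows into \<open>F\<close>
  from representatives of \<open>I\<close> that \<open>p\<close> kills, and \<open>e\<close>
  collects these arrows. Torsion of the shift of \<open>S\<close> is recorded because the cone of
  \<open>e\<close> is an extension of this shift by \<open>F\<close>.\<close>

lemma coproduct_cover:
  assumes p: "p \<in> Hom K F E"
  obtains S e where "e \<in> Hom K S F" "p \<cdot> e = Null K S E"
    "\<forall>C\<in>I. \<forall>g \<in> Hom K C F. p \<cdot> g = Null K C E \<longrightarrow> (\<exists>y \<in> Hom K C S. g = e \<cdot> y)"
    "torsion_object \<kappa> K I S" "torsion_object \<kappa> K I (ShiftO K S)"
    "\<forall>L. localizing \<kappa> K L \<and> I \<subseteq> L \<longrightarrow> S \<in> L"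
proof -
  note P = HomD[OF p]
  obtain R where R: "small \<kappa> R" "R \<subseteq> I" "\<And>C. C \<in> I \<Longrightarrow> \<exists>A\<in>R. isomorphic K C A"
    using representatives by blast
  define J where "J = {(C, g). C \<in> R \<and> g \<in> Hom K C F \<and> p \<cdot> g = Null K C E}"
  have "small \<kappa> (Sigma R (\<lambda>C. Hom K C F))"
  proof (rule small_Sigma[OF universe R(1)])
    fix C assume "C \<in> R"
    then have "compact_object \<kappa> K C" using R(2) compact by blast
    then show "small \<kappa> (Hom K C F)" using P(4) by (rule hom_small)
  qed
  moreover have "J \<subseteq> Sigma R (\<lambda>C. Hom K C F)" unfolding J_def by blast
  ultimately have J: "small \<kappa> J" by (rule small_subset)
  have M: "fst j \<in> I" if "j \<in> J" for j using that R(2) unfolding J_def by auto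
  obtain S \<iota> where S: "coproduct K J fst S \<iota>"
    using coproduct_exists'[OF J, of fst] M thick_subcategoryD(1)[OF thick] by blast
  note DS = coproductD[OF S]
  have "snd j \<in> Hom K (fst j) F" if "j \<in> J" for j using that unfolding J_def by auto
  then obtain e where e: "e \<in> Hom K S F" "\<And>j. j \<in> J \<Longrightarrow> e \<cdot> \<iota> j = snd j"
    using coproduct_desc[OF S P(4), of snd] by blast
  show ?thesis
  proof (rule that[OF e(1)])
    show "p \<cdot> e = Null K S E"
    proof (rule coproduct_ext[OF S comp_hom[OF e(1) p]])
      show "Null K S E \<in> Hom K S E" using Null_hom DS(1) P(5) by blast
      fix j assume j: "j \<in> J"
      have "(p \<cdot> e) \<cdot> \<iota> j = p \<cdot> snd j" using comp_assoc[OF DS(3)[OF j] e(1) p] e(2)[OF j] by simp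
      also have "\<dots> = Null K (fst j) E" using j unfolding J_def by auto
      finally show "(p \<cdot> e) \<cdot> \<iota> j = Null K S E \<cdot> \<iota> j" using DS(4-6)[OF j] P(5) by simp
    qed
    show "\<forall>C\<in>I. \<forall>g \<in> Hom K C F. p \<cdot> g = Null K C E \<longrightarrow> (\<exists>y \<in> Hom K C S. g = e \<cdot> y)"
    proof (intro ballI impI)
      fix C g assume C: "C \<in> I" and g: "g \<in> Hom K C F" "p \<cdot> g = Null K C E"
      obtain A where A: "A \<in> R" "isomorphic K C A" using R(3)[OF C] by blast
      obtain a b where ab: "a \<in> Hom K C A" "b \<in> Hom K A C" "b \<cdot> a = Idn K C" "a \<cdot> b = Idn K A"
        using A(2) by (rule isomorphicE)
      have "p \<cdot> g \<cdot> b = Null K A E"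
        using comp_subst_hom[OF g(2) g(1) p ab(2)] HomD[OF ab(2)] P by simp
      then have j: "(A, g \<cdot> b) \<in> J" unfolding J_def using A(1) comp_hom[OF ab(2) g(1)] by blast
      have "e \<cdot> (\<iota> (A, g \<cdot> b) \<cdot> a) = (g \<cdot> b) \<cdot> a"
        using comp_subst_hom[OF e(2)[OF j] DS(3)[OF j] e(1)] ab(1) by simp
      also have "\<dots> = g" using HomD[OF g(1)] HomD[OF ab(1)] HomD[OF ab(2)] ab(3) by simp
      finally have "g = e \<cdot> (\<iota> (A, g \<cdot> b) \<cdot> a)" by (rule sym)
      moreover have "\<iota> (A, g \<cdot> b) \<cdot> a \<in> Hom K C S"
        by (rule comp_hom[OF _ DS(3)[OF j]]) (simp add: ab(1))
      ultimately show "\<exists>y \<in> Hom K C S. g = e \<cdot> y" by blast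
    qed
    show "torsion_object \<kappa> K I S" using torsion_coproduct[OF J S M] .
    show "torsion_object \<kappa> K I (ShiftO K S)"
      by (rule torsion_coproduct[OF J coproduct_shift[OF S]])
        (use M thick_subcategoryD(1,2)[OF thick] in blast)
    show "\<forall>L. localizing \<kappa> K L \<and> I \<subseteq> L \<longrightarrow> S \<in> L"
      using localizing_coproduct[OF _ J S] M by blast
  qed
qed

text \<open>The start covers all arrows from \<open>I\<close> to \<open>E\<close>. Each step then
  takes the cone of the cover of those arrows into \<open>F n\<close> that die in \<open>E\<close>;
  they die one stage later, while \<open>p n\<close> extends over the cone.\<close>

lemma tower:
  assumes E: "E \<in> Obj K"
  obtains F p t where "\<forall>n. p n \<in> Hom K (F n) E" "\<forall>n. t n \<in> Hom K (F n) (F (Suc n))"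
    "\<forall>n. p (Suc n) \<cdot> t n = p n"
    "\<forall>n. \<forall>C\<in>I. \<forall>g \<in> Hom K C (F n). p n \<cdot> g = Null K C E \<longrightarrow> t n \<cdot> g = Null K C (F (Suc n))"
    "\<forall>C\<in>I. \<forall>x \<in> Hom K C E. \<exists>y \<in> Hom K C (F 0). x = p 0 \<cdot> y"
    "\<forall>n. torsion_object \<kappa> K I (F n)" "\<forall>n L. localizing \<kappa> K L \<and> I \<subseteq> L \<longrightarrow> F n \<in> L"
proof -
  \<comment> \<open>The invariants of a stage \<open>s = (F, p)\<close> in the form that dependent
    choice requires; lifting of arrows from \<open>I\<close> is asked of the initial stage
    only.\<close>
  define P where "P n s \<longleftrightarrow> snd s \<in> Hom K (fst s) E \<and> torsion_object \<kappa> K I (fst s) \<and>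
      (\<forall>L. localizing \<kappa> K L \<and> I \<subseteq> L \<longrightarrow> fst s \<in> L) \<and>
      (n = 0 \<longrightarrow> (\<forall>C\<in>I. \<forall>x \<in> Hom K C E. \<exists>y \<in> Hom K C (fst s). x = snd s \<cdot> y))" for n :: nat and s
  define Q where "Q n s s' \<longleftrightarrow> (\<exists>t \<in> Hom K (fst s) (fst s'). snd s' \<cdot> t = snd s \<and>
      (\<forall>C\<in>I. \<forall>g \<in> Hom K C (fst s). snd s \<cdot> g = Null K C E \<longrightarrow> t \<cdot> g = Null K C (fst s')))"
    for n :: nat and s s'
  have "\<exists>s. P 0 s"
  proof -
    obtain Z where Z: "zero_object K Z" using zero_object_exists by blast
    \<comment> \<open>The zero arrow kills everything, so this cover takes in all arrows from
      \<open>I\<close> to \<open>E\<close>.\<close>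
    obtain S e where e: "e \<in> Hom K S E" and "Null K E Z \<cdot> e = Null K S Z"
      and e': "\<forall>C\<in>I. \<forall>g \<in> Hom K C E. Null K E Z \<cdot> g = Null K C Z \<longrightarrow> (\<exists>y \<in> Hom K C S. g = e \<cdot> y)"
      and S: "torsion_object \<kappa> K I S" and "torsion_object \<kappa> K I (ShiftO K S)"
      and S': "\<forall>L. localizing \<kappa> K L \<and> I \<subseteq> L \<longrightarrow> S \<in> L"
      by (rule coproduct_cover[OF Null_hom[OF E zero_object_obj[OF Z]]])
    have "\<exists>y \<in> Hom K C S. g = e \<cdot> y" if "C \<in> I" "g \<in> Hom K C E" for C g
      using e'[rule_format, OF that] HomD[OF that(2)] zero_object_obj[OF Z] by simp
    then have "P 0 (S, e)" unfolding P_def using e S S' by simp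
    then show ?thesis by blast
  qed
  moreover have "\<exists>s'. P (Suc n) s' \<and> Q n s s'" if Ps: "P n s" for n s
  proof -
    obtain F p where s: "s = (F, p)" by (cases s)
    have p: "p \<in> Hom K F E" and F: "torsion_object \<kappa> K I F" "\<And>L. localizing \<kappa> K L \<Longrightarrow> I \<subseteq> L \<Longrightarrow> F \<in> L"
      using Ps unfolding P_def s by auto
    obtain S e where e: "e \<in> Hom K S F" "p \<cdot> e = Null K S E"
      "\<forall>C\<in>I. \<forall>g \<in> Hom K C F. p \<cdot> g = Null K C E \<longrightarrow> (\<exists>y \<in> Hom K C S. g = e \<cdot> y)"
      and "torsion_object \<kappa> K I S" and S: "torsion_object \<kappa> K I (ShiftO K S)"
        "\<forall>L. localizing \<kappa> K L \<and> I \<subseteq> L \<longrightarrow> S \<in> L"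
      by (rule coproduct_cover[OF p])
    obtain F' t h where T: "distinguished K S F F' e t h" using triangle_complete[OF e(1)] by blast
    note DT = triangleD[OF T]
    obtain p' where p': "p' \<in> Hom K F' E" "p = p' \<cdot> t" using triangle_extend[OF T p e(2)] .
    have "t \<cdot> g = Null K C F'" if g: "C \<in> I" "g \<in> Hom K C F" "p \<cdot> g = Null K C E" for C g
    proof -
      obtain y where y: "y \<in> Hom K C S" "g = e \<cdot> y" using e(3)[rule_format, OF g] by blast
      show ?thesis
        unfolding y(2) using comp_subst_hom[OF triangle_comp_null[OF T] DT(1,2) y(1)] HomD[OF y(1)] DT by simp
    qed
    then have "Q n s (F', p')" unfolding Q_def s using p' DT(2) by (intro bexI[of _ t]) simp_all
    \<comment> \<open>Rotation exhibits \<open>F'\<close> as an extension of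
      \<open>ShiftO K S\<close> by \<open>F\<close>.\<close>
    moreover have "torsion_object \<kappa> K I F'" using torsion_extension[OF triangle_rot[OF T] F(1) S(1)] .
    moreover have "F' \<in> L" if "localizing \<kappa> K L" "I \<subseteq> L" for L
      using thick_subcategoryD(3)[OF localizing_thick[OF that(1)] T] S(2) F(2) that by blast
    ultimately have "P (Suc n) (F', p') \<and> Q n s (F', p')" unfolding P_def using p'(1) by simp
    then show ?thesis by blast
  qed
  ultimately obtain s where s: "\<And>n. P n (s n)" "\<And>n. Q n (s n) (s (Suc n))"
    using dependent_nat_choice[of P Q] by blast
  then have "\<forall>n. \<exists>t \<in> Hom K (fst (s n)) (fst (s (Suc n))). snd (s (Suc n)) \<cdot> t = snd (s n) \<and>
      (\<forall>C\<in>I. \<forall>g \<in> Hom K C (fst (s n)). snd (s n) \<cdot> g = Null K C E \<longrightarrow> t \<cdot> g = Null K C (fst (s (Suc n))))"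
    unfolding Q_def by blast
  then obtain t where t: "\<forall>n. t n \<in> Hom K (fst (s n)) (fst (s (Suc n)))"
    "\<forall>n. snd (s (Suc n)) \<cdot> t n = snd (s n)"
    "\<forall>n. \<forall>C\<in>I. \<forall>g \<in> Hom K C (fst (s n)). snd (s n) \<cdot> g = Null K C E \<longrightarrow>
        t n \<cdot> g = Null K C (fst (s (Suc n)))"
    by metis
  have "\<forall>n. snd (s n) \<in> Hom K (fst (s n)) E" "\<forall>n. torsion_object \<kappa> K I (fst (s n))"
    "\<forall>n L. localizing \<kappa> K L \<and> I \<subseteq> L \<longrightarrow> fst (s n) \<in> L"
    "\<forall>C\<in>I. \<forall>x \<in> Hom K C E. \<exists>y \<in> Hom K C (fst (s 0)). x = snd (s 0) \<cdot> y"
    using s(1) unfolding P_def by blast+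
  then show ?thesis
    using that[of "\<lambda>n. snd (s n)" "\<lambda>n. fst (s n)" t] t by simp
qed

text \<open>\<open>T\<close> is the homotopy colimit of the tower and \<open>L\<close> the cone of
  its map to \<open>E\<close>. The last clause, on compact \<open>E\<close> with \<open>L\<close>
  zero, is where torsion of the stages is used.\<close>

theorem bousfield:
  assumes E: "E \<in> Obj K"
  obtains T L \<pi> q h where "distinguished K T E L \<pi> q h"
    "\<forall>\<L>. localizing \<kappa> K \<L> \<and> I \<subseteq> \<L> \<longrightarrow> T \<in> \<L>"
    "\<forall>C\<in>I. \<forall>f \<in> Hom K C L. f = Null K C L"
    "compact_object \<kappa> K E \<and> zero_object K L \<longrightarrow> E \<in> I"
proof -
  obtain F p t where "\<forall>n. p n \<in> Hom K (F n) E" "\<forall>n. t n \<in> Hom K (F n) (F (Suc n))"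
    "\<forall>n. p (Suc n) \<cdot> t n = p n"
    "\<forall>n. \<forall>C\<in>I. \<forall>g \<in> Hom K C (F n). p n \<cdot> g = Null K C E \<longrightarrow> t n \<cdot> g = Null K C (F (Suc n))"
    "\<forall>C\<in>I. \<forall>x \<in> Hom K C E. \<exists>y \<in> Hom K C (F 0). x = p 0 \<cdot> y"
    "\<forall>n. torsion_object \<kappa> K I (F n)" "\<forall>n L. localizing \<kappa> K L \<and> I \<subseteq> L \<longrightarrow> F n \<in> L"
    by (rule tower[OF E])
  note p = this(1)[rule_format] and t = this(2)[rule_format] and pt = this(3)[rule_format]
    and kill = this(4)[rule_format] and onto = this(5)[rule_format] and tors = this(6)[rule_format]
    and loc = this(7)[rule_format, OF conjI]
  obtain T j where "\<forall>n. j n \<in> Hom K (F n) T" "\<forall>n. j (Suc n) \<cdot> t n = j n"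
    "\<forall>C. compact_object \<kappa> K C \<longrightarrow> (\<forall>y \<in> Hom K C T. \<exists>n. \<exists>y' \<in> Hom K C (F n). y = j n \<cdot> y')"
    "\<forall>E\<in>Obj K. \<forall>p. (\<forall>n. p n \<in> Hom K (F n) E \<and> p (Suc n) \<cdot> t n = p n) \<longrightarrow>
       (\<exists>\<pi> \<in> Hom K T E. \<forall>n. \<pi> \<cdot> j n = p n)"
    "\<forall>L. localizing \<kappa> K L \<and> (\<forall>n. F n \<in> L) \<longrightarrow> T \<in> L"
    by (rule telescope[where t = t and F = F, OF t])
  note j = this(1)[rule_format] and jt = this(2)[rule_format] and factor = this(3)[rule_format]
    and desc = this(4) and Tloc = this(5)
  obtain \<pi> where \<pi>: "\<pi> \<in> Hom K T E" "\<And>n. \<pi> \<cdot> j n = p n" using bspec[OF desc E] p pt by blast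
  obtain L q h where tri: "distinguished K T E L \<pi> q h" using triangle_complete[OF \<pi>(1)] by blast
  note D = triangleD[OF tri]
  \<comment> \<open>An arrow from \<open>I\<close> to \<open>T\<close> that dies in \<open>E\<close>
    comes from an arrow into some stage that dies in \<open>E\<close> as well, and so becomes zero
    one stage later.\<close>
  have mono: "z = Null K C T" if C: "C \<in> I" and z: "z \<in> Hom K C T" "\<pi> \<cdot> z = Null K C E" for C z
  proof -
    obtain n y where y: "y \<in> Hom K C (F n)" "z = j n \<cdot> y" using factor[OF compact[OF C] z(1)] by blast
    have "p n \<cdot> y = Null K C E" using comp_subst_hom[OF \<pi>(2) j \<pi>(1) y(1)] z(2) y(2) by simp
    then have "t n \<cdot> y = Null K C (F (Suc n))" using kill[OF C y(1)] by blast
    moreover have "j (Suc n) \<cdot> t n \<cdot> y = z" using comp_subst_hom[OF jt t j y(1)] y(2) by simp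
    ultimately show ?thesis using HomD[OF j[of "Suc n"]] HomD[OF y(1)] by simp
  qed
  \<comment> \<open>Applied to the desuspension of \<open>C\<close>, \<open>mono\<close> makes
    \<open>f\<close> lift through \<open>q\<close>. Arrows from \<open>I\<close> to \<open>E\<close>
    factor through \<open>\<pi>\<close>, and \<open>q \<cdot> \<pi>\<close> is zero.\<close>
  have local: "f = Null K C L" if C: "C \<in> I" and f: "f \<in> Hom K C L" for C f
  proof -
    obtain C' a b where "compact_object \<kappa> K C'" and ab: "a \<in> Hom K (ShiftO K C') C" "b \<in> Hom K C (ShiftO K C')"
      "b \<cdot> a = Idn K (ShiftO K C')" "a \<cdot> b = Idn K C" using compact_unshift_arrows[OF compact[OF C]] .
    then have C'o: "C' \<in> Obj K" using compactD(1) by blast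
    have "ShiftO K C' \<in> I" using thick_iso[OF thick isomorphicI[OF ab(2,1,4,3)] C] .
    then have C': "C' \<in> I" using thick_subcategoryD(2)[OF thick C'o] by blast
    have fa: "f \<cdot> a \<in> Hom K (ShiftO K C') L" using comp_hom[OF ab(1) f] .
    obtain z where z: "z \<in> Hom K C' T" "ShiftA K z = h \<cdot> f \<cdot> a"
      using shift_full[OF C'o D(13) comp_hom[OF fa D(3)]] .
    have "ShiftA K (\<pi> \<cdot> z) = ShiftA K \<pi> \<cdot> h \<cdot> f \<cdot> a"
      using z(2) HomD[OF z(1)] HomD[OF \<pi>(1)] by (subst shift_comp) auto
    also have "\<dots> = Null K (ShiftO K C') (ShiftO K E)"
      using comp_subst_hom[OF triangle_comp_null'(2)[OF tri] D(3) shift_hom[OF \<pi>(1)] fa] HomD[OF fa] E by simp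
    finally have "\<pi> \<cdot> z = Null K C' E" by (rule shift_null_imp[OF comp_hom[OF z(1) \<pi>(1)]])
    then have "z = Null K C' T" using mono[OF C' z(1)] by blast
    then have "h \<cdot> f \<cdot> a = Null K (ShiftO K C') (ShiftO K T)" using z(2) C'o D(13) by simp
    then have "(h \<cdot> f \<cdot> a) \<cdot> b = Null K C (ShiftO K T)" using HomD[OF ab(2)] D(13) by simp
    then have "h \<cdot> f = Null K C (ShiftO K T)" using D HomD[OF f] HomD[OF ab(1)] HomD[OF ab(2)] ab(4) by simp
    then obtain x where x: "x \<in> Hom K C E" "f = q \<cdot> x" using triangle_lift'[OF tri f] by blast
    obtain y where y: "y \<in> Hom K C (F 0)" "x = p 0 \<cdot> y" using onto[OF C x(1)] by blast
    have "x = \<pi> \<cdot> j 0 \<cdot> y" using comp_subst_hom[OF \<pi>(2) j \<pi>(1) y(1)] y(2) by simp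
    then show ?thesis
      using comp_subst_hom[OF triangle_comp_null[OF tri] \<pi>(1) D(2) comp_hom[OF y(1) j]] x(2)
        HomD[OF y(1)] HomD[OF j[of 0]] D(15) by simp
  qed
  \<comment> \<open>The identity of \<open>E\<close> lifts through some stage, and the lift becomes
    zero on an arrow \<open>u\<close> whose cone \<open>E'\<close> is in \<open>I\<close>. Then
    \<open>u\<close> itself is zero, so \<open>E\<close> is a retract of \<open>E'\<close>.\<close>
  have neeman: "E \<in> I" if Ec: "compact_object \<kappa> K E" and L: "zero_object K L"
  proof -
    have "q \<cdot> Idn K E = Null K E L" using hom_to_zero[OF L D(2)] D by simp
    then obtain r where r: "r \<in> Hom K E T" "Idn K E = \<pi> \<cdot> r"
      using triangle_lift[OF tri ide_hom[OF E]] by blast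
    obtain n y where y: "y \<in> Hom K E (F n)" "r = j n \<cdot> y" using factor[OF Ec r(1)] by blast
    obtain D' E' u v w where U: "distinguished K D' E E' u v w" "E' \<in> I" "y \<cdot> u = Null K D' (F n)"
      using tors[of n] Ec y(1) unfolding torsion_object_def by blast
    note DU = triangleD[OF U(1)]
    have "r \<cdot> u = Null K D' T"
      unfolding y(2) using comp_assoc[OF DU(1) y(1) j] U(3) DU HomD[OF j[of n]] by simp
    then have "\<pi> \<cdot> r \<cdot> u = Null K D' E" using HomD[OF \<pi>(1)] DU by simp
    then have "Idn K E \<cdot> u = Null K D' E" using comp_assoc[OF DU(1) r(1) \<pi>(1)] r(2) by simp
    then obtain v' where v': "v' \<in> Hom K E' E" "Idn K E = v' \<cdot> v"
      using triangle_extend[OF U(1) ide_hom[OF E]] by blast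
    then show ?thesis using thick_retract[OF thick DU(2) v'(1)] U(2) by simp
  qed
  show ?thesis
  proof (rule that[OF tri])
    show "\<forall>\<L>. localizing \<kappa> K \<L> \<and> I \<subseteq> \<L> \<longrightarrow> T \<in> \<L>" using Tloc loc by blast
  qed (use local neeman in blast)+
qed

end

text \<open>Localization at all compact objects leaves an object without nonzero arrows from compact
  objects, hence zero. This lets one tensor factor at a time range over all of
  \<open>K\<close>.\<close>

lemma (in compactly_generated_mtc) localizing_all:
  assumes L: "localizing \<kappa> K L" and c: "\<And>C. compact_object \<kappa> K C \<Longrightarrow> C \<in> L" and E: "E \<in> Obj K"
  shows "E \<in> L"
proof -
  interpret compact_thick_subcategory K \<kappa> "{C. compact_object \<kappa> K C}"
    by unfold_locales (use compact_thick in auto)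
  obtain T L' \<pi> q h where T: "distinguished K T E L' \<pi> q h"
    and "\<forall>\<L>. localizing \<kappa> K \<L> \<and> {C. compact_object \<kappa> K C} \<subseteq> \<L> \<longrightarrow> T \<in> \<L>"
    and loc: "\<forall>C\<in>{C. compact_object \<kappa> K C}. \<forall>f \<in> Hom K C L'. f = Null K C L'"
    and "compact_object \<kappa> K E \<and> zero_object K L' \<longrightarrow> E \<in> {C. compact_object \<kappa> K C}"
    by (rule bousfield[OF E])
  then have "T \<in> L" using L c by blast
  have "zero_object K L'" using compact_generate[OF triangleD(15)[OF T]] loc by blast
  then show ?thesis
    using thick_subcategoryD(5)[OF localizing_thick[OF L] T] \<open>T \<in> L\<close> thick_zero[OF localizing_thick[OF L]] by blast
qed

section \<open>Tensor products, duals and thick ideals\<close>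

context monoidal_category
begin

lemma tensor_arr [simp]:
  assumes "f \<in> Arr K" "g \<in> Arr K"
  shows "f \<boxdot> g \<in> Arr K" "Dom K (f \<boxdot> g) = Dom K f \<boxtimes> Dom K g" "Cod K (f \<boxdot> g) = Cod K f \<boxtimes> Cod K g"
  using tensor_hom[of f "Dom K f" "Cod K f" g "Dom K g" "Cod K g"] assms by (auto simp: Hom_def)

lemma tensor_isomorphic:
  assumes "isomorphic K A A'" "isomorphic K B B'"
  shows "isomorphic K (A \<boxtimes> B) (A' \<boxtimes> B')"
proof -
  obtain f g where f: "f \<in> Hom K A A'" "g \<in> Hom K A' A" "g \<cdot> f = Idn K A" "f \<cdot> g = Idn K A'"
    using assms(1) by (rule isomorphicE)
  obtain h k where h: "h \<in> Hom K B B'" "k \<in> Hom K B' B" "k \<cdot> h = Idn K B" "h \<cdot> k = Idn K B'"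
    using assms(2) by (rule isomorphicE)
  show ?thesis
  proof (rule isomorphicI)
    show "f \<boxdot> h \<in> Hom K (A \<boxtimes> B) (A' \<boxtimes> B')" "g \<boxdot> k \<in> Hom K (A' \<boxtimes> B') (A \<boxtimes> B)"
      using tensor_hom f h by blast+
    show "(g \<boxdot> k) \<cdot> (f \<boxdot> h) = Idn K (A \<boxtimes> B)"
      using tensor_comp[OF f(1,2) h(1,2)] f(3) h(3) tensor_ide HomD(4)[OF f(1)] HomD(4)[OF h(1)] by simp
    show "(f \<boxdot> h) \<cdot> (g \<boxdot> k) = Idn K (A' \<boxtimes> B')"
      using tensor_comp[OF f(2,1) h(2,1)] f(4) h(4) tensor_ide HomD(5)[OF f(1)] HomD(5)[OF h(1)] by simp
  qed
qed

lemma assoc_isomorphic: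
  "A \<in> Obj K \<Longrightarrow> B \<in> Obj K \<Longrightarrow> C \<in> Obj K \<Longrightarrow> isomorphic K ((A \<boxtimes> B) \<boxtimes> C) (A \<boxtimes> (B \<boxtimes> C))"
  using assoc_iso unfolding isomorphic_def by blast

lemma lunit_isomorphic: "A \<in> Obj K \<Longrightarrow> isomorphic K (UnitO K \<boxtimes> A) A"
  using lunit_iso unfolding isomorphic_def by blast

lemma runit_isomorphic: "A \<in> Obj K \<Longrightarrow> isomorphic K (A \<boxtimes> UnitO K) A"
  using runit_iso unfolding isomorphic_def by blast

text \<open>The rebracketings that turn a two-sided multiple of \<open>M \<boxtimes> A\<close> or
  \<open>A \<boxtimes> M\<close> into one of \<open>A\<close>, together with \<open>A\<close> as a
  multiple of itself.\<close>

lemma sandwich_isomorphic: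
  assumes "A \<in> Obj K" "M \<in> Obj K" "X \<in> Obj K" "Y \<in> Obj K"
  shows "isomorphic K (((X \<boxtimes> M) \<boxtimes> A) \<boxtimes> Y) ((X \<boxtimes> (M \<boxtimes> A)) \<boxtimes> Y)"
    and "isomorphic K ((X \<boxtimes> A) \<boxtimes> (M \<boxtimes> Y)) ((X \<boxtimes> (A \<boxtimes> M)) \<boxtimes> Y)"
    and "isomorphic K ((UnitO K \<boxtimes> A) \<boxtimes> UnitO K) A"
proof -
  show "isomorphic K (((X \<boxtimes> M) \<boxtimes> A) \<boxtimes> Y) ((X \<boxtimes> (M \<boxtimes> A)) \<boxtimes> Y)"
    using tensor_isomorphic[OF assoc_isomorphic isomorphic_refl] assms by blast
  have "isomorphic K ((X \<boxtimes> A) \<boxtimes> (M \<boxtimes> Y)) (((X \<boxtimes> A) \<boxtimes> M) \<boxtimes> Y)"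
    using assoc_isomorphic isomorphic_sym tensor_obj assms by blast
  moreover have "isomorphic K (((X \<boxtimes> A) \<boxtimes> M) \<boxtimes> Y) ((X \<boxtimes> (A \<boxtimes> M)) \<boxtimes> Y)"
    using tensor_isomorphic[OF assoc_isomorphic isomorphic_refl] assms by blast
  ultimately show "isomorphic K ((X \<boxtimes> A) \<boxtimes> (M \<boxtimes> Y)) ((X \<boxtimes> (A \<boxtimes> M)) \<boxtimes> Y)"
    by (rule isomorphic_trans)
  have "isomorphic K ((UnitO K \<boxtimes> A) \<boxtimes> UnitO K) (UnitO K \<boxtimes> A)"
    using runit_isomorphic tensor_obj unit_obj assms by blast
  then show "isomorphic K ((UnitO K \<boxtimes> A) \<boxtimes> UnitO K) A"
    using lunit_isomorphic[OF assms(1)] isomorphic_trans by blast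
qed

end

context monoidal_triangulated_category
begin

lemma tensor_left_functor: "A \<in> Obj K \<Longrightarrow> additive_endofunctor K (\<lambda>B. A \<boxtimes> B) (\<lambda>f. Idn K A \<boxdot> f)"
  using tensor_left_exact unfolding exact_endofunctor_def by blast

lemma tensor_right_functor: "A \<in> Obj K \<Longrightarrow> additive_endofunctor K (\<lambda>B. B \<boxtimes> A) (\<lambda>f. f \<boxdot> Idn K A)"
  using tensor_right_exact unfolding exact_endofunctor_def by blast

lemma tensor_left_null:
  "A \<in> Obj K \<Longrightarrow> B \<in> Obj K \<Longrightarrow> C \<in> Obj K \<Longrightarrow> Idn K A \<boxdot> Null K B C = Null K (A \<boxtimes> B) (A \<boxtimes> C)"
  using additive_endofunctor_null[OF tensor_left_functor] by blast

lemma tensor_left_comp: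
  "A \<in> Obj K \<Longrightarrow> f \<in> Hom K B C \<Longrightarrow> g \<in> Hom K C D \<Longrightarrow>
    (Idn K A \<boxdot> g) \<cdot> (Idn K A \<boxdot> f) = Idn K A \<boxdot> (g \<cdot> f)"
  using additive_endofunctorD(4)[OF tensor_left_functor] by simp

lemma tensor_right_comp:
  "A \<in> Obj K \<Longrightarrow> f \<in> Hom K B C \<Longrightarrow> g \<in> Hom K C D \<Longrightarrow>
    (g \<boxdot> Idn K A) \<cdot> (f \<boxdot> Idn K A) = (g \<cdot> f) \<boxdot> Idn K A"
  using additive_endofunctorD(4)[OF tensor_right_functor] by simp

lemma tensor_interchange:
  assumes "f \<in> Hom K A A'" "g \<in> Hom K B B'"
  shows "(f \<boxdot> Idn K B') \<cdot> (Idn K A \<boxdot> g) = f \<boxdot> g" "(Idn K A' \<boxdot> g) \<cdot> (f \<boxdot> Idn K B) = f \<boxdot> g"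
  using tensor_comp[of "Idn K A" A A f A' g B B' "Idn K B'" B']
    tensor_comp[of f A A' "Idn K A'" A' "Idn K B" B B g B'] ide_hom assms HomD[OF assms(1)] HomD[OF assms(2)]
  by auto

lemma isomorphism_epi:
  assumes "isomorphism K A B e" "g \<in> Hom K B C" "g \<cdot> e = Null K A C"
  shows "g = Null K B C"
proof -
  obtain e' where e: "e \<in> Hom K A B" "e' \<in> Hom K B A" "e' \<cdot> e = Idn K A" "e \<cdot> e' = Idn K B"
    using assms(1) by (rule isomorphismE)
  have "(g \<cdot> e) \<cdot> e' = g" using e HomD[OF e(1)] HomD[OF e(2)] HomD[OF assms(2)] by simp
  then show ?thesis unfolding assms(3) using HomD[OF e(2)] HomD[OF assms(2)] by simp
qed

lemma isomorphism_mono: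
  assumes "isomorphism K A B e" "g \<in> Hom K C A" "e \<cdot> g = Null K C B"
  shows "g = Null K C A"
proof -
  obtain e' where e: "e \<in> Hom K A B" "e' \<in> Hom K B A" "e' \<cdot> e = Idn K A" "e \<cdot> e' = Idn K B"
    using assms(1) by (rule isomorphismE)
  have "e' \<cdot> (e \<cdot> g) = g" using inverse_cancel[OF e(3,1,2) assms(2)] .
  then show ?thesis unfolding assms(3) using HomD[OF e(2)] HomD[OF assms(2)] by simp
qed

lemma isomorphism_tensor_right:
  assumes "isomorphism K A B e" "C \<in> Obj K"
  shows "isomorphism K (A \<boxtimes> C) (B \<boxtimes> C) (e \<boxdot> Idn K C)"
proof -
  obtain e' where e: "e \<in> Hom K A B" "e' \<in> Hom K B A" "e' \<cdot> e = Idn K A" "e \<cdot> e' = Idn K B"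
    using assms(1) by (rule isomorphismE)
  show ?thesis unfolding isomorphism_def inverse_arrows_def
    using tensor_right_comp[OF assms(2) e(1,2)] tensor_right_comp[OF assms(2) e(2,1)] e
      tensor_hom[OF e(1) ide_hom[OF assms(2)]] tensor_hom[OF e(2) ide_hom[OF assms(2)]]
      tensor_ide HomD[OF e(1)] assms(2) by (intro exI[of _ "e' \<boxdot> Idn K C"]) simp
qed

lemma assoc_inverse_natural:
  assumes "inverse_arrows K ((A \<boxtimes> B) \<boxtimes> C) (A \<boxtimes> (B \<boxtimes> C)) (Assoc K A B C) \<beta>"
    and "inverse_arrows K ((A \<boxtimes> B) \<boxtimes> C') (A \<boxtimes> (B \<boxtimes> C')) (Assoc K A B C') \<beta>'"
    and A: "A \<in> Obj K" "B \<in> Obj K" and g: "g \<in> Hom K C C'"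
  shows "(Idn K (A \<boxtimes> B) \<boxdot> g) \<cdot> \<beta> = \<beta>' \<cdot> (Idn K A \<boxdot> (Idn K B \<boxdot> g))"
proof -
  let ?a = "Assoc K A B C" and ?a' = "Assoc K A B C'"
  let ?l = "Idn K (A \<boxtimes> B) \<boxdot> g" and ?r = "Idn K A \<boxdot> (Idn K B \<boxdot> g)"
  have a: "?a \<in> Hom K ((A \<boxtimes> B) \<boxtimes> C) (A \<boxtimes> (B \<boxtimes> C))" "\<beta> \<in> Hom K (A \<boxtimes> (B \<boxtimes> C)) ((A \<boxtimes> B) \<boxtimes> C)"
    "?a \<cdot> \<beta> = Idn K (A \<boxtimes> (B \<boxtimes> C))"
    and a': "?a' \<in> Hom K ((A \<boxtimes> B) \<boxtimes> C') (A \<boxtimes> (B \<boxtimes> C'))"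
    "\<beta>' \<in> Hom K (A \<boxtimes> (B \<boxtimes> C')) ((A \<boxtimes> B) \<boxtimes> C')" "\<beta>' \<cdot> ?a' = Idn K ((A \<boxtimes> B) \<boxtimes> C')"
    using assms(1,2) unfolding inverse_arrows_def by auto
  have l: "?l \<in> Hom K ((A \<boxtimes> B) \<boxtimes> C) ((A \<boxtimes> B) \<boxtimes> C')" "?r \<in> Hom K (A \<boxtimes> (B \<boxtimes> C)) (A \<boxtimes> (B \<boxtimes> C'))"
    using tensor_hom[OF ide_hom g] tensor_hom[OF ide_hom tensor_hom[OF ide_hom g]] A tensor_obj by auto
  have "?a' \<cdot> ?l = ?r \<cdot> ?a"
    using assoc_natural[OF ide_hom[OF A(1)] ide_hom[OF A(2)] g] tensor_ide[OF A] by simp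
  then have "(\<beta>' \<cdot> (?a' \<cdot> ?l)) \<cdot> \<beta> = (\<beta>' \<cdot> (?r \<cdot> ?a)) \<cdot> \<beta>" by simp
  moreover have "\<beta>' \<cdot> (?a' \<cdot> ?l) = ?l" using inverse_cancel[OF a'(3,1,2) l(1)] .
  moreover have "(\<beta>' \<cdot> (?r \<cdot> ?a)) \<cdot> \<beta> = \<beta>' \<cdot> ?r"
    using a(3) HomD(1,2,3)[OF a(1)] HomD(1,2,3)[OF a(2)] HomD(1,2,3)[OF a'(2)] HomD(1,2,3)[OF l(2)] by simp
  ultimately show ?thesis by simp
qed

text \<open>A zigzag identity recovers \<open>g\<close> from its transpose
  \<open>(Idn K C \<boxdot> g) \<cdot> coev\<close> by applying \<open>ev\<close>, so transposition
  detects zero. This is the form in which compactness of the unit passes to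
  \<open>D\<close>.\<close>

lemma dual_pair_detects_zero:
  assumes "dual_pair K D C" "C \<in> Obj K" "D \<in> Obj K"
  obtains coev where "coev \<in> Hom K (UnitO K) (C \<boxtimes> D)"
    "\<forall>T. \<forall>g \<in> Hom K D T. (Idn K C \<boxdot> g) \<cdot> coev = Null K (UnitO K) (C \<boxtimes> T) \<longrightarrow> g = Null K D T"
proof -
  obtain ev coev \<beta> where ev: "ev \<in> Hom K (D \<boxtimes> C) (UnitO K)" and coev: "coev \<in> Hom K (UnitO K) (C \<boxtimes> D)"
    and \<beta>: "inverse_arrows K ((D \<boxtimes> C) \<boxtimes> D) (D \<boxtimes> (C \<boxtimes> D)) (Assoc K D C D) \<beta>"
    and z: "LUnit K D \<cdot> (ev \<boxdot> Idn K D) \<cdot> \<beta> \<cdot> (Idn K D \<boxdot> coev) = RUnit K D"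
    using assms(1) unfolding dual_pair_def by blast
  have b: "\<beta> \<in> Hom K (D \<boxtimes> (C \<boxtimes> D)) ((D \<boxtimes> C) \<boxtimes> D)" using \<beta> unfolding inverse_arrows_def by blast
  have "g = Null K D T" if g: "g \<in> Hom K D T" and 0: "(Idn K C \<boxdot> g) \<cdot> coev = Null K (UnitO K) (C \<boxtimes> T)" for g T
  proof (rule isomorphism_epi[OF runit_iso[OF assms(3)] g])
    have T: "T \<in> Obj K" using HomD[OF g] by simp
    obtain \<beta>' where \<beta>': "inverse_arrows K ((D \<boxtimes> C) \<boxtimes> T) (D \<boxtimes> (C \<boxtimes> T)) (Assoc K D C T) \<beta>'"
      using assoc_iso[OF assms(3,2) T] unfolding isomorphism_def by blast
    have b': "\<beta>' \<in> Hom K (D \<boxtimes> (C \<boxtimes> T)) ((D \<boxtimes> C) \<boxtimes> T)" using \<beta>' unfolding inverse_arrows_def by blast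
    have evD: "ev \<boxdot> Idn K D \<in> Hom K ((D \<boxtimes> C) \<boxtimes> D) (UnitO K \<boxtimes> D)" using tensor_hom[OF ev ide_hom[OF assms(3)]] .
    have evT: "ev \<boxdot> Idn K T \<in> Hom K ((D \<boxtimes> C) \<boxtimes> T) (UnitO K \<boxtimes> T)" using tensor_hom[OF ev ide_hom[OF T]] .
    have Dc: "Idn K D \<boxdot> coev \<in> Hom K (D \<boxtimes> UnitO K) (D \<boxtimes> (C \<boxtimes> D))" using tensor_hom[OF ide_hom[OF assms(3)] coev] .
    have lD: "LUnit K D \<in> Hom K (UnitO K \<boxtimes> D) D" and lT: "LUnit K T \<in> Hom K (UnitO K \<boxtimes> T) T"
      using lunit_iso assms(3) T unfolding isomorphism_def inverse_arrows_def by blast+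
    have DC: "D \<boxtimes> C \<in> Obj K" using tensor_obj assms by blast
    have g1: "Idn K (UnitO K) \<boxdot> g \<in> Hom K (UnitO K \<boxtimes> D) (UnitO K \<boxtimes> T)" using tensor_hom[OF ide_hom[OF unit_obj] g] .
    have gDC: "Idn K (D \<boxtimes> C) \<boxdot> g \<in> Hom K ((D \<boxtimes> C) \<boxtimes> D) ((D \<boxtimes> C) \<boxtimes> T)" using tensor_hom[OF ide_hom[OF DC] g] .
    have gC: "Idn K C \<boxdot> g \<in> Hom K (C \<boxtimes> D) (C \<boxtimes> T)" using tensor_hom[OF ide_hom[OF assms(2)] g] .
    have gD: "Idn K D \<boxdot> (Idn K C \<boxdot> g) \<in> Hom K (D \<boxtimes> (C \<boxtimes> D)) (D \<boxtimes> (C \<boxtimes> T))"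
      using tensor_hom[OF ide_hom[OF assms(3)] gC] .
    let ?x = "\<beta> \<cdot> (Idn K D \<boxdot> coev)"
    have x: "?x \<in> Hom K (D \<boxtimes> UnitO K) ((D \<boxtimes> C) \<boxtimes> D)" using comp_hom[OF Dc b] .
    \<comment> \<open>Naturality moves \<open>g\<close> past the left unitor, the evaluation and the
      inverse associator until it meets \<open>coev\<close>, where the hypothesis applies.\<close>
    have "g \<cdot> RUnit K D = (g \<cdot> LUnit K D) \<cdot> ((ev \<boxdot> Idn K D) \<cdot> ?x)"
      unfolding z[symmetric] using comp_assoc[OF comp_hom[OF x evD] lD g] .
    also have "g \<cdot> LUnit K D = LUnit K T \<cdot> (Idn K (UnitO K) \<boxdot> g)" using lunit_natural[OF g] by simp
    also have "(LUnit K T \<cdot> (Idn K (UnitO K) \<boxdot> g)) \<cdot> ((ev \<boxdot> Idn K D) \<cdot> ?x)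
        = LUnit K T \<cdot> ((Idn K (UnitO K) \<boxdot> g) \<cdot> ((ev \<boxdot> Idn K D) \<cdot> ?x))"
      by (rule comp_assoc[OF comp_hom[OF x evD] g1 lT, symmetric])
    also have "(Idn K (UnitO K) \<boxdot> g) \<cdot> ((ev \<boxdot> Idn K D) \<cdot> ?x)
        = ((ev \<boxdot> Idn K T) \<cdot> (Idn K (D \<boxtimes> C) \<boxdot> g)) \<cdot> ?x"
      unfolding tensor_interchange(1)[OF ev g]
      by (rule comp_subst_hom[OF tensor_interchange(2)[OF ev g] evD g1 x])
    also have "\<dots> = (ev \<boxdot> Idn K T) \<cdot> ((Idn K (D \<boxtimes> C) \<boxdot> g) \<cdot> ?x)"
      by (rule comp_assoc[OF x gDC evT, symmetric])
    also have "(Idn K (D \<boxtimes> C) \<boxdot> g) \<cdot> ?x = (\<beta>' \<cdot> (Idn K D \<boxdot> (Idn K C \<boxdot> g))) \<cdot> (Idn K D \<boxdot> coev)"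
      by (rule comp_subst_hom[OF assoc_inverse_natural[OF \<beta> \<beta>' assms(3,2) g] b gDC Dc])
    also have "\<dots> = \<beta>' \<cdot> ((Idn K D \<boxdot> (Idn K C \<boxdot> g)) \<cdot> (Idn K D \<boxdot> coev))"
      by (rule comp_assoc[OF Dc gD b', symmetric])
    also have "(Idn K D \<boxdot> (Idn K C \<boxdot> g)) \<cdot> (Idn K D \<boxdot> coev) = Null K (D \<boxtimes> UnitO K) (D \<boxtimes> (C \<boxtimes> T))"
      unfolding tensor_left_comp[OF assms(3) coev gC] 0
      using tensor_left_null[OF assms(3) unit_obj] tensor_obj assms(2) T by simp
    finally show "g \<cdot> RUnit K D = Null K (D \<boxtimes> UnitO K) T"
      using HomD[OF b'] HomD[OF evT] HomD[OF lT] HomD[OF Dc] by simp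
  qed
  then show ?thesis using that coev by blast
qed

text \<open>A zigzag identity splits \<open>D\<close> off
  \<open>D \<boxtimes> (C \<boxtimes> D)\<close>; this is how an ideal containing \<open>C\<close>
  is seen to contain its dual.\<close>

lemma dual_retract:
  assumes "dual_pair K D C" "C \<in> Obj K" "D \<in> Obj K"
  obtains i p where "i \<in> Hom K D (D \<boxtimes> (C \<boxtimes> D))" "p \<in> Hom K (D \<boxtimes> (C \<boxtimes> D)) D" "p \<cdot> i = Idn K D"
proof -
  obtain ev coev \<beta> where ev: "ev \<in> Hom K (D \<boxtimes> C) (UnitO K)" and coev: "coev \<in> Hom K (UnitO K) (C \<boxtimes> D)"
    and \<beta>: "inverse_arrows K ((D \<boxtimes> C) \<boxtimes> D) (D \<boxtimes> (C \<boxtimes> D)) (Assoc K D C D) \<beta>"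
    and z: "LUnit K D \<cdot> (ev \<boxdot> Idn K D) \<cdot> \<beta> \<cdot> (Idn K D \<boxdot> coev) = RUnit K D"
    using assms(1) unfolding dual_pair_def by blast
  have b: "\<beta> \<in> Hom K (D \<boxtimes> (C \<boxtimes> D)) ((D \<boxtimes> C) \<boxtimes> D)" using \<beta> unfolding inverse_arrows_def by blast
  have evD: "ev \<boxdot> Idn K D \<in> Hom K ((D \<boxtimes> C) \<boxtimes> D) (UnitO K \<boxtimes> D)" using tensor_hom[OF ev ide_hom[OF assms(3)]] .
  have Dc: "Idn K D \<boxdot> coev \<in> Hom K (D \<boxtimes> UnitO K) (D \<boxtimes> (C \<boxtimes> D))" using tensor_hom[OF ide_hom[OF assms(3)] coev] .
  have lD: "LUnit K D \<in> Hom K (UnitO K \<boxtimes> D) D"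
    using lunit_iso assms(3) unfolding isomorphism_def inverse_arrows_def by blast
  obtain r where r: "RUnit K D \<in> Hom K (D \<boxtimes> UnitO K) D" "r \<in> Hom K D (D \<boxtimes> UnitO K)" "RUnit K D \<cdot> r = Idn K D"
    using isomorphismE[OF runit_iso[OF assms(3)]] by blast
  let ?p = "LUnit K D \<cdot> (ev \<boxdot> Idn K D) \<cdot> \<beta>" and ?i = "(Idn K D \<boxdot> coev) \<cdot> r"
  have p: "?p \<in> Hom K (D \<boxtimes> (C \<boxtimes> D)) D" using comp_hom[OF comp_hom[OF b evD] lD] .
  have i: "?i \<in> Hom K D (D \<boxtimes> (C \<boxtimes> D))" using comp_hom[OF r(2) Dc] .
  have "?p \<cdot> (Idn K D \<boxdot> coev) = RUnit K D"
    unfolding z[symmetric] using HomD[OF b] HomD[OF evD] HomD[OF Dc] HomD[OF lD] by simp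
  then have "?p \<cdot> ?i = RUnit K D \<cdot> r" by (rule comp_subst_hom[OF _ Dc p r(2)])
  then show ?thesis using that i p r(3) by simp
qed

text \<open>The composite of \<open>coev \<otimes> (C \<otimes> L)\<close> with \<open>R\<close> below is a zigzag tensored with \<open>L\<close>, hence invertible.
  Only this is needed, not the adjunction isomorphism itself, so that the pentagon and triangle axioms
  suffice without further coherence.\<close>

lemma dual_hom_vanish:
  assumes dp: "dual_pair K D C" and C: "C \<in> Obj K" and D: "D \<in> Obj K" and L: "L \<in> Obj K"
    and f: "f \<in> Hom K X (C \<boxtimes> L)" and v: "\<And>w. w \<in> Hom K (D \<boxtimes> X) L \<Longrightarrow> w = Null K (D \<boxtimes> X) L"
  shows "f = Null K X (C \<boxtimes> L)"
proof -
  obtain ev coev where ev: "ev \<in> Hom K (D \<boxtimes> C) (UnitO K)" and coev: "coev \<in> Hom K (UnitO K) (C \<boxtimes> D)"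
    and z: "RUnit K C \<cdot> (Idn K C \<boxdot> ev) \<cdot> Assoc K C D C \<cdot> (coev \<boxdot> Idn K C) = LUnit K C"
    using dp unfolding dual_pair_def by blast
  have X: "X \<in> Obj K" using HomD[OF f] by simp
  note O = C D L X unit_obj tensor_obj
  have ah: "Assoc K A B E \<in> Hom K ((A \<boxtimes> B) \<boxtimes> E) (A \<boxtimes> (B \<boxtimes> E))"
    if "A \<in> Obj K" "B \<in> Obj K" "E \<in> Obj K" for A B E
    using assoc_iso[OF that] unfolding isomorphism_def inverse_arrows_def by blast
  have lL: "LUnit K L \<in> Hom K (UnitO K \<boxtimes> L) L"
    using lunit_iso[OF L] unfolding isomorphism_def inverse_arrows_def by blast
  have rC: "RUnit K C \<in> Hom K (C \<boxtimes> UnitO K) C"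
    using runit_iso[OF C] unfolding isomorphism_def inverse_arrows_def by blast
  obtain \<gamma> where \<gamma>: "Assoc K D C L \<in> Hom K ((D \<boxtimes> C) \<boxtimes> L) (D \<boxtimes> (C \<boxtimes> L))"
    "\<gamma> \<in> Hom K (D \<boxtimes> (C \<boxtimes> L)) ((D \<boxtimes> C) \<boxtimes> L)" "\<gamma> \<cdot> Assoc K D C L = Idn K ((D \<boxtimes> C) \<boxtimes> L)"
    using isomorphismE[OF assoc_iso[OF D C L]] by blast
  let ?iC = "Idn K C" and ?iL = "Idn K L"
  define e where "e = LUnit K L \<cdot> (ev \<boxdot> ?iL)"
  have evL: "ev \<boxdot> ?iL \<in> Hom K ((D \<boxtimes> C) \<boxtimes> L) (UnitO K \<boxtimes> L)" using tensor_hom[OF ev ide_hom[OF L]] .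
  have e: "e \<in> Hom K ((D \<boxtimes> C) \<boxtimes> L) L" unfolding e_def using comp_hom[OF evL lL] .
  \<comment> \<open>The counit at \<open>L\<close> of the adjunction between tensoring with
    \<open>D\<close> and with \<open>C\<close>. Composed with \<open>Idn K D \<boxdot> f\<close> it
    is the transpose of \<open>f\<close>, which vanishes by assumption.\<close>
  define r where "r = e \<cdot> \<gamma>"
  have r: "r \<in> Hom K (D \<boxtimes> (C \<boxtimes> L)) L" unfolding r_def using comp_hom[OF \<gamma>(2) e] .
  have Df: "Idn K D \<boxdot> f \<in> Hom K (D \<boxtimes> X) (D \<boxtimes> (C \<boxtimes> L))" using tensor_hom[OF ide_hom[OF D] f] .
  have rf: "r \<cdot> (Idn K D \<boxdot> f) = Null K (D \<boxtimes> X) L" using v[OF comp_hom[OF Df r]] .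
  have Cr: "?iC \<boxdot> r \<in> Hom K (C \<boxtimes> (D \<boxtimes> (C \<boxtimes> L))) (C \<boxtimes> L)" using tensor_hom[OF ide_hom[OF C] r] .
  have a1: "Assoc K C D (C \<boxtimes> L) \<in> Hom K ((C \<boxtimes> D) \<boxtimes> (C \<boxtimes> L)) (C \<boxtimes> (D \<boxtimes> (C \<boxtimes> L)))" using ah O by blast
  define R where "R = (?iC \<boxdot> r) \<cdot> Assoc K C D (C \<boxtimes> L)"
  have R: "R \<in> Hom K ((C \<boxtimes> D) \<boxtimes> (C \<boxtimes> L)) (C \<boxtimes> L)" unfolding R_def using comp_hom[OF a1 Cr] .
  have CDf: "Idn K (C \<boxtimes> D) \<boxdot> f \<in> Hom K ((C \<boxtimes> D) \<boxtimes> X) ((C \<boxtimes> D) \<boxtimes> (C \<boxtimes> L))"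
    using tensor_hom[OF ide_hom f] O by blast
  have aX: "Assoc K C D X \<in> Hom K ((C \<boxtimes> D) \<boxtimes> X) (C \<boxtimes> (D \<boxtimes> X))" using ah O by blast
  have CDf': "?iC \<boxdot> (Idn K D \<boxdot> f) \<in> Hom K (C \<boxtimes> (D \<boxtimes> X)) (C \<boxtimes> (D \<boxtimes> (C \<boxtimes> L)))"
    using tensor_hom[OF ide_hom[OF C] Df] .
  have "R \<cdot> (Idn K (C \<boxtimes> D) \<boxdot> f) = (?iC \<boxdot> r) \<cdot> (Assoc K C D (C \<boxtimes> L) \<cdot> (Idn K (C \<boxtimes> D) \<boxdot> f))"
    unfolding R_def by (rule comp_assoc[OF CDf a1 Cr, symmetric])
  also have "Assoc K C D (C \<boxtimes> L) \<cdot> (Idn K (C \<boxtimes> D) \<boxdot> f) = (?iC \<boxdot> (Idn K D \<boxdot> f)) \<cdot> Assoc K C D X"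
    using assoc_natural[OF ide_hom[OF C] ide_hom[OF D] f] tensor_ide[OF C D] by simp
  also have "(?iC \<boxdot> r) \<cdot> ((?iC \<boxdot> (Idn K D \<boxdot> f)) \<cdot> Assoc K C D X) = (?iC \<boxdot> Null K (D \<boxtimes> X) L) \<cdot> Assoc K C D X"
    by (rule comp_subst_hom[OF _ CDf' Cr aX]) (simp add: tensor_left_comp[OF C Df r] rf)
  also have "\<dots> = Null K ((C \<boxtimes> D) \<boxtimes> X) (C \<boxtimes> L)"
    using tensor_left_null[OF C _ L] HomD[OF aX] O by simp
  finally have Rf: "R \<cdot> (Idn K (C \<boxtimes> D) \<boxdot> f) = Null K ((C \<boxtimes> D) \<boxtimes> X) (C \<boxtimes> L)" .
  have cCL: "coev \<boxdot> Idn K (C \<boxtimes> L) \<in> Hom K (UnitO K \<boxtimes> (C \<boxtimes> L)) ((C \<boxtimes> D) \<boxtimes> (C \<boxtimes> L))"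
    using tensor_hom[OF coev ide_hom] O by blast
  have cX: "coev \<boxdot> Idn K X \<in> Hom K (UnitO K \<boxtimes> X) ((C \<boxtimes> D) \<boxtimes> X)" using tensor_hom[OF coev ide_hom[OF X]] .
  have f1: "Idn K (UnitO K) \<boxdot> f \<in> Hom K (UnitO K \<boxtimes> X) (UnitO K \<boxtimes> (C \<boxtimes> L))"
    using tensor_hom[OF ide_hom[OF unit_obj] f] .
  have "(R \<cdot> (coev \<boxdot> Idn K (C \<boxtimes> L))) \<cdot> (Idn K (UnitO K) \<boxdot> f)
      = R \<cdot> ((coev \<boxdot> Idn K (C \<boxtimes> L)) \<cdot> (Idn K (UnitO K) \<boxdot> f))"
    by (rule comp_assoc[OF f1 cCL R, symmetric])
  also have "(coev \<boxdot> Idn K (C \<boxtimes> L)) \<cdot> (Idn K (UnitO K) \<boxdot> f) = (Idn K (C \<boxtimes> D) \<boxdot> f) \<cdot> (coev \<boxdot> Idn K X)"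
    unfolding tensor_interchange[OF coev f] ..
  also have "R \<cdot> \<dots> = Null K ((C \<boxtimes> D) \<boxtimes> X) (C \<boxtimes> L) \<cdot> (coev \<boxdot> Idn K X)"
    by (rule comp_subst_hom[OF Rf CDf R cX])
  also have "\<dots> = Null K (UnitO K \<boxtimes> X) (C \<boxtimes> L)" using HomD[OF cX] O by simp
  finally have zero: "(R \<cdot> (coev \<boxdot> Idn K (C \<boxtimes> L))) \<cdot> (Idn K (UnitO K) \<boxdot> f) = Null K (UnitO K \<boxtimes> X) (C \<boxtimes> L)" .

  define U where "U = R \<cdot> (coev \<boxdot> Idn K (C \<boxtimes> L))"
  have U: "U \<in> Hom K (UnitO K \<boxtimes> (C \<boxtimes> L)) (C \<boxtimes> L)" unfolding U_def using comp_hom[OF cCL R] .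
  let ?\<alpha> = "Assoc K (UnitO K) C L"
  have \<alpha>: "?\<alpha> \<in> Hom K ((UnitO K \<boxtimes> C) \<boxtimes> L) (UnitO K \<boxtimes> (C \<boxtimes> L))" using ah O by blast
  \<comment> \<open>Pentagon and unit triangle reduce this composite to the zigzag identity for
    \<open>C\<close>, tensored with \<open>L\<close>.\<close>
  have U\<alpha>: "U \<cdot> ?\<alpha> = LUnit K C \<boxdot> ?iL"
  proof -
    let ?p = "coev \<boxdot> ?iC" and ?a2 = "Assoc K (C \<boxtimes> D) C L" and ?a3 = "Assoc K D C L"
      and ?a4 = "Assoc K C (D \<boxtimes> C) L" and ?a5 = "Assoc K C D C" and ?a6 = "Assoc K C (UnitO K) L"
    have p: "?p \<in> Hom K (UnitO K \<boxtimes> C) ((C \<boxtimes> D) \<boxtimes> C)" using tensor_hom[OF coev ide_hom[OF C]] .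
    have pL: "?p \<boxdot> ?iL \<in> Hom K ((UnitO K \<boxtimes> C) \<boxtimes> L) (((C \<boxtimes> D) \<boxtimes> C) \<boxtimes> L)" using tensor_hom[OF p ide_hom[OF L]] .
    have a2: "?a2 \<in> Hom K (((C \<boxtimes> D) \<boxtimes> C) \<boxtimes> L) ((C \<boxtimes> D) \<boxtimes> (C \<boxtimes> L))" using ah O by blast
    have a4: "?a4 \<in> Hom K ((C \<boxtimes> (D \<boxtimes> C)) \<boxtimes> L) (C \<boxtimes> ((D \<boxtimes> C) \<boxtimes> L))" using ah O by blast
    have a5: "?a5 \<in> Hom K ((C \<boxtimes> D) \<boxtimes> C) (C \<boxtimes> (D \<boxtimes> C))" using ah O by blast
    have a6: "?a6 \<in> Hom K ((C \<boxtimes> UnitO K) \<boxtimes> L) (C \<boxtimes> (UnitO K \<boxtimes> L))" using ah O by blast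
    have Ca3: "?iC \<boxdot> ?a3 \<in> Hom K (C \<boxtimes> ((D \<boxtimes> C) \<boxtimes> L)) (C \<boxtimes> (D \<boxtimes> (C \<boxtimes> L)))" using tensor_hom[OF ide_hom[OF C] \<gamma>(1)] .
    have a5L: "?a5 \<boxdot> ?iL \<in> Hom K (((C \<boxtimes> D) \<boxtimes> C) \<boxtimes> L) ((C \<boxtimes> (D \<boxtimes> C)) \<boxtimes> L)" using tensor_hom[OF a5 ide_hom[OF L]] .
    have CevL: "?iC \<boxdot> (ev \<boxdot> ?iL) \<in> Hom K (C \<boxtimes> ((D \<boxtimes> C) \<boxtimes> L)) (C \<boxtimes> (UnitO K \<boxtimes> L))" using tensor_hom[OF ide_hom[OF C] evL] .
    have Cev: "?iC \<boxdot> ev \<in> Hom K (C \<boxtimes> (D \<boxtimes> C)) (C \<boxtimes> UnitO K)" using tensor_hom[OF ide_hom[OF C] ev] .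
    have CevL': "(?iC \<boxdot> ev) \<boxdot> ?iL \<in> Hom K ((C \<boxtimes> (D \<boxtimes> C)) \<boxtimes> L) ((C \<boxtimes> UnitO K) \<boxtimes> L)" using tensor_hom[OF Cev ide_hom[OF L]] .
    have ClL: "?iC \<boxdot> LUnit K L \<in> Hom K (C \<boxtimes> (UnitO K \<boxtimes> L)) (C \<boxtimes> L)" using tensor_hom[OF ide_hom[OF C] lL] .
    let ?y = "(?a5 \<boxdot> ?iL) \<cdot> (?p \<boxdot> ?iL)"
    have y: "?y \<in> Hom K ((UnitO K \<boxtimes> C) \<boxtimes> L) ((C \<boxtimes> (D \<boxtimes> C)) \<boxtimes> L)" using comp_hom[OF pL a5L] .
    have "U \<cdot> ?\<alpha> = R \<cdot> ((coev \<boxdot> Idn K (C \<boxtimes> L)) \<cdot> ?\<alpha>)"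
      unfolding U_def by (rule comp_assoc[OF \<alpha> cCL R, symmetric])
    also have "(coev \<boxdot> Idn K (C \<boxtimes> L)) \<cdot> ?\<alpha> = ?a2 \<cdot> (?p \<boxdot> ?iL)"
      using assoc_natural[OF coev ide_hom[OF C] ide_hom[OF L]] tensor_ide[OF C L] by simp
    also have "R \<cdot> (?a2 \<cdot> (?p \<boxdot> ?iL)) = (?iC \<boxdot> r) \<cdot> (Assoc K C D (C \<boxtimes> L) \<cdot> (?a2 \<cdot> (?p \<boxdot> ?iL)))"
      unfolding R_def by (rule comp_assoc[OF comp_hom[OF pL a2] a1 Cr, symmetric])
    also have "Assoc K C D (C \<boxtimes> L) \<cdot> (?a2 \<cdot> (?p \<boxdot> ?iL)) = ((?iC \<boxdot> ?a3) \<cdot> ?a4 \<cdot> (?a5 \<boxdot> ?iL)) \<cdot> (?p \<boxdot> ?iL)"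
      by (rule comp_subst_hom[OF pentagon[OF C D C L] a2 a1 pL])
    also have "\<dots> = (?iC \<boxdot> ?a3) \<cdot> ((?a4 \<cdot> (?a5 \<boxdot> ?iL)) \<cdot> (?p \<boxdot> ?iL))"
      by (rule comp_assoc[OF pL comp_hom[OF a5L a4] Ca3, symmetric])
    also have "(?a4 \<cdot> (?a5 \<boxdot> ?iL)) \<cdot> (?p \<boxdot> ?iL) = ?a4 \<cdot> ?y"
      by (rule comp_assoc[OF pL a5L a4, symmetric])
    also have "(?iC \<boxdot> r) \<cdot> ((?iC \<boxdot> ?a3) \<cdot> (?a4 \<cdot> ?y)) = (?iC \<boxdot> e) \<cdot> (?a4 \<cdot> ?y)"
    proof (rule comp_subst_hom[OF _ Ca3 Cr comp_hom[OF y a4]])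
      have "r \<cdot> ?a3 = e"
        unfolding r_def using HomD[OF e] HomD[OF \<gamma>(1)] HomD[OF \<gamma>(2)] \<gamma>(3) by simp
      then show "(?iC \<boxdot> r) \<cdot> (?iC \<boxdot> ?a3) = ?iC \<boxdot> e" using tensor_left_comp[OF C \<gamma>(1) r] by simp
    qed
    also have "?iC \<boxdot> e = (?iC \<boxdot> LUnit K L) \<cdot> (?iC \<boxdot> (ev \<boxdot> ?iL))"
      unfolding e_def using tensor_left_comp[OF C evL lL] by simp
    also have "((?iC \<boxdot> LUnit K L) \<cdot> (?iC \<boxdot> (ev \<boxdot> ?iL))) \<cdot> (?a4 \<cdot> ?y)
        = (?iC \<boxdot> LUnit K L) \<cdot> ((?iC \<boxdot> (ev \<boxdot> ?iL)) \<cdot> (?a4 \<cdot> ?y))"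
      by (rule comp_assoc[OF comp_hom[OF y a4] CevL ClL, symmetric])
    also have "(?iC \<boxdot> (ev \<boxdot> ?iL)) \<cdot> (?a4 \<cdot> ?y) = (?a6 \<cdot> ((?iC \<boxdot> ev) \<boxdot> ?iL)) \<cdot> ?y"
      by (rule comp_subst_hom[OF assoc_natural[OF ide_hom[OF C] ev ide_hom[OF L], symmetric] a4 CevL y])
    also have "\<dots> = ?a6 \<cdot> (((?iC \<boxdot> ev) \<boxdot> ?iL) \<cdot> ?y)"
      by (rule comp_assoc[OF y CevL' a6, symmetric])
    also have "(?iC \<boxdot> LUnit K L) \<cdot> (?a6 \<cdot> (((?iC \<boxdot> ev) \<boxdot> ?iL) \<cdot> ?y)) = (RUnit K C \<boxdot> ?iL) \<cdot> (((?iC \<boxdot> ev) \<boxdot> ?iL) \<cdot> ?y)"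
      by (rule comp_subst_hom[OF unit_triangle[OF C L] a6 ClL comp_hom[OF y CevL']])
    also have "?y = (?a5 \<cdot> ?p) \<boxdot> ?iL" by (rule tensor_right_comp[OF L p a5])
    also have "((?iC \<boxdot> ev) \<boxdot> ?iL) \<cdot> \<dots> = ((?iC \<boxdot> ev) \<cdot> ?a5 \<cdot> ?p) \<boxdot> ?iL"
      by (rule tensor_right_comp[OF L comp_hom[OF p a5] Cev])
    also have "(RUnit K C \<boxdot> ?iL) \<cdot> \<dots> = (RUnit K C \<cdot> (?iC \<boxdot> ev) \<cdot> ?a5 \<cdot> ?p) \<boxdot> ?iL"
      by (rule tensor_right_comp[OF L comp_hom[OF comp_hom[OF p a5] Cev] rC])
    finally show ?thesis unfolding z .
  qed
  \<comment> \<open>By \<open>U\<alpha>\<close> the arrow \<open>U\<close> is invertible up to the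
    associator, so it can be cancelled from the equation \<open>zero\<close>.\<close>
  have f0: "Idn K (UnitO K) \<boxdot> f = Null K (UnitO K \<boxtimes> X) (UnitO K \<boxtimes> (C \<boxtimes> L))"
  proof -
    obtain \<alpha>' where \<alpha>': "\<alpha>' \<in> Hom K (UnitO K \<boxtimes> (C \<boxtimes> L)) ((UnitO K \<boxtimes> C) \<boxtimes> L)"
      "\<alpha>' \<cdot> ?\<alpha> = Idn K ((UnitO K \<boxtimes> C) \<boxtimes> L)" "?\<alpha> \<cdot> \<alpha>' = Idn K (UnitO K \<boxtimes> (C \<boxtimes> L))"
      using isomorphismE[OF assoc_iso[OF unit_obj C L]] by blast
    let ?f = "\<alpha>' \<cdot> (Idn K (UnitO K) \<boxdot> f)"
    have f': "?f \<in> Hom K (UnitO K \<boxtimes> X) ((UnitO K \<boxtimes> C) \<boxtimes> L)" using comp_hom[OF f1 \<alpha>'(1)] .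
    have \<alpha>f: "?\<alpha> \<cdot> ?f = Idn K (UnitO K) \<boxdot> f" using inverse_cancel[OF \<alpha>'(3,1) \<alpha> f1] .
    have "(LUnit K C \<boxdot> ?iL) \<cdot> ?f = U \<cdot> (?\<alpha> \<cdot> ?f)" by (rule comp_subst_hom[OF U\<alpha> \<alpha> U f', symmetric])
    also have "\<dots> = Null K (UnitO K \<boxtimes> X) (C \<boxtimes> L)" unfolding \<alpha>f U_def by (rule zero)
    finally have "?f = Null K (UnitO K \<boxtimes> X) ((UnitO K \<boxtimes> C) \<boxtimes> L)"
      by (rule isomorphism_mono[OF isomorphism_tensor_right[OF lunit_iso[OF C] L] f'])
    then show ?thesis using \<alpha>f HomD[OF \<alpha>] O by simp
  qed
  show ?thesis
  proof (rule isomorphism_epi[OF lunit_iso[OF X] f])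
    have "f \<cdot> LUnit K X = LUnit K (C \<boxtimes> L) \<cdot> (Idn K (UnitO K) \<boxdot> f)" using lunit_natural[OF f] by simp
    then show "f \<cdot> LUnit K X = Null K (UnitO K \<boxtimes> X) (C \<boxtimes> L)"
      unfolding f0 using lunit_iso[of "C \<boxtimes> L"] O unfolding isomorphism_def inverse_arrows_def
      by (auto simp: Hom_def)
  qed
qed

end

section \<open>Localizing subcategories and the thick ideals inside them\<close>

context compactly_generated_mtc
begin

lemma localizing_iso: "localizing \<kappa> K L \<Longrightarrow> isomorphic K A B \<Longrightarrow> A \<in> L \<Longrightarrow> B \<in> L"
  using thick_iso[OF localizing_thick] by blast

lemma localizing_iso_iff: "localizing \<kappa> K L \<Longrightarrow> isomorphic K A B \<Longrightarrow> A \<in> L \<longleftrightarrow> B \<in> L"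
  using localizing_iso isomorphic_sym by blast

text \<open>Tensoring with a fixed object is exact and preserves coproducts, so conditions on one
  tensor factor cut out localizing subcategories; every extension from compact objects to all of
  \<open>K\<close> rests on this.\<close>

lemma localizing_vimage:
  assumes F: "exact_endofunctor K Fo Fa" and L: "localizing \<kappa> K L"
    and cp: "\<And>(I :: 'u set) M S \<iota>. small \<kappa> I \<Longrightarrow> coproduct K I M S \<iota> \<Longrightarrow>
       coproduct K I (\<lambda>i. Fo (M i)) (Fo S) (\<lambda>i. Fa (\<iota> i))"
  shows "localizing \<kappa> K {A \<in> Obj K. Fo A \<in> L}"
  unfolding localizing_def
proof (intro conjI allI impI)
  obtain \<phi> where add: "additive_endofunctor K Fo Fa"
    and \<phi>: "\<forall>A\<in>Obj K. isomorphism K (Fo (ShiftO K A)) (ShiftO K (Fo A)) (\<phi> A)"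
    and ex: "\<forall>A B C f g h. distinguished K A B C f g h \<longrightarrow>
             distinguished K (Fo A) (Fo B) (Fo C) (Fa f) (Fa g) (\<phi> A \<cdot> Fa h)"
    using F unfolding exact_endofunctor_def by blast
  note D = additive_endofunctorD[OF add] and T = localizing_thick[OF L]
  show "thick_subcategory K {A \<in> Obj K. Fo A \<in> L}"
  proof (rule thick_subcategoryI)
    fix Z assume Z: "zero_object K Z"
    then have "zero_object K (Fo Z)"
      using D(1,2)[of Z] additive_endofunctor_null[OF add, of Z Z] unfolding zero_object_iff by simp
    then show "Z \<in> {A \<in> Obj K. Fo A \<in> L}" using thick_zero[OF T] zero_object_obj[OF Z] by blast
  next
    fix A assume A: "A \<in> Obj K"
    have "isomorphic K (Fo (ShiftO K A)) (ShiftO K (Fo A))" using \<phi> A unfolding isomorphic_def by blast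
    then have "Fo (ShiftO K A) \<in> L \<longleftrightarrow> Fo A \<in> L"
      using localizing_iso_iff[OF L] thick_subcategoryD(2)[OF T D(1)[OF A]] by blast
    then show "ShiftO K A \<in> {A \<in> Obj K. Fo A \<in> L} \<longleftrightarrow> A \<in> {A \<in> Obj K. Fo A \<in> L}" using A by simp
  next
    fix A B C f g h assume t: "distinguished K A B C f g h"
      and "A \<in> {A \<in> Obj K. Fo A \<in> L}" "B \<in> {A \<in> Obj K. Fo A \<in> L}"
    then show "C \<in> {A \<in> Obj K. Fo A \<in> L}"
      using thick_subcategoryD(3)[OF T] ex triangleD(15)[OF t] by blast
  next
    fix A M i p assume M: "M \<in> {A \<in> Obj K. Fo A \<in> L}" and i: "i \<in> Hom K A M" and p: "p \<in> Hom K M A"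
      and pi: "p \<cdot> i = Idn K A"
    have "Fa p \<cdot> Fa i = Idn K (Fo A)" using D(4)[OF i p] D(2) pi HomD(4)[OF i] by simp
    then have "Fo A \<in> L" using thick_retract[OF T D(3)[OF i] D(3)[OF p]] M by blast
    then show "A \<in> {A \<in> Obj K. Fo A \<in> L}" using HomD(4)[OF i] by blast
  qed blast
next
  fix I :: "'u set" and M S \<iota>
  assume "small \<kappa> I \<and> coproduct K I M S \<iota> \<and> (\<forall>i\<in>I. M i \<in> {A \<in> Obj K. Fo A \<in> L})"
  then have I: "small \<kappa> I" and C: "coproduct K I M S \<iota>" and M: "\<And>i. i \<in> I \<Longrightarrow> Fo (M i) \<in> L" by blast+
  have "Fo S \<in> L" using localizing_coproduct[OF L I cp[OF I C]] M by blast
  then show "S \<in> {A \<in> Obj K. Fo A \<in> L}" using coproductD(1)[OF C] by blast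
qed

lemma localizing_tensor_left:
  "localizing \<kappa> K L \<Longrightarrow> X \<in> Obj K \<Longrightarrow> localizing \<kappa> K {A \<in> Obj K. X \<boxtimes> A \<in> L}"
  using localizing_vimage[OF tensor_left_exact] tensor_left_coproduct by blast

lemma localizing_tensor_right:
  "localizing \<kappa> K L \<Longrightarrow> X \<in> Obj K \<Longrightarrow> localizing \<kappa> K {A \<in> Obj K. A \<boxtimes> X \<in> L}"
  using localizing_vimage[OF tensor_right_exact] tensor_right_coproduct by blast

lemma localizing_zero: "localizing \<kappa> K {Z. zero_object K Z}"
  unfolding localizing_def
proof (intro conjI allI impI)
  show "thick_subcategory K {Z. zero_object K Z}" by (rule zero_thick)
  fix I :: "'u set" and M S \<iota>
  assume "small \<kappa> I \<and> coproduct K I M S \<iota> \<and> (\<forall>i\<in>I. M i \<in> {Z. zero_object K Z})"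
  then have C: "coproduct K I M S \<iota>" and M: "\<And>i. i \<in> I \<Longrightarrow> zero_object K (M i)" by blast+
  note D = coproductD[OF C]
  have "Idn K S = Null K S S"
  proof (rule coproduct_ext[OF C ide_hom[OF D(1)] Null_hom[OF D(1) D(1)]])
    fix i assume i: "i \<in> I"
    have "\<iota> i = Null K (M i) S" using hom_from_zero[OF M[OF i] D(3)[OF i]] .
    then show "Idn K S \<cdot> \<iota> i = Null K S S \<cdot> \<iota> i" using D(1) D(2)[OF i] by simp
  qed
  then show "S \<in> {Z. zero_object K Z}" unfolding zero_object_iff using D(1) by simp
qed

lemma localizing_Inter:
  assumes "\<S> \<noteq> {}" "\<And>L. L \<in> \<S> \<Longrightarrow> localizing \<kappa> K L"
  shows "localizing \<kappa> K (\<Inter>\<S>)"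
  unfolding localizing_def
proof (intro conjI allI impI)
  show "thick_subcategory K (\<Inter>\<S>)"
    by (rule thick_Inter[OF assms(1)]) (rule localizing_thick[OF assms(2)])
next
  fix I :: "'u set" and M S \<iota>
  assume "small \<kappa> I \<and> coproduct K I M S \<iota> \<and> (\<forall>i\<in>I. M i \<in> \<Inter>\<S>)"
  then show "S \<in> \<Inter>\<S>" using assms(2) unfolding localizing_def by blast
qed

text \<open>For localizing \<open>L\<close> this is the largest thick ideal of \<open>K\<close>
  inside \<open>L\<close>. Both sides are multiplied because there is no braiding to exchange
  them.\<close>

definition ideal_core :: "'o set \<Rightarrow> 'o set" where
  "ideal_core L = {A \<in> Obj K. \<forall>X\<in>Obj K. \<forall>Y\<in>Obj K. (X \<boxtimes> A) \<boxtimes> Y \<in> L}"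

text \<open>The core is an intersection of preimages of \<open>L\<close> under tensoring with
  \<open>X\<close> on the left and \<open>Y\<close> on the right.\<close>

lemma ideal_core_localizing:
  assumes L: "localizing \<kappa> K L"
  shows "localizing \<kappa> K (ideal_core L)"
proof -
  let ?P = "\<lambda>X Y. {A \<in> Obj K. X \<boxtimes> A \<in> {B \<in> Obj K. B \<boxtimes> Y \<in> L}}"
  let ?S = "{?P X Y | X Y. X \<in> Obj K \<and> Y \<in> Obj K}"
  have "localizing \<kappa> K (\<Inter>?S)"
  proof (rule localizing_Inter)
    show "?S \<noteq> {}" using unit_obj by blast
    show "localizing \<kappa> K L'" if "L' \<in> ?S" for L'
      using that localizing_tensor_left[OF localizing_tensor_right[OF L]] by blast
  qed
  moreover have "\<Inter>?S = ideal_core L"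
    unfolding ideal_core_def using tensor_obj unit_obj by blast
  ultimately show ?thesis by simp
qed

lemma ideal_core_subset: "localizing \<kappa> K L \<Longrightarrow> ideal_core L \<subseteq> L"
  unfolding ideal_core_def using sandwich_isomorphic(3) localizing_iso unit_obj by blast

lemma ThickId_iff:
  "I \<in> ThickId K \<longleftrightarrow> thick_subcategory K I \<and> (\<forall>A\<in>I. \<forall>M\<in>Obj K. M \<boxtimes> A \<in> I \<and> A \<boxtimes> M \<in> I)"
  unfolding ThickId_def thick_ideal_def thick_subcategory_def by blast

lemma ideal_core_ThickId:
  assumes L: "localizing \<kappa> K L"
  shows "ideal_core L \<in> ThickId K"
  unfolding ThickId_iff
proof (intro conjI ballI)
  show "thick_subcategory K (ideal_core L)" using localizing_thick[OF ideal_core_localizing[OF L]] .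
  fix A M assume A: "A \<in> ideal_core L" and M: "M \<in> Obj K"
  have Ao: "A \<in> Obj K" using A unfolding ideal_core_def by blast
  have "(X \<boxtimes> (M \<boxtimes> A)) \<boxtimes> Y \<in> L" "(X \<boxtimes> (A \<boxtimes> M)) \<boxtimes> Y \<in> L" if "X \<in> Obj K" "Y \<in> Obj K" for X Y
    using localizing_iso[OF L sandwich_isomorphic(1)[OF Ao M that]]
      localizing_iso[OF L sandwich_isomorphic(2)[OF Ao M that]] A tensor_obj M that
    unfolding ideal_core_def by blast+
  then show "M \<boxtimes> A \<in> ideal_core L" "A \<boxtimes> M \<in> ideal_core L"
    by (simp_all add: ideal_core_def tensor_obj[OF M Ao] tensor_obj[OF Ao M])
qed

lemma generated_ideal_core:
  assumes "localizing \<kappa> K L" "S \<subseteq> ideal_core L"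
  shows "generated_ideal K S \<subseteq> ideal_core L"
  unfolding generated_ideal_def using ideal_core_ThickId[OF assms(1)] assms(2) by blast

text \<open>For fixed compact \<open>X\<close> the admissible \<open>Y\<close> form a localizing
  subcategory containing the compact objects, hence everything; then the same argument frees
  \<open>X\<close> with \<open>Y\<close> arbitrary.\<close>

lemma ideal_core_compact:
  assumes L: "localizing \<kappa> K L" and A: "A \<in> Obj K"
    and c: "\<And>X Y. compact_object \<kappa> K X \<Longrightarrow> compact_object \<kappa> K Y \<Longrightarrow> (X \<boxtimes> A) \<boxtimes> Y \<in> L"
  shows "A \<in> ideal_core L"
proof -
  have 1: "(X \<boxtimes> A) \<boxtimes> Y \<in> L" if X: "compact_object \<kappa> K X" and Y: "Y \<in> Obj K" for X Y
  proof -
    have "X \<boxtimes> A \<in> Obj K" using compactD(1)[OF X] A tensor_obj by blast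
    then have "localizing \<kappa> K {Y \<in> Obj K. (X \<boxtimes> A) \<boxtimes> Y \<in> L}" by (rule localizing_tensor_left[OF L])
    then have "Y \<in> {Y \<in> Obj K. (X \<boxtimes> A) \<boxtimes> Y \<in> L}"
      by (rule localizing_all[OF _ _ Y]) (use c X compactD(1) in blast)
    then show ?thesis by blast
  qed
  have "(X \<boxtimes> A) \<boxtimes> Y \<in> L" if X: "X \<in> Obj K" and Y: "Y \<in> Obj K" for X Y
  proof -
    have "localizing \<kappa> K {X \<in> Obj K. X \<boxtimes> A \<in> {B \<in> Obj K. B \<boxtimes> Y \<in> L}}"
      by (rule localizing_tensor_right[OF localizing_tensor_right[OF L Y] A])
    then have "X \<in> {X \<in> Obj K. X \<boxtimes> A \<in> {B \<in> Obj K. B \<boxtimes> Y \<in> L}}"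
      by (rule localizing_all[OF _ _ X]) (use 1 Y A compactD(1) tensor_obj in blast)
    then show ?thesis by blast
  qed
  then show ?thesis unfolding ideal_core_def using A by blast
qed

subsection \<open>Ideals of compact objects\<close>

abbreviation Kc :: "('o, 'm) mtcat" where "Kc \<equiv> compact_part \<kappa> K"

lemma compact_part_simps [simp]:
  "A \<in> Obj Kc \<longleftrightarrow> compact_object \<kappa> K A" "ShiftO Kc = ShiftO K" "TensorO Kc = TensorO K"
  "UnitO Kc = UnitO K"
  by (simp_all add: compact_part_def full_subcategory_def)

lemma compact_part_Obj: "Obj Kc = {C. compact_object \<kappa> K C}"
  by (simp add: compact_part_def full_subcategory_def)

lemma compact_part_Hom:
  "compact_object \<kappa> K A \<Longrightarrow> compact_object \<kappa> K B \<Longrightarrow> Hom Kc A B = Hom K A B"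
  unfolding Hom_def by (auto simp: compact_part_def full_subcategory_def)

lemma compact_part_Hom_obj: "f \<in> Hom Kc A B \<Longrightarrow> compact_object \<kappa> K A \<and> compact_object \<kappa> K B"
  unfolding Hom_def by (auto simp: compact_part_def full_subcategory_def)

lemma compact_part_distinguished:
  "distinguished Kc A B C f g h \<longleftrightarrow> distinguished K A B C f g h \<and>
     compact_object \<kappa> K A \<and> compact_object \<kappa> K B \<and> compact_object \<kappa> K C"
proof -
  have t: "Triangles Kc = Triangles K" by (simp add: compact_part_def full_subcategory_def)
  have "distinguished Kc A B C f g h \<longleftrightarrow> distinguished K A B C f g h"
    if "compact_object \<kappa> K A" "compact_object \<kappa> K B" "compact_object \<kappa> K C"
    using that by (simp add: distinguished_def candidate_triangle_def t compact_part_Hom compact_shift)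
  moreover have "compact_object \<kappa> K A \<and> compact_object \<kappa> K B \<and> compact_object \<kappa> K C"
    if "distinguished Kc A B C f g h"
    using that compact_part_Hom_obj[of f A B] compact_part_Hom_obj[of g B C]
    unfolding distinguished_def candidate_triangle_def by blast
  ultimately show ?thesis by blast
qed

lemma compact_part_biproduct:
  "biproduct Kc A B M \<longleftrightarrow> biproduct K A B M \<and>
     compact_object \<kappa> K A \<and> compact_object \<kappa> K B \<and> compact_object \<kappa> K M"
proof -
  have t: "Comp Kc = Comp K" "Plus Kc = Plus K" "Idn Kc = Idn K"
    by (simp_all add: compact_part_def full_subcategory_def)
  have "biproduct Kc A B M \<longleftrightarrow> biproduct K A B M"
    if c: "compact_object \<kappa> K A" "compact_object \<kappa> K B" "compact_object \<kappa> K M"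
    unfolding biproduct_def t using c c[THEN compactD(1)] by (simp add: compact_part_Hom)
  moreover have "biproduct Kc A B M \<Longrightarrow> compact_object \<kappa> K A \<and> compact_object \<kappa> K B \<and> compact_object \<kappa> K M"
    unfolding biproduct_def by simp
  ultimately show ?thesis by blast
qed

text \<open>Compact objects are closed under cones, shifts, desuspensions and retracts, so the
  triangulated conditions can be read in \<open>K\<close>, where the general lemmas apply; only the
  tensor factors stay restricted to compact objects.\<close>

lemma ThickId_compact_iff:
  "I \<in> ThickId Kc \<longleftrightarrow> thick_subcategory K I \<and> (\<forall>A\<in>I. compact_object \<kappa> K A) \<and>
     (\<forall>A\<in>I. \<forall>M. compact_object \<kappa> K M \<longrightarrow> M \<boxtimes> A \<in> I \<and> A \<boxtimes> M \<in> I)"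
proof
  assume "I \<in> ThickId Kc"
  then have I: "thick_ideal Kc I" unfolding ThickId_def by blast
  have t: "triangulated_subcategory Kc I" and s: "\<And>A B M. biproduct Kc A B M \<Longrightarrow> M \<in> I \<Longrightarrow> A \<in> I"
    and m0: "\<forall>A\<in>I. \<forall>M\<in>Obj Kc. TensorO Kc M A \<in> I \<and> TensorO Kc A M \<in> I"
    using I unfolding thick_ideal_def by blast+
  have m: "\<forall>A\<in>I. \<forall>M. compact_object \<kappa> K M \<longrightarrow> M \<boxtimes> A \<in> I \<and> A \<boxtimes> M \<in> I"
    using m0 unfolding compact_part_simps(3) compact_part_Obj by blast
  have "I \<subseteq> Obj Kc" and ne: "I \<noteq> {}" and sh0: "\<forall>A\<in>Obj Kc. A \<in> I \<longleftrightarrow> ShiftO Kc A \<in> I"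
    and cone: "\<And>A B C f g h. distinguished Kc A B C f g h \<Longrightarrow> A \<in> I \<Longrightarrow> B \<in> I \<Longrightarrow> C \<in> I"
    using t unfolding triangulated_subcategory_def by blast+
  then have c: "\<And>A. A \<in> I \<Longrightarrow> compact_object \<kappa> K A" unfolding compact_part_Obj by blast
  have sh: "\<And>A. compact_object \<kappa> K A \<Longrightarrow> ShiftO K A \<in> I \<longleftrightarrow> A \<in> I"
    using sh0 unfolding compact_part_simps(2) compact_part_Obj by blast
  have co: "C \<in> I" if "distinguished K A B C f g h" "A \<in> I" "B \<in> I" for A B C f g h
    using cone[of A B C f g h] that c compact_cone[OF that(1)] unfolding compact_part_distinguished by blast
  have "thick_subcategory K I"
  proof (rule thick_subcategoryI[OF _ _ _ co])
    show "I \<subseteq> Obj K" using c compactD(1) by blast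
    show "Z \<in> I" if "zero_object K Z" for Z
    proof -
      obtain A where A: "A \<in> I" using ne by blast
      show ?thesis using co[OF triangle_ide[OF compactD(1)[OF c[OF A]] that] A A] .
    qed
    show "ShiftO K A \<in> I \<longleftrightarrow> A \<in> I" if "A \<in> Obj K" for A
      using sh c compact_unshift[OF _ that] by blast
    show "A \<in> I" if M: "M \<in> I" and i: "i \<in> Hom K A M" and p: "p \<in> Hom K M A" "p \<cdot> i = Idn K A" for A M i p
    proof -
      \<comment> \<open>The complement of the retract is a cone of compact objects, so the splitting
        takes place within the compact part.\<close>
      obtain B f g where B: "distinguished K A M B i f g" "biproduct K A B M"
        using retract_biproduct[OF i p] by blast
      have "compact_object \<kappa> K A" using thick_retract[OF compact_thick[of \<kappa>] i p] c[OF M] by blast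
      then have "biproduct Kc A B M"
        unfolding compact_part_biproduct using B compact_cone[OF B(1)] c[OF M] by blast
      then show ?thesis using s M by blast
    qed
  qed
  then show "thick_subcategory K I \<and> (\<forall>A\<in>I. compact_object \<kappa> K A) \<and>
     (\<forall>A\<in>I. \<forall>M. compact_object \<kappa> K M \<longrightarrow> M \<boxtimes> A \<in> I \<and> A \<boxtimes> M \<in> I)" using c m by blast
next
  assume h: "thick_subcategory K I \<and> (\<forall>A\<in>I. compact_object \<kappa> K A) \<and>
     (\<forall>A\<in>I. \<forall>M. compact_object \<kappa> K M \<longrightarrow> M \<boxtimes> A \<in> I \<and> A \<boxtimes> M \<in> I)"
  then have t: "thick_subcategory K I" by blast
  obtain Z where Z: "zero_object K Z" using zero_object_exists by blast
  have "triangulated_subcategory Kc I"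
    unfolding triangulated_subcategory_def
  proof (intro conjI)
    show "I \<subseteq> Obj Kc" using h by auto
    show "I \<noteq> {}" using thick_zero[OF t Z] by blast
    show "\<forall>A\<in>Obj Kc. (A \<in> I) = (ShiftO Kc A \<in> I)" 
      using thick_subcategoryD(2)[OF t] compactD(1) unfolding compact_part_simps(2) compact_part_Obj by blast
    show "\<forall>A B C f g h. distinguished Kc A B C f g h \<longrightarrow>
       (A \<in> I \<and> B \<in> I \<longrightarrow> C \<in> I) \<and> (B \<in> I \<and> C \<in> I \<longrightarrow> A \<in> I) \<and> (A \<in> I \<and> C \<in> I \<longrightarrow> B \<in> I)"
      unfolding compact_part_distinguished using thick_subcategoryD(3-5)[OF t] by blast
  qed
  moreover have "\<forall>A B M. biproduct Kc A B M \<and> M \<in> I \<longrightarrow> A \<in> I \<and> B \<in> I"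
    unfolding compact_part_biproduct using thick_subcategoryD(6,7)[OF t] by blast
  moreover have "\<forall>A\<in>I. \<forall>M\<in>Obj Kc. TensorO Kc M A \<in> I \<and> TensorO Kc A M \<in> I"
    using h unfolding compact_part_simps(3) compact_part_Obj by blast
  ultimately show "I \<in> ThickId Kc"
    unfolding ThickId_def thick_ideal_def by blast
qed

lemma ThickId_compactD:
  assumes "I \<in> ThickId Kc"
  shows "thick_subcategory K I" "A \<in> I \<Longrightarrow> compact_object \<kappa> K A"
    "A \<in> I \<Longrightarrow> compact_object \<kappa> K M \<Longrightarrow> M \<boxtimes> A \<in> I" "A \<in> I \<Longrightarrow> compact_object \<kappa> K M \<Longrightarrow> A \<boxtimes> M \<in> I"
  using assms unfolding ThickId_compact_iff by blast+

lemma Obj_ThickId: "Obj Kc \<in> ThickId Kc"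
  unfolding ThickId_compact_iff compact_part_Obj using compact_thick compact_tensor by blast

lemma generated_ideal_ThickId:
  assumes "S \<subseteq> Obj Kc"
  shows "generated_ideal Kc S \<in> ThickId Kc"
  unfolding ThickId_compact_iff
proof (intro conjI)
  let ?S = "{I \<in> ThickId Kc. S \<subseteq> I}"
  have ne: "Obj Kc \<in> ?S" using Obj_ThickId assms by blast
  show "thick_subcategory K (generated_ideal Kc S)"
    unfolding generated_ideal_def by (rule thick_Inter) (use ne ThickId_compactD(1) in blast)+
  show "\<forall>A\<in>generated_ideal Kc S. compact_object \<kappa> K A"
    unfolding generated_ideal_def using ne by auto
  show "\<forall>A\<in>generated_ideal Kc S. \<forall>M. compact_object \<kappa> K M \<longrightarrow>
      M \<boxtimes> A \<in> generated_ideal Kc S \<and> A \<boxtimes> M \<in> generated_ideal Kc S"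
    unfolding generated_ideal_def using ThickId_compactD(3,4) by blast
qed

lemma generated_ideal_subset: "S \<subseteq> generated_ideal T S"
  unfolding generated_ideal_def by blast

lemma generated_ideal_least: "I \<in> ThickId T \<Longrightarrow> S \<subseteq> I \<Longrightarrow> generated_ideal T S \<subseteq> I"
  unfolding generated_ideal_def by blast

text \<open>Compact multiples of an object of \<open>I\<close> stay in \<open>I\<close>, and by
  \<open>ideal_core_compact\<close> compact multiples are all that has to be tested.\<close>

lemma compact_ideal_in_core:
  assumes I: "I \<in> ThickId Kc" and L: "localizing \<kappa> K L" "I \<subseteq> L"
  shows "I \<subseteq> ideal_core L"
proof
  fix A assume A: "A \<in> I"
  show "A \<in> ideal_core L"
    by (rule ideal_core_compact[OF L(1)]) (use A ThickId_compactD[OF I] compactD(1) L(2) in blast)+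
qed

text \<open>The core of \<open>L\<close> is an ideal of \<open>K\<close> that already contains
  \<open>I\<close>. This bounds the ideal generated in \<open>K\<close> without describing its
  objects.\<close>

lemma generated_ideal_localizing:
  assumes "I \<in> ThickId Kc" "localizing \<kappa> K L" "I \<subseteq> L"
  shows "generated_ideal K I \<subseteq> L"
  using generated_ideal_core[OF assms(2) compact_ideal_in_core[OF assms]] ideal_core_subset[OF assms(2)] by blast

lemma Obj_ThickId_ambient: "Obj K \<in> ThickId K"
  unfolding ThickId_iff using tensor_obj
  by (auto intro!: thick_subcategoryI simp: zero_object_obj dest: triangleD HomD)

lemma generated_ideal_obj: "S \<subseteq> Obj K \<Longrightarrow> generated_ideal K S \<subseteq> Obj K"
  using generated_ideal_least[OF Obj_ThickId_ambient] .

lemma generated_ideal_ambient_ThickId: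
  assumes "S \<subseteq> Obj K"
  shows "generated_ideal K S \<in> ThickId K"
  unfolding ThickId_iff
proof (intro conjI ballI)
  show "thick_subcategory K (generated_ideal K S)"
    unfolding generated_ideal_def
    by (rule thick_Inter) (use Obj_ThickId_ambient assms ThickId_iff in blast)+
  fix A M assume "A \<in> generated_ideal K S" "M \<in> Obj K"
  then show "M \<boxtimes> A \<in> generated_ideal K S" "A \<boxtimes> M \<in> generated_ideal K S"
    unfolding generated_ideal_def ThickId_iff by blast+
qed

text \<open>The extension principle is applied to one tensor factor at a time: first
  \<open>I\<close> is enlarged against fixed objects of \<open>J\<close>, then \<open>J\<close>
  against fixed objects of the enlarged ideal.\<close>

lemma generated_ideal_tensor:
  assumes I: "I \<in> ThickId Kc" and J: "J \<in> ThickId Kc" and L: "localizing \<kappa> K L" and IJ: "tensor_set K I J \<subseteq> L"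
  shows "tensor_set K (generated_ideal K I) (generated_ideal K J) \<subseteq> L"
proof -
  have 1: "A \<boxtimes> B \<in> L" if B: "B \<in> J" and A: "A \<in> generated_ideal K I" for A B
  proof -
    have Bo: "B \<in> Obj K" using ThickId_compactD(2)[OF J B] compactD(1) by blast
    have "I \<subseteq> {A \<in> Obj K. A \<boxtimes> B \<in> L}"
      using IJ B ThickId_compactD(2)[OF I] compactD(1) unfolding tensor_set_def by blast
    then show ?thesis
      using generated_ideal_localizing[OF I localizing_tensor_right[OF L Bo]] A by blast
  qed
  have "A \<boxtimes> B \<in> L" if B: "B \<in> generated_ideal K J" and A: "A \<in> generated_ideal K I" for A B
  proof -
    have "I \<subseteq> Obj K" using ThickId_compactD(2)[OF I] compactD(1) by blast
    then have Ao: "A \<in> Obj K" using A generated_ideal_obj by blast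
    have "J \<subseteq> {B \<in> Obj K. A \<boxtimes> B \<in> L}" using 1 A ThickId_compactD(2)[OF J] compactD(1) by blast
    then show ?thesis
      using generated_ideal_localizing[OF J localizing_tensor_left[OF L Ao]] B by blast
  qed
  then show ?thesis unfolding tensor_set_def by blast
qed

subsection \<open>Objects orthogonal to an ideal\<close>

text \<open>An arrow from \<open>D\<close> to \<open>S\<close> is tested by its transpose from the
  unit to \<open>C \<boxtimes> S\<close>. The unit is compact and tensoring with \<open>C\<close>
  preserves the coproduct, so the finite support of the transpose serves for the arrow
  itself.\<close>

lemma dual_compact:
  assumes dp: "dual_pair K D C" and C: "C \<in> Obj K" and D: "D \<in> Obj K"
  shows "compact_object \<kappa> K D"
proof (rule compactI[OF D])
  fix I :: "'u set" and M S \<iota> x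
  assume I: "small \<kappa> I" and S: "coproduct K I M S \<iota>" and x: "x \<in> Hom K D S"
  note DS = coproductD[OF S]
  obtain coev where coev: "coev \<in> Hom K (UnitO K) (C \<boxtimes> D)"
    and z: "\<forall>T. \<forall>g \<in> Hom K D T. (Idn K C \<boxdot> g) \<cdot> coev = Null K (UnitO K) (C \<boxtimes> T) \<longrightarrow> g = Null K D T"
    by (rule dual_pair_detects_zero[OF assms])
  have Cx: "Idn K C \<boxdot> x \<in> Hom K (C \<boxtimes> D) (C \<boxtimes> S)" using tensor_hom[OF ide_hom[OF C] x] .
  obtain F where F: "finite F" "F \<subseteq> I"
    "supported_on K (C \<boxtimes> S) (\<lambda>i. Idn K C \<boxdot> \<iota> i) F ((Idn K C \<boxdot> x) \<cdot> coev)"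
    using compactD(2)[OF compact_unit I tensor_left_coproduct[OF I S C] comp_hom[OF coev Cx]] by blast
  have "supported_on K S \<iota> F x"
  proof (rule supported_onI[OF x])
    fix T u assume u: "u \<in> Hom K S T" "\<forall>i\<in>F. u \<cdot> \<iota> i = Null K (Dom K (\<iota> i)) T"
    have T: "T \<in> Obj K" using HomD[OF u(1)] by blast
    have Cu: "Idn K C \<boxdot> u \<in> Hom K (C \<boxtimes> S) (C \<boxtimes> T)" using tensor_hom[OF ide_hom[OF C] u(1)] .
    have "(Idn K C \<boxdot> u) \<cdot> ((Idn K C \<boxdot> x) \<cdot> coev) = Null K (UnitO K) (C \<boxtimes> T)"
    proof (rule supported_onD[OF F(3) Cu comp_hom[OF coev Cx]])
      fix i assume i: "i \<in> F"
      then have iI: "i \<in> I" using F by blast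
      have "(Idn K C \<boxdot> u) \<cdot> (Idn K C \<boxdot> \<iota> i) = Idn K C \<boxdot> Null K (M i) T"
        using tensor_left_comp[OF C DS(3)[OF iI] u(1)] u(2) i DS(5)[OF iI] by simp
      then show "(Idn K C \<boxdot> u) \<cdot> (Idn K C \<boxdot> \<iota> i) = Null K (Dom K (Idn K C \<boxdot> \<iota> i)) (C \<boxtimes> T)"
        using tensor_left_null[OF C DS(2)[OF iI] T] DS(4,5)[OF iI] C by simp
    qed
    moreover have "(Idn K C \<boxdot> u) \<cdot> ((Idn K C \<boxdot> x) \<cdot> coev) = (Idn K C \<boxdot> (u \<cdot> x)) \<cdot> coev"
      using comp_subst_hom[OF tensor_left_comp[OF C x u(1)] Cx Cu coev] .
    ultimately show "u \<cdot> x = Null K D T" using z comp_hom[OF x u(1)] by metis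
  qed
  then show "\<exists>F. finite F \<and> F \<subseteq> I \<and> supported_on K S \<iota> F x" using F by blast
qed

text \<open>By compact generation it suffices to kill arrows from compact \<open>X\<close> to
  \<open>C \<boxtimes> L\<close>. Their transposes go from \<open>D \<boxtimes> X\<close> to
  \<open>L\<close>, and \<open>D\<close> lies in \<open>J\<close> as a retract of
  \<open>D \<boxtimes> (C \<boxtimes> D)\<close>.\<close>

lemma orthogonal_tensor_zero:
  assumes J: "J \<in> ThickId Kc" and L: "L \<in> Obj K" and o: "\<forall>C\<in>J. \<forall>f \<in> Hom K C L. f = Null K C L"
    and C: "C \<in> J"
  shows "zero_object K (C \<boxtimes> L)"
proof (rule ccontr)
  note JD = ThickId_compactD[OF J]
  have Cc: "compact_object \<kappa> K C" using JD(2)[OF C] .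
  have Co: "C \<in> Obj K" using compactD(1)[OF Cc] .
  assume "\<not> zero_object K (C \<boxtimes> L)"
  then obtain X f where X: "compact_object \<kappa> K X" and f: "f \<in> Hom K X (C \<boxtimes> L)" "f \<noteq> Null K X (C \<boxtimes> L)"
    using compact_generate tensor_obj Co L by blast
  obtain D where D: "D \<in> Obj K" "dual_pair K D C" using compact_rigid[OF Cc] unfolding rigid_def by blast
  have Dc: "compact_object \<kappa> K D" using dual_compact[OF D(2) Co D(1)] .
  obtain i p where ip: "i \<in> Hom K D (D \<boxtimes> (C \<boxtimes> D))" "p \<in> Hom K (D \<boxtimes> (C \<boxtimes> D)) D" "p \<cdot> i = Idn K D"
    using dual_retract[OF D(2) Co D(1)] by blast
  have "D \<boxtimes> (C \<boxtimes> D) \<in> J" using JD(3)[OF JD(4)[OF C Dc] Dc] .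
  then have "D \<in> J" using thick_retract[OF JD(1) ip] by blast
  then have "D \<boxtimes> X \<in> J" using JD(4) X by blast
  then have "f = Null K X (C \<boxtimes> L)" using dual_hom_vanish[OF D(2) Co D(1) L f(1)] o by blast
  then show False using f(2) by blast
qed

text \<open>The objects \<open>N\<close> annihilated by the ideal generated by \<open>J\<close> form
  a two-sided ideal: a left factor is absorbed by the generated ideal, which is closed under right
  multiplication, and a right factor preserves zero. So it is enough that \<open>L\<close> belongs
  to \<open>N\<close>.\<close>

lemma orthogonal_ideals:
  assumes J: "J \<in> ThickId Kc" and L: "L \<in> Obj K" and o: "\<forall>C\<in>J. \<forall>f \<in> Hom K C L. f = Null K C L"
    and A: "A \<in> generated_ideal K J" and B: "B \<in> generated_ideal K {L}"
  shows "zero_object K (A \<boxtimes> B)"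
proof -
  let ?Z = "{Z. zero_object K Z}"
  have Jo: "J \<subseteq> Obj K" using ThickId_compactD(2)[OF J] compactD(1) by blast
  have go: "generated_ideal K J \<subseteq> Obj K" by (rule generated_ideal_obj[OF Jo])
  define N where "N = {B \<in> Obj K. \<forall>A \<in> generated_ideal K J. zero_object K (A \<boxtimes> B)}"
  have "N = \<Inter> {{B \<in> Obj K. A \<boxtimes> B \<in> ?Z} | A. A \<in> generated_ideal K J}"
    unfolding N_def using generated_ideal_subset[of J K] thick_zero[OF ThickId_compactD(1)[OF J]]
      zero_object_exists by blast
  moreover have "localizing \<kappa> K \<dots>"
  proof (rule localizing_Inter)
    show "{{B \<in> Obj K. A \<boxtimes> B \<in> ?Z} | A. A \<in> generated_ideal K J} \<noteq> {}" using A by blast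
    show "localizing \<kappa> K L'" if "L' \<in> {{B \<in> Obj K. A \<boxtimes> B \<in> ?Z} | A. A \<in> generated_ideal K J}" for L'
      using that localizing_tensor_left[OF localizing_zero] go by blast
  qed
  ultimately have N: "localizing \<kappa> K N" by simp
  have gt: "A \<boxtimes> M \<in> generated_ideal K J" if "A \<in> generated_ideal K J" "M \<in> Obj K" for A M
    using that unfolding generated_ideal_def ThickId_iff by blast
  have "N \<in> ThickId K"
    unfolding ThickId_iff
  proof (intro conjI ballI)
    show "thick_subcategory K N" using localizing_thick[OF N] .
    fix B M assume B: "B \<in> N" and M: "M \<in> Obj K"
    have Bo: "B \<in> Obj K" using B unfolding N_def by blast
    have "zero_object K (A \<boxtimes> (M \<boxtimes> B))" if A: "A \<in> generated_ideal K J" for A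
    proof -
      have Ao: "A \<in> Obj K" using A go by blast
      have "zero_object K ((A \<boxtimes> M) \<boxtimes> B)" using B gt[OF A M] unfolding N_def by blast
      then show ?thesis using thick_iso[OF zero_thick assoc_isomorphic[OF Ao M Bo]] by blast
    qed
    then show "M \<boxtimes> B \<in> N" unfolding N_def using tensor_obj M Bo by blast
    have "zero_object K (A \<boxtimes> (B \<boxtimes> M))" if A: "A \<in> generated_ideal K J" for A
    proof -
      have Ao: "A \<in> Obj K" using A go by blast
      have "A \<boxtimes> B \<in> {Z. zero_object K Z}" using B A unfolding N_def by blast
      moreover have "{Z. zero_object K Z} \<subseteq> {A \<in> Obj K. A \<boxtimes> M \<in> {Z. zero_object K Z}}"
        using thick_zero[OF localizing_thick[OF localizing_tensor_right[OF localizing_zero M]]] by blast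
      ultimately have "(A \<boxtimes> B) \<boxtimes> M \<in> {Z. zero_object K Z}" by blast
      then show ?thesis using thick_iso[OF zero_thick assoc_isomorphic[OF Ao Bo M]] by blast
    qed
    then show "B \<boxtimes> M \<in> N" unfolding N_def using tensor_obj M Bo by blast
  qed
  moreover have "L \<in> N"
  proof -
    \<comment> \<open>The objects annihilating \<open>L\<close> form a localizing subcategory, so
      the vanishing extends from \<open>J\<close> to the ideal generated in
      \<open>K\<close>.\<close>
    have "J \<subseteq> {A \<in> Obj K. A \<boxtimes> L \<in> {Z. zero_object K Z}}"
      using orthogonal_tensor_zero[OF J L o] Jo by blast
    then have "generated_ideal K J \<subseteq> {A \<in> Obj K. A \<boxtimes> L \<in> {Z. zero_object K Z}}"
      by (rule generated_ideal_localizing[OF J localizing_tensor_right[OF localizing_zero L]])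
    then show ?thesis unfolding N_def using L by blast
  qed
  ultimately have "generated_ideal K {L} \<subseteq> N" using generated_ideal_least[of N K "{L}"] by blast
  then show ?thesis using A B unfolding N_def by blast
qed

end

section \<open>Binary biproducts, minimal closed sets and specialization closed sets\<close>

lemma Phi_mono: "S \<subseteq> S' \<Longrightarrow> Phi \<sigma> S \<subseteq> Phi \<sigma> S'"
  unfolding Phi_def by blast

text \<open>The support axioms know direct sums only through indexed coproducts, so a biproduct is
  presented as one indexed by \<open>bool\<close>.\<close>

lemma (in triangulated_category) biproduct_coproduct:
  assumes "biproduct K A B M"
  obtains \<iota> where "coproduct K (UNIV :: bool set) (\<lambda>b. if b then A else B) M \<iota>"
proof -
  obtain i j p q where h: "i \<in> Hom K A M" "j \<in> Hom K B M" "p \<in> Hom K M A" "q \<in> Hom K M B"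
    and e: "p \<cdot> i = Idn K A" "q \<cdot> j = Idn K B" "(i \<cdot> p) \<boxplus> (j \<cdot> q) = Idn K M"
    "q \<cdot> i = Null K A B" "p \<cdot> j = Null K B A"
    using assms by (rule biproductE)
  note D = h[THEN HomD(1)] h[THEN HomD(2)] h[THEN HomD(3)]
  have M: "M \<in> Obj K" and A: "A \<in> Obj K" and B: "B \<in> Obj K" using h HomD by blast+
  have "coproduct K (UNIV :: bool set) (\<lambda>b. if b then A else B) M (\<lambda>b. if b then i else j)"
  proof (rule coproductI[OF M])
    show "(if b then i else j) \<in> Hom K (if b then A else B) M" for b :: bool using h by simp
    fix T g assume T: "T \<in> Obj K" and g: "\<forall>b\<in>UNIV. g b \<in> Hom K (if b then A else B) T"
    have gA: "g True \<in> Hom K A T" and gB: "g False \<in> Hom K B T" using g by (metis UNIV_I)+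
    note G = HomD(1-3)[OF gA] HomD(1-3)[OF gB]
    let ?u = "(g True \<cdot> p) \<boxplus> (g False \<cdot> q)"
    have u: "?u \<in> Hom K M T" using D G by (simp add: Hom_def)
    have "?u \<cdot> i = g True" "?u \<cdot> j = g False" using D G e A B T by simp_all
    then have "\<forall>b\<in>UNIV. ?u \<cdot> (if b then i else j) = g b" by (metis (full_types))
    then show "\<exists>u\<in>Hom K M T. \<forall>b\<in>UNIV. u \<cdot> (if b then i else j) = g b" using u by blast
  next
    fix T u v assume u: "u \<in> Hom K M T" and v: "v \<in> Hom K M T"
      and uv: "\<forall>b\<in>(UNIV :: bool set). u \<cdot> (if b then i else j) = v \<cdot> (if b then i else j)"
    have ui: "u \<cdot> i = v \<cdot> i" "u \<cdot> j = v \<cdot> j" using uv[rule_format, of True] uv[rule_format, of False] by auto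
    have "w = ((w \<cdot> i) \<cdot> p) \<boxplus> ((w \<cdot> j) \<cdot> q)" if w: "w \<in> Hom K M T" for w
    proof -
      have "w \<cdot> ((i \<cdot> p) \<boxplus> (j \<cdot> q)) = ((w \<cdot> i) \<cdot> p) \<boxplus> ((w \<cdot> j) \<cdot> q)"
        using D HomD(1-3)[OF w] by simp
      then show ?thesis unfolding e(3) using HomD[OF w] by simp
    qed
    from this[OF u] this[OF v] show "u = v" unfolding ui by simp
  qed
  then show ?thesis by (rule that)
qed

text \<open>Without a minimal set, dependent choice would yield a strictly decreasing sequence of
  closed sets.\<close>

lemma Noetherian_minimal:
  assumes "Noetherian_space X" "closedin X W" "P W"
  obtains Z where "closedin X Z" "P Z" "\<And>Z'. closedin X Z' \<Longrightarrow> Z' \<subset> Z \<Longrightarrow> \<not> P Z'"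
proof (rule ccontr)
  note found = that
  assume "\<not> thesis"
  then have step: "\<exists>Z'. (closedin X Z' \<and> P Z') \<and> Z' \<subset> Z" if "closedin X Z \<and> P Z" for Z
    using found[of Z] that by blast
  have "\<exists>Z. closedin X Z \<and> P Z" using assms(2,3) by blast
  then obtain f :: "nat \<Rightarrow> 'a set" where f: "\<And>n. closedin X (f n) \<and> P (f n)" "\<And>n. f (Suc n) \<subset> f n"
    using dependent_nat_choice[of "\<lambda>_ Z. closedin X Z \<and> P Z" "\<lambda>_ Z Z'. Z' \<subset> Z"] step by metis
  have "decseq f" by (rule decseq_SucI) (use f(2) in blast)
  then obtain N where "\<forall>n\<ge>N. f n = f N" using assms(1) f(1) unfolding Noetherian_space_def by blast
  then show False using f(2)[of N] by (metis le_SucI order_refl psubset_eq)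
qed

lemma specialization_closed_Un: "\<forall>W\<in>\<F>. closedin X W \<Longrightarrow> \<Union>\<F> \<in> specialization_closed X"
  unfolding specialization_closed_def by blast

lemma specialization_closed_Int:
  assumes "V \<in> specialization_closed X" "W \<in> specialization_closed X"
  shows "V \<inter> W \<in> specialization_closed X"
proof -
  obtain \<F> \<G> where F: "V = \<Union>\<F>" "\<forall>W\<in>\<F>. closedin X W" and G: "W = \<Union>\<G>" "\<forall>W\<in>\<G>. closedin X W"
    using assms unfolding specialization_closed_def by blast
  have "V \<inter> W = \<Union>{A \<inter> B | A B. A \<in> \<F> \<and> B \<in> \<G>}" unfolding F(1) G(1) by blast
  moreover have "\<forall>C\<in>{A \<inter> B | A B. A \<in> \<F> \<and> B \<in> \<G>}. closedin X C" using F(2) G(2) by auto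
  ultimately show ?thesis
    using specialization_closed_Un[of "{A \<inter> B | A B. A \<in> \<F> \<and> B \<in> \<G>}" X] by argo
qed

lemma specialization_closed_subset: "W \<in> specialization_closed X \<Longrightarrow> W \<subseteq> topspace X"
  unfolding specialization_closed_def using closedin_subset by blast

section \<open>Extended weak support data\<close>

locale supported_mtc = compactly_generated_mtc K \<kappa> + extended_weak_support_datum \<kappa> K X \<sigma>
  for K :: "('o, 'm) mtcat" (structure) and \<kappa> :: "'u rel" and X :: "'x topology" and \<sigma> :: "'o \<Rightarrow> 'x set"
begin

text \<open>The support axioms make this localizing but give no control over tensoring with a single
  object, which is why its core appears below.\<close>

definition supported_in :: "'x set \<Rightarrow> 'o set" where
  "supported_in W = {A \<in> Obj K. \<sigma> A \<subseteq> W}"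

lemma support_biproduct:
  assumes "biproduct K A B M"
  shows "\<sigma> A \<subseteq> \<sigma> M"
proof -
  obtain \<iota> where C: "coproduct K (UNIV :: bool set) (\<lambda>b. if b then A else B) M \<iota>"
    using biproduct_coproduct[OF assms] .
  have s: "small \<kappa> (UNIV :: bool set)" by (rule small_finite[OF universe]) simp
  obtain I :: "'u set" and \<phi> :: "'u \<Rightarrow> bool" where \<phi>: "bij_betw \<phi> I UNIV" "small \<kappa> I" using small_index[OF universe s] .
  obtain i where i: "i \<in> I" "\<phi> i" using \<phi>(1) unfolding bij_betw_def by (metis (full_types) UNIV_I imageE)
  have "\<sigma> M = (\<Union>i\<in>I. \<sigma> (if \<phi> i then A else B))"
    using support_coproduct[OF \<phi>(2) coproduct_reindex[OF \<phi>(1) C]] by simp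
  then show ?thesis using i by (metis (mono_tags, lifting) UN_upper)
qed

lemma supported_in_localizing: "localizing \<kappa> K (supported_in W)"
  unfolding localizing_def
proof (intro conjI allI impI)
  show "thick_subcategory K (supported_in W)"
  proof (rule thick_subcategoryI)
    fix A B C f g h assume T: "distinguished K A B C f g h" and A: "A \<in> supported_in W" and B: "B \<in> supported_in W"
    note D = triangleD[OF T]
    \<comment> \<open>The triangle axiom bounds the first object of a triangle; two rotations bring
      \<open>C\<close> to that place.\<close>
    have "\<sigma> C \<subseteq> \<sigma> (ShiftO K A) \<union> \<sigma> (ShiftO K B)"
      using support_triangle[OF triangle_rot[OF triangle_rot[OF T]]] .
    then show "C \<in> supported_in W" using A B D unfolding supported_in_def by (auto simp: support_shift)
  next
    fix A M i p assume M: "M \<in> supported_in W" and i: "i \<in> Hom K A M" and p: "p \<in> Hom K M A" "p \<cdot> i = Idn K A"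
    obtain B f g where "biproduct K A B M" using retract_biproduct[OF i p] by blast
    then show "A \<in> supported_in W" using support_biproduct M HomD[OF i] unfolding supported_in_def by blast
  qed (auto simp: supported_in_def support_zero support_shift zero_object_obj)
  fix I :: "'u set" and M S \<iota>
  assume "small \<kappa> I \<and> coproduct K I M S \<iota> \<and> (\<forall>i\<in>I. M i \<in> supported_in W)"
  then have I: "small \<kappa> I" and C: "coproduct K I M S \<iota>" and M: "\<forall>i\<in>I. M i \<in> supported_in W" by blast+
  show "S \<in> supported_in W"
    using support_coproduct[OF I C] coproductD(1)[OF C] M unfolding supported_in_def by blast
qed

lemma Phi_subset_iff: "S \<subseteq> Obj K \<Longrightarrow> Phi \<sigma> S \<subseteq> W \<longleftrightarrow> S \<subseteq> supported_in W"
  unfolding Phi_def supported_in_def by blast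

text \<open>The largest ideal of compact objects whose \<Phi> lies in \<open>W\<close>; it turns out
  to invert \<Phi> on specialization closed sets.\<close>

definition ideal_of :: "'x set \<Rightarrow> 'o set" where
  "ideal_of W = {C. compact_object \<kappa> K C} \<inter> ideal_core (supported_in W)"

lemma ideal_of_ThickId: "ideal_of W \<in> ThickId Kc"
  unfolding ThickId_compact_iff
proof (intro conjI)
  note L = supported_in_localizing[of W]
  have "thick_subcategory K (\<Inter>{{C. compact_object \<kappa> K C}, ideal_core (supported_in W)})"
    by (rule thick_Inter) (use compact_thick localizing_thick[OF ideal_core_localizing[OF L]] in auto)
  then show "thick_subcategory K (ideal_of W)" unfolding ideal_of_def by simp
  show "\<forall>A\<in>ideal_of W. compact_object \<kappa> K A" unfolding ideal_of_def by blast
  show "\<forall>A\<in>ideal_of W. \<forall>M. compact_object \<kappa> K M \<longrightarrow> M \<boxtimes> A \<in> ideal_of W \<and> A \<boxtimes> M \<in> ideal_of W"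
    using ideal_core_ThickId[OF L] compact_tensor compactD(1) unfolding ideal_of_def ThickId_iff by blast
qed

lemma ThickId_obj: "I \<in> ThickId Kc \<Longrightarrow> I \<subseteq> Obj K"
  using ThickId_compactD(2) compactD(1) by blast

text \<open>An ideal of compact objects supported in \<open>W\<close> lies in the core
  automatically, which makes \<Phi> and \<open>ideal_of\<close> a Galois connection.\<close>

lemma Phi_ThickId_iff:
  assumes I: "I \<in> ThickId Kc"
  shows "Phi \<sigma> I \<subseteq> W \<longleftrightarrow> I \<subseteq> ideal_of W"
proof -
  note L = supported_in_localizing[of W]
  have "I \<subseteq> supported_in W \<longleftrightarrow> I \<subseteq> ideal_core (supported_in W)"
    using compact_ideal_in_core[OF I L] ideal_core_subset[OF L] by blast
  then show ?thesis
    using Phi_subset_iff[OF ThickId_obj[OF I]] ThickId_compactD(2)[OF I] unfolding ideal_of_def by blast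
qed

abbreviation supp :: "'o \<Rightarrow> 'x set" where
  "supp A \<equiv> Phi \<sigma> (generated_ideal Kc {A})"

lemma principal_ThickId: "compact_object \<kappa> K A \<Longrightarrow> generated_ideal Kc {A} \<in> ThickId Kc"
  using generated_ideal_ThickId by simp

lemma principal_subset_iff: "I \<in> ThickId Kc \<Longrightarrow> generated_ideal Kc {A} \<subseteq> I \<longleftrightarrow> A \<in> I"
  using generated_ideal_subset[of "{A}" Kc] generated_ideal_least[of I Kc "{A}"] by blast

lemma supp_subset_iff:
  assumes "compact_object \<kappa> K A"
  shows "supp A \<subseteq> W \<longleftrightarrow> A \<in> ideal_of W"
  using Phi_ThickId_iff[OF principal_ThickId[OF assms]] principal_subset_iff[OF ideal_of_ThickId] by blast

lemma Phi_eq_Union_supp: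
  assumes "I \<in> ThickId Kc"
  shows "Phi \<sigma> I = (\<Union>A\<in>I. supp A)"
proof
  have "\<sigma> A \<subseteq> supp A" for A unfolding Phi_def using generated_ideal_subset[of "{A}" Kc] by blast
  then show "Phi \<sigma> I \<subseteq> (\<Union>A\<in>I. supp A)" unfolding Phi_def[of \<sigma> I] by blast
  have "supp A \<subseteq> Phi \<sigma> I" if "A \<in> I" for A
    by (rule Phi_mono) (use principal_subset_iff[OF assms] that in blast)
  then show "(\<Union>A\<in>I. supp A) \<subseteq> Phi \<sigma> I" by blast
qed

text \<open>Objects supported in \<open>Phi \<sigma> I\<close> form a localizing subcategory
  containing \<open>I\<close>, so the extended ideal acquires no new support. This carries the
  tensor axiom from ideals of \<open>K\<close> to ideals of compact objects.\<close>

lemma Phi_extension: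
  assumes I: "I \<in> ThickId Kc"
  shows "Phi \<sigma> (generated_ideal K I) = Phi \<sigma> I"
proof
  have "I \<subseteq> supported_in (Phi \<sigma> I)" using Phi_subset_iff[OF ThickId_obj[OF I]] by blast
  then have "generated_ideal K I \<subseteq> supported_in (Phi \<sigma> I)"
    by (rule generated_ideal_localizing[OF I supported_in_localizing])
  then show "Phi \<sigma> (generated_ideal K I) \<subseteq> Phi \<sigma> I" unfolding Phi_def supported_in_def by blast
  show "Phi \<sigma> I \<subseteq> Phi \<sigma> (generated_ideal K I)" by (rule Phi_mono[OF generated_ideal_subset])
qed

lemma tensor_set_compact: "tensor_set Kc I J = tensor_set K I J"
  unfolding tensor_set_def by simp

lemma tensor_set_subset:
  assumes I: "I \<in> ThickId Kc" and J: "J \<in> ThickId Kc"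
  shows "tensor_set Kc I J \<subseteq> I" "tensor_set Kc I J \<subseteq> J" "tensor_set Kc I J \<subseteq> Obj Kc"
proof -
  have "A \<boxtimes> B \<in> I \<and> A \<boxtimes> B \<in> J" if "A \<in> I" "B \<in> J" for A B
    using ThickId_compactD(4)[OF I that(1) ThickId_compactD(2)[OF J that(2)]]
      ThickId_compactD(3)[OF J that(2) ThickId_compactD(2)[OF I that(1)]] by blast
  then show 1: "tensor_set Kc I J \<subseteq> I" "tensor_set Kc I J \<subseteq> J"
    by (auto simp: tensor_set_compact tensor_set_def)
  then show "tensor_set Kc I J \<subseteq> Obj Kc" using ThickId_compactD(2)[OF I] unfolding compact_part_Obj by blast
qed

text \<open>One inclusion is monotonicity. For the other, the products of the extended ideals stay
  in the localizing subcategory of objects supported in \<open>?V\<close>, and the tensor axiom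
  evaluates their support.\<close>

lemma Phi_tensor:
  assumes I: "I \<in> ThickId Kc" and J: "J \<in> ThickId Kc"
  shows "Phi \<sigma> (generated_ideal Kc (tensor_set Kc I J)) = Phi \<sigma> I \<inter> Phi \<sigma> J"
proof
  have "generated_ideal Kc (tensor_set Kc I J) \<subseteq> I" "generated_ideal Kc (tensor_set Kc I J) \<subseteq> J"
    using generated_ideal_least[OF I tensor_set_subset(1)[OF I J]]
      generated_ideal_least[OF J tensor_set_subset(2)[OF I J]] .
  then show "Phi \<sigma> (generated_ideal Kc (tensor_set Kc I J)) \<subseteq> Phi \<sigma> I \<inter> Phi \<sigma> J"
    by (intro Int_greatest Phi_mono)
  let ?V = "Phi \<sigma> (generated_ideal Kc (tensor_set Kc I J))"
  have T: "generated_ideal Kc (tensor_set Kc I J) \<in> ThickId Kc"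
    by (rule generated_ideal_ThickId[OF tensor_set_subset(3)[OF I J]])
  have "generated_ideal Kc (tensor_set Kc I J) \<subseteq> supported_in ?V"
    using Phi_subset_iff[OF ThickId_obj[OF T]] by blast
  then have "tensor_set K I J \<subseteq> supported_in ?V"
    using generated_ideal_subset[of "tensor_set Kc I J" Kc] unfolding tensor_set_compact by blast
  then have "tensor_set K (generated_ideal K I) (generated_ideal K J) \<subseteq> supported_in ?V"
    by (rule generated_ideal_tensor[OF I J supported_in_localizing])
  then have "Phi \<sigma> (tensor_set K (generated_ideal K I) (generated_ideal K J)) \<subseteq> ?V"
    unfolding Phi_def[of _ "tensor_set K _ _"] supported_in_def by blast
  then show "Phi \<sigma> I \<inter> Phi \<sigma> J \<subseteq> ?V"
    using support_tensor[OF generated_ideal_ambient_ThickId[OF ThickId_obj[OF I]]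
        generated_ideal_ambient_ThickId[OF ThickId_obj[OF J]]]
    unfolding Phi_extension[OF I] Phi_extension[OF J] by blast
qed

end

locale faithful_supported_mtc = supported_mtc K \<kappa> X \<sigma>
  for K :: "('o, 'm) mtcat" (structure) and \<kappa> :: "'u rel" and X :: "'x topology" and \<sigma> :: "'o \<Rightarrow> 'x set" +
  assumes zariski: "Zariski_space X"
    and closed: "\<forall>C \<in> Obj Kc. closedin X (supp C)"
    and faithful: "\<forall>M \<in> Obj K. Phi \<sigma> (generated_ideal K {M}) = {} \<longleftrightarrow> zero_object K M"
    and realize: "\<forall>W. closedin X W \<longrightarrow> (\<exists>M \<in> Obj Kc. supp M = W)"
begin

lemma realizeE:
  assumes "closedin X W"
  obtains M where "compact_object \<kappa> K M" "M \<in> Obj Kc" "supp M = W"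
proof -
  obtain M where M: "M \<in> Obj Kc" "supp M = W"
    using realize[rule_format, OF assms] by (rule bexE)
  then have "compact_object \<kappa> K M" by simp
  then show ?thesis using M by (rule that)
qed

theorem Phi_order_reflecting:
  assumes I: "I \<in> ThickId Kc" and J: "J \<in> ThickId Kc" and IJ: "Phi \<sigma> I \<subseteq> Phi \<sigma> J"
  shows "I \<subseteq> J"
proof
  fix N assume N: "N \<in> I"
  interpret J: compact_thick_subcategory K \<kappa> J
    by unfold_locales (use ThickId_compactD[OF J] in auto)
  have Nc: "compact_object \<kappa> K N" using ThickId_compactD(2)[OF I N] .
  obtain T L \<pi> q h where tri: "distinguished K T N L \<pi> q h"
    and T: "\<forall>\<L>. localizing \<kappa> K \<L> \<and> J \<subseteq> \<L> \<longrightarrow> T \<in> \<L>"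
    and o: "\<forall>C\<in>J. \<forall>f \<in> Hom K C L. f = Null K C L"
    and z: "compact_object \<kappa> K N \<and> zero_object K L \<longrightarrow> N \<in> J"
    by (rule J.bousfield[OF compactD(1)[OF Nc]])
  have Lo: "L \<in> Obj K" using triangleD[OF tri] by blast
  let ?W = "Phi \<sigma> J"
  \<comment> \<open>Working in the core makes the bound hold for every object of the ideal generated
    by \<open>L\<close>, which is what faithfulness refers to.\<close>
  let ?C = "ideal_core (supported_in ?W)"
  have C: "localizing \<kappa> K ?C" by (rule ideal_core_localizing[OF supported_in_localizing])
  have "J \<subseteq> ?C" "N \<in> ?C"
    using Phi_ThickId_iff[OF I, of ?W] Phi_ThickId_iff[OF J, of ?W] IJ N unfolding ideal_of_def by blast+
  then have "L \<in> ?C" using T C thick_subcategoryD(3)[OF localizing_thick[OF C] tri] by blast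
  then have "generated_ideal K {L} \<subseteq> ?C" using generated_ideal_core[OF supported_in_localizing] by blast
  then have "generated_ideal K {L} \<subseteq> supported_in ?W" using ideal_core_subset[OF supported_in_localizing] by blast
  then have sub: "Phi \<sigma> (generated_ideal K {L}) \<subseteq> ?W" unfolding Phi_def[of _ "generated_ideal K _"] supported_in_def by blast
  have "\<sigma> M = {}" if "M \<in> tensor_set K (generated_ideal K J) (generated_ideal K {L})" for M
    using that orthogonal_ideals[OF J Lo o] support_zero unfolding tensor_set_def by blast
  then have "Phi \<sigma> (tensor_set K (generated_ideal K J) (generated_ideal K {L})) = {}" unfolding Phi_def by blast
  moreover have "{L} \<subseteq> Obj K" using Lo by blast
  ultimately have "Phi \<sigma> (generated_ideal K J) \<inter> Phi \<sigma> (generated_ideal K {L}) = {}"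
    using support_tensor[OF generated_ideal_ambient_ThickId[OF ThickId_obj[OF J]] generated_ideal_ambient_ThickId] by simp
  then have "Phi \<sigma> (generated_ideal K {L}) = {}" using sub unfolding Phi_extension[OF J] by blast
  then have "zero_object K L" using faithful Lo by blast
  then show "N \<in> J" using z Nc by blast
qed

section \<open>The isomorphism of ordered monoids\<close>

lemma Phi_subset_cancel:
  "I \<in> ThickId Kc \<Longrightarrow> J \<in> ThickId Kc \<Longrightarrow> Phi \<sigma> I \<subseteq> Phi \<sigma> J \<longleftrightarrow> I \<subseteq> J"
  using Phi_order_reflecting[of I J] Phi_mono[of I J \<sigma>] by blast

lemma Phi_inject: "I \<in> ThickId Kc \<Longrightarrow> J \<in> ThickId Kc \<Longrightarrow> Phi \<sigma> I = Phi \<sigma> J \<Longrightarrow> I = J"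
  using Phi_order_reflecting[of I J] Phi_order_reflecting[of J I] by blast

lemma Phi_specialization_closed: "I \<in> ThickId Kc \<Longrightarrow> Phi \<sigma> I \<in> specialization_closed X"
proof -
  assume I: "I \<in> ThickId Kc"
  have "\<forall>W \<in> supp ` I. closedin X W" using closed ThickId_compactD(2)[OF I] by auto
  then show ?thesis unfolding Phi_eq_Union_supp[OF I] by (rule specialization_closed_Un)
qed

text \<open>Each closed piece \<open>V\<close> of \<open>W\<close> is the support of a compact
  object by realization, and such an object belongs to \<open>ideal_of W\<close>.\<close>

lemma Phi_ideal_of:
  assumes "W \<in> specialization_closed X"
  shows "Phi \<sigma> (ideal_of W) = W"
proof
  show "Phi \<sigma> (ideal_of W) \<subseteq> W" using Phi_ThickId_iff[OF ideal_of_ThickId] by blast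
  obtain \<F> where F: "W = \<Union>\<F>" "\<forall>V\<in>\<F>. closedin X V" using assms unfolding specialization_closed_def by blast
  have "V \<subseteq> Phi \<sigma> (ideal_of W)" if "V \<in> \<F>" for V
  proof -
    have "closedin X V" using F(2) that by blast
    then obtain M where M: "compact_object \<kappa> K M" and "M \<in> Obj Kc" and MV: "supp M = V"
      by (rule realizeE)
    then have "M \<in> ideal_of W" using supp_subset_iff[OF M] that F(1) MV by blast
    then show ?thesis using Phi_eq_Union_supp[OF ideal_of_ThickId] MV by blast
  qed
  then show "W \<subseteq> Phi \<sigma> (ideal_of W)" using F(1) by blast
qed

lemma Phi_Obj: "Phi \<sigma> (Obj Kc) = topspace X"
proof
  show "Phi \<sigma> (Obj Kc) \<subseteq> topspace X"
    unfolding Phi_def using support_subset compactD(1) by (auto simp: compact_part_Obj)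
  show "topspace X \<subseteq> Phi \<sigma> (Obj Kc)"
    unfolding Phi_def using support_unit compact_unit by (auto simp: compact_part_Obj)
qed

lemma Phi_ordered_monoid_iso:
  "ordered_monoid_iso (Phi \<sigma>) (ThickId_monoid Kc) (\<subseteq>) (specialization_closed_monoid X) (\<subseteq>)"
proof -
  let ?M = "ThickId_monoid Kc" and ?N = "specialization_closed_monoid X"
  let ?t = "\<lambda>I J. generated_ideal Kc (tensor_set Kc I J)"
  have cM: "carrier ?M = ThickId Kc" "\<And>I J. I \<otimes>\<^bsub>?M\<^esub> J = ?t I J" "\<one>\<^bsub>?M\<^esub> = Obj Kc"
    and cN: "carrier ?N = specialization_closed X" "\<And>V W. V \<otimes>\<^bsub>?N\<^esub> W = V \<inter> W" "\<one>\<^bsub>?N\<^esub> = topspace X"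
    by (simp_all add: ThickId_monoid_def specialization_closed_monoid_def)
  have t: "?t I J \<in> ThickId Kc" if "I \<in> ThickId Kc" "J \<in> ThickId Kc" for I J
    by (rule generated_ideal_ThickId[OF tensor_set_subset(3)[OF that]])
  have top: "Phi \<sigma> I \<subseteq> topspace X" if "I \<in> ThickId Kc" for I
    using specialization_closed_subset[OF Phi_specialization_closed[OF that]] .
  have "Group.monoid ?M"
  proof (rule monoidI; unfold cM)
    show "?t (?t I J) L = ?t I (?t J L)" if "I \<in> ThickId Kc" "J \<in> ThickId Kc" "L \<in> ThickId Kc" for I J L
      by (rule Phi_inject) (use t that in \<open>auto simp: Phi_tensor\<close>)
    show "?t (Obj Kc) I = I" if "I \<in> ThickId Kc" for I
      by (rule Phi_inject[OF t[OF Obj_ThickId that] that])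
        (use top[OF that] in \<open>simp add: Phi_tensor[OF Obj_ThickId that] Phi_Obj inf_absorb2\<close>)
    show "?t I (Obj Kc) = I" if "I \<in> ThickId Kc" for I
      by (rule Phi_inject[OF t[OF that Obj_ThickId] that])
        (use top[OF that] in \<open>simp add: Phi_tensor[OF that Obj_ThickId] Phi_Obj inf_absorb1\<close>)
  qed (use t Obj_ThickId in auto)
  moreover have "?t I L \<subseteq> ?t J L \<and> ?t L I \<subseteq> ?t L J"
    if "I \<in> ThickId Kc" "J \<in> ThickId Kc" "L \<in> ThickId Kc" "I \<subseteq> J" for I J L
  proof -
    have "Phi \<sigma> (?t I L) \<subseteq> Phi \<sigma> (?t J L)" "Phi \<sigma> (?t L I) \<subseteq> Phi \<sigma> (?t L J)"
      unfolding Phi_tensor[OF that(1,3)] Phi_tensor[OF that(2,3)] Phi_tensor[OF that(3,1)]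
        Phi_tensor[OF that(3,2)] using Phi_mono[OF that(4), of \<sigma>] by blast+
    then show ?thesis
      using Phi_order_reflecting[OF t[OF that(1,3)] t[OF that(2,3)]]
        Phi_order_reflecting[OF t[OF that(3,1)] t[OF that(3,2)]] by blast
  qed
  ultimately have M: "ordered_monoid ?M (\<subseteq>)"
    unfolding ordered_monoid_def cM
    by (auto simp: partial_order_on_def preorder_on_def refl_on_def trans_def antisym_def)
  have tX: "topspace X \<in> specialization_closed X" using specialization_closed_Un[of "{topspace X}" X] by simp
  have "Group.monoid ?N"
    by (rule monoidI; unfold cN)
      (simp_all add: tX specialization_closed_Int specialization_closed_subset inf_assoc inf_absorb1 inf_absorb2)
  then have N: "ordered_monoid ?N (\<subseteq>)"
    unfolding ordered_monoid_def cN
    by (auto simp: partial_order_on_def preorder_on_def refl_on_def trans_def antisym_def)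
  have "Phi \<sigma> ` ThickId Kc = specialization_closed X"
  proof
    show "Phi \<sigma> ` ThickId Kc \<subseteq> specialization_closed X" using Phi_specialization_closed by blast
    show "specialization_closed X \<subseteq> Phi \<sigma> ` ThickId Kc"
    proof
      fix W assume "W \<in> specialization_closed X"
      then have "W = Phi \<sigma> (ideal_of W)" by (rule Phi_ideal_of[symmetric])
      then show "W \<in> Phi \<sigma> ` ThickId Kc" using ideal_of_ThickId by (rule image_eqI)
    qed
  qed
  then have "Phi \<sigma> \<in> iso ?M ?N"
    unfolding iso_def hom_def bij_betw_def inj_on_def cM cN
    using Phi_inject Phi_tensor Phi_specialization_closed by auto
  then show ?thesis
    unfolding ordered_monoid_iso_def cM cN using M N Phi_Obj Phi_subset_cancel by blast
qed

subsection \<open>The comparison with the spectrum\<close>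

definition point_ideal :: "'x \<Rightarrow> 'o set" where
  "point_ideal x = {A \<in> Obj Kc. x \<notin> supp A}"

text \<open>Missing \<open>x\<close> means being supported in the complement of \<open>x\<close>, so
  thickness and the comparison with \<Phi> are inherited from \<open>ideal_of\<close>.\<close>

lemma point_ideal_eq: "point_ideal x = ideal_of (- {x})"
proof -
  have "x \<notin> supp A \<longleftrightarrow> A \<in> ideal_of (- {x})" if "compact_object \<kappa> K A" for A
    using supp_subset_iff[OF that, of "- {x}"] by blast
  moreover have "ideal_of (- {x}) \<subseteq> {C. compact_object \<kappa> K C}" unfolding ideal_of_def by blast
  ultimately show ?thesis unfolding point_ideal_def compact_part_Obj by blast
qed

lemma subset_point_ideal_iff: "I \<in> ThickId Kc \<Longrightarrow> I \<subseteq> point_ideal x \<longleftrightarrow> x \<notin> Phi \<sigma> I"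
  unfolding point_ideal_eq using Phi_ThickId_iff[of I "- {x}"] by blast

text \<open>A product of ideals corresponds to an intersection of supports, and a point outside an
  intersection is outside one of the two sets.\<close>

lemma point_ideal_prime:
  assumes x: "x \<in> topspace X"
  shows "prime_ideal Kc (point_ideal x)"
  unfolding prime_ideal_def
proof (intro conjI ballI impI)
  show "thick_ideal Kc (point_ideal x)"
    using ideal_of_ThickId unfolding point_ideal_eq ThickId_def by blast
  have "\<not> Obj Kc \<subseteq> point_ideal x" using subset_point_ideal_iff[OF Obj_ThickId] Phi_Obj x by blast
  then show "point_ideal x \<noteq> Obj Kc" by blast
  fix I J assume I: "I \<in> ThickId Kc" and J: "J \<in> ThickId Kc" and "tensor_set Kc I J \<subseteq> point_ideal x"
  then have "generated_ideal Kc (tensor_set Kc I J) \<subseteq> point_ideal x"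
    using generated_ideal_least ideal_of_ThickId unfolding point_ideal_eq by blast
  then have "x \<notin> Phi \<sigma> I \<inter> Phi \<sigma> J"
    using subset_point_ideal_iff generated_ideal_ThickId[OF tensor_set_subset(3)[OF I J]] Phi_tensor[OF I J] by blast
  then show "I \<subseteq> point_ideal x \<or> J \<subseteq> point_ideal x"
    using subset_point_ideal_iff I J by blast
qed

lemma point_ideal_inj: "inj_on point_ideal (topspace X)"
proof (rule inj_onI)
  fix x y assume x: "x \<in> topspace X" and y: "y \<in> topspace X" and eq: "point_ideal x = point_ideal y"
  \<comment> \<open>The closure of \<open>v\<close> is realized as the support of a compact
    \<open>M\<close>; membership of \<open>M\<close> in a point ideal then tests whether the point
    lies in this closure.\<close>
  have mem: "u \<in> X closure_of {v}" if uv: "u \<in> topspace X" "v \<in> topspace X" "point_ideal u = point_ideal v" for u v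
  proof -
    obtain M where "compact_object \<kappa> K M" and M: "M \<in> Obj Kc" "supp M = X closure_of {v}"
      by (rule realizeE[OF closedin_closure_of])
    have "v \<in> X closure_of {v}" using closure_of_subset[of "{v}" X] uv by blast
    then have "M \<notin> point_ideal v" using M unfolding point_ideal_def by blast
    then have "M \<notin> point_ideal u" using uv by blast
    then show ?thesis using M unfolding point_ideal_def by blast
  qed
  have "X closure_of {x} = X closure_of {y}"
  proof (rule subset_antisym)
    show "X closure_of {x} \<subseteq> X closure_of {y}"
      by (rule closure_of_minimal) (use mem[OF x y eq] in simp_all)
    show "X closure_of {y} \<subseteq> X closure_of {x}"
      by (rule closure_of_minimal) (use mem[OF y x eq[symmetric]] in simp_all)
  qed
  moreover have "irreducible_closedin X (X closure_of {x})"
    unfolding irreducible_closedin_def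
  proof (intro conjI allI impI)
    have m: "x \<in> X closure_of {x}" using closure_of_subset[of "{x}" X] x by blast
    then show "X closure_of {x} \<noteq> {}" by blast
    fix A B assume AB: "closedin X A \<and> closedin X B \<and> X closure_of {x} = A \<union> B"
    then have "x \<in> A \<or> x \<in> B" using m by blast
    then have "X closure_of {x} \<subseteq> A \<or> X closure_of {x} \<subseteq> B"
      using closure_of_minimal[of "{x}" A X] closure_of_minimal[of "{x}" B X] AB by blast
    then show "X closure_of {x} = A \<or> X closure_of {x} = B" using AB by blast
  qed simp
  ultimately show "x = y" using zariski x y unfolding Zariski_space_def by metis
qed

lemma point_ideal_surj:
  assumes P: "prime_ideal Kc P"
  obtains x where "x \<in> topspace X" "point_ideal x = P"
proof -
  have PT: "P \<in> ThickId Kc" and ne: "P \<noteq> Obj Kc"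
    and pr: "\<And>I J. I \<in> ThickId Kc \<Longrightarrow> J \<in> ThickId Kc \<Longrightarrow> tensor_set Kc I J \<subseteq> P \<Longrightarrow> I \<subseteq> P \<or> J \<subseteq> P"
    using P unfolding prime_ideal_def ThickId_def by blast+
  let ?W = "Phi \<sigma> P"
  have "P \<subseteq> Obj Kc" using ThickId_compactD(2)[OF PT] unfolding compact_part_Obj by blast
  then have "\<not> Obj Kc \<subseteq> P" using ne by blast
  then have "\<not> topspace X \<subseteq> ?W" using Phi_order_reflecting[OF Obj_ThickId PT] Phi_Obj by blast
  then obtain Z where Z: "closedin X Z" "\<not> Z \<subseteq> ?W"
    and min: "\<And>Z'. closedin X Z' \<Longrightarrow> Z' \<subset> Z \<Longrightarrow> \<not> \<not> Z' \<subseteq> ?W"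
    using Noetherian_minimal[of X "topspace X" "\<lambda>Z. \<not> Z \<subseteq> ?W"] zariski unfolding Zariski_space_def by blast
  \<comment> \<open>By minimality proper closed subsets of \<open>Z\<close> lie in
    \<open>?W\<close>, hence so would a union of two of them; and \<open>Z\<close> is nonempty
    because it is not contained in \<open>?W\<close>.\<close>
  have "irreducible_closedin X Z"
    unfolding irreducible_closedin_def using Z min by blast
  then obtain x where x: "x \<in> topspace X" "X closure_of {x} = Z"
    using zariski unfolding Zariski_space_def by blast
  have xZ: "x \<in> Z" using closure_of_subset[of "{x}" X] x by blast
  \<comment> \<open>Supports of compact objects are closed, so one that contains the generic point
    contains all of \<open>Z\<close>.\<close>
  have xW: "x \<notin> ?W"
  proof
    assume "x \<in> ?W"
    then obtain A where A: "A \<in> P" "x \<in> supp A" using Phi_eq_Union_supp[OF PT] by blast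
    have "closedin X (supp A)" using closed \<open>P \<subseteq> Obj Kc\<close> A(1) by blast
    then have "Z \<subseteq> supp A" using closure_of_minimal[of "{x}" "supp A" X] A(2) x(2) by blast
    then show False using Phi_eq_Union_supp[OF PT] A(1) Z(2) by blast
  qed
  have "point_ideal x \<subseteq> P"
  proof
    fix A assume "A \<in> point_ideal x"
    then have A: "A \<in> Obj Kc" "x \<notin> supp A" unfolding point_ideal_def by blast+
    \<comment> \<open>Realizing \<open>Z\<close> by \<open>M\<close> turns the inclusion of
      \<open>Z \<inter> supp A\<close> in \<open>?W\<close> into a product of ideals inside
      \<open>P\<close>; since \<open>M\<close> is not in \<open>P\<close>, primality puts
      \<open>A\<close> there.\<close>
    obtain M where "compact_object \<kappa> K M" and M: "M \<in> Obj Kc" "supp M = Z" by (rule realizeE[OF Z(1)])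
    have IA: "generated_ideal Kc {A} \<in> ThickId Kc" and IM: "generated_ideal Kc {M} \<in> ThickId Kc"
      using principal_ThickId A(1) M(1) by auto
    let ?T = "generated_ideal Kc (tensor_set Kc (generated_ideal Kc {M}) (generated_ideal Kc {A}))"
    have "Phi \<sigma> ?T = Z \<inter> supp A" using Phi_tensor[OF IM IA] M(2) by simp
    moreover have "closedin X (Z \<inter> supp A)" using closedin_Int Z(1) closed A(1) by blast
    then have "Z \<inter> supp A \<subseteq> ?W" using min xZ A(2) by blast
    ultimately have "?T \<subseteq> P"
      using Phi_order_reflecting[OF generated_ideal_ThickId[OF tensor_set_subset(3)[OF IM IA]] PT] by simp
    then have "generated_ideal Kc {M} \<subseteq> P \<or> generated_ideal Kc {A} \<subseteq> P"
      by (rule pr[OF IM IA subset_trans[OF generated_ideal_subset]])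
    then show "A \<in> P" using Phi_mono[of "generated_ideal Kc {M}" P \<sigma>] M(2) Z(2) principal_subset_iff[OF PT] by blast
  qed
  moreover have "P \<subseteq> point_ideal x" using subset_point_ideal_iff[OF PT] xW by blast
  ultimately show ?thesis using that x(1) by blast
qed

lemma point_ideal_image: "point_ideal ` topspace X = {P. prime_ideal Kc P}"
proof
  show "point_ideal ` topspace X \<subseteq> {P. prime_ideal Kc P}" using point_ideal_prime by blast
  show "{P. prime_ideal Kc P} \<subseteq> point_ideal ` topspace X"
  proof
    fix P assume "P \<in> {P. prime_ideal Kc P}"
    then obtain x where "x \<in> topspace X" "point_ideal x = P" using point_ideal_surj[of P] by blast
    then show "P \<in> point_ideal ` topspace X" by blast
  qed
qed

text \<open>A point ideal avoids \<open>A\<close> exactly when the point lies in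
  \<open>supp A\<close>, so \<open>V_closed\<close> matches intersections of supports.\<close>

lemma V_closed_point_ideal:
  assumes "S \<subseteq> Obj Kc"
  shows "V_closed Kc S = point_ideal ` {x \<in> topspace X. \<forall>A\<in>S. x \<in> supp A}"
proof -
  have "point_ideal x \<inter> S = {} \<longleftrightarrow> (\<forall>A\<in>S. x \<in> supp A)" for x
    using assms unfolding point_ideal_def by blast
  moreover have "V_closed Kc S = {P \<in> {P. prime_ideal Kc P}. P \<inter> S = {}}"
    unfolding V_closed_def by simp
  then have "V_closed Kc S = point_ideal ` {x \<in> topspace X. point_ideal x \<inter> S = {}}"
    unfolding point_ideal_image[symmetric] by auto
  ultimately show ?thesis by simp
qed

text \<open>Closedness of the supports makes every spectral closed set come from a closed set of
  \<open>X\<close>; conversely, realization yields each closed set of \<open>X\<close> as the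
  support of a single object.\<close>

lemma Spc_open_iff:
  "(\<exists>S\<subseteq>Obj Kc. U = {P. prime_ideal Kc P} - V_closed Kc S) \<longleftrightarrow> (\<exists>G. openin X G \<and> U = point_ideal ` G)"
proof
  assume "\<exists>S\<subseteq>Obj Kc. U = {P. prime_ideal Kc P} - V_closed Kc S"
  then obtain S where S: "S \<subseteq> Obj Kc" "U = {P. prime_ideal Kc P} - V_closed Kc S" by blast
  let ?F = "{x \<in> topspace X. \<forall>A\<in>S. x \<in> supp A}"
  have "?F = \<Inter>(insert (topspace X) (supp ` S))" by auto
  moreover have "closedin X \<dots>" by (rule closedin_Inter) (use closed S(1) in auto)
  ultimately have "openin X (topspace X - ?F)" by (simp add: openin_diff)
  moreover have "U = point_ideal ` (topspace X - ?F)"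
    unfolding S(2) point_ideal_image[symmetric] V_closed_point_ideal[OF S(1)]
    by (rule inj_on_image_set_diff[OF point_ideal_inj, symmetric]) auto
  ultimately show "\<exists>G. openin X G \<and> U = point_ideal ` G" by blast
next
  assume "\<exists>G. openin X G \<and> U = point_ideal ` G"
  then obtain G where G: "openin X G" "U = point_ideal ` G" by blast
  have "closedin X (topspace X - G)" using G(1) by blast
  then obtain M where "compact_object \<kappa> K M" and M: "M \<in> Obj Kc" "supp M = topspace X - G" by (rule realizeE)
  have sub: "G \<subseteq> topspace X" using G(1) openin_subset by blast
  have "V_closed Kc {M} = point_ideal ` (topspace X - G)"
    using V_closed_point_ideal[of "{M}"] M by (auto intro!: arg_cong[of _ _ "\<lambda>A. point_ideal ` A"])
  then have "{P. prime_ideal Kc P} - V_closed Kc {M} = point_ideal ` (topspace X - (topspace X - G))"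
    unfolding point_ideal_image[symmetric]
    using inj_on_image_set_diff[OF point_ideal_inj, of "topspace X" "topspace X - G"] by auto
  also have "topspace X - (topspace X - G) = G" using sub by blast
  finally show "\<exists>S\<subseteq>Obj Kc. U = {P. prime_ideal Kc P} - V_closed Kc S" using G(2) M(1) by blast
qed

text \<open>\<open>Spc\<close> is defined through \<open>topology\<close>, which is informative only
  once the family of sets is known to be a topology. This is inherited from \<open>X\<close> along
  \<open>point_ideal\<close>, whose injectivity is used for intersections.\<close>

lemma openin_Spc: "openin (Spc Kc) U \<longleftrightarrow> (\<exists>G. openin X G \<and> U = point_ideal ` G)"
proof -
  let ?R = "\<lambda>U. \<exists>G. openin X G \<and> U = point_ideal ` G"
  have "istopology ?R"
    unfolding istopology_def
  proof (intro conjI allI impI)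
    fix U V assume "?R U" "?R V"
    then obtain G H where G: "openin X G" "U = point_ideal ` G" and H: "openin X H" "V = point_ideal ` H" by blast
    have "U \<inter> V = point_ideal ` (G \<inter> H)"
      unfolding G(2) H(2) using inj_on_image_Int[OF point_ideal_inj] G(1) H(1) openin_subset by metis
    then show "?R (U \<inter> V)" using G H by blast
  next
    fix \<U> assume "\<forall>U\<in>\<U>. ?R U"
    then obtain g where g: "\<And>U. U \<in> \<U> \<Longrightarrow> openin X (g U) \<and> U = point_ideal ` g U" by metis
    then have "\<Union>\<U> = point_ideal ` (\<Union>(g ` \<U>))" by blast
    moreover have "openin X (\<Union>(g ` \<U>))" using g by blast
    ultimately show "?R (\<Union>\<U>)" by blast
  qed
  then show ?thesis unfolding Spc_def Spc_open_iff by (simp add: topology_inverse')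
qed

lemma point_ideal_homeomorphic: "homeomorphic_map X (Spc Kc) point_ideal"
proof -
  have ts: "topspace (Spc Kc) = point_ideal ` topspace X"
  proof
    have "openin (Spc Kc) (topspace (Spc Kc))" by simp
    then obtain G where G: "openin X G" "topspace (Spc Kc) = point_ideal ` G" unfolding openin_Spc by blast
    show "topspace (Spc Kc) \<subseteq> point_ideal ` topspace X"
      unfolding G(2) by (rule image_mono[OF openin_subset[OF G(1)]])
    have "openin (Spc Kc) (point_ideal ` topspace X)" unfolding openin_Spc using openin_topspace by blast
    then show "point_ideal ` topspace X \<subseteq> topspace (Spc Kc)" by (rule openin_subset)
  qed
  show ?thesis
  proof (rule bijective_open_imp_homeomorphic_map)
    show "continuous_map X (Spc Kc) point_ideal"
      unfolding continuous_map_def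
    proof (intro conjI allI impI)
      fix U assume "openin (Spc Kc) U"
      then obtain G where G: "openin X G" "U = point_ideal ` G" unfolding openin_Spc by blast
      have "{x \<in> topspace X. point_ideal x \<in> U} = G"
        unfolding G(2) using openin_subset[OF G(1)] point_ideal_inj unfolding inj_on_def by blast
      then show "openin X {x \<in> topspace X. point_ideal x \<in> U}" using G(1) by simp
    qed (use ts in auto)
    show "open_map X (Spc Kc) point_ideal" unfolding open_map_def openin_Spc by blast
  qed (use ts point_ideal_inj in auto)
qed

end

theorem theorem1p4p1:
  fixes K :: "('o, 'm) mtcat" and \<kappa> :: "'u rel"
    and X :: "'x topology" and \<sigma> :: "'o \<Rightarrow> 'x set"
  assumes "compactly_generated_mtc K \<kappa>"
    and "Zariski_space X"
    and "extended_weak_support_datum \<kappa> K X \<sigma>"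
    and support_closed: "\<forall>C \<in> Obj (compact_part \<kappa> K).
        closedin X (Phi \<sigma> (generated_ideal (compact_part \<kappa> K) {C}))"
    and faithfulness: "\<forall>M \<in> Obj K.
        Phi \<sigma> (generated_ideal K {M}) = {} \<longleftrightarrow> zero_object K M"
    and realization: "\<forall>W. closedin X W \<longrightarrow>
        (\<exists>M \<in> Obj (compact_part \<kappa> K).
           Phi \<sigma> (generated_ideal (compact_part \<kappa> K) {M}) = W)"
  shows "ordered_monoid_iso (Phi \<sigma>)
           (ThickId_monoid (compact_part \<kappa> K)) (\<subseteq>) (specialization_closed_monoid X) (\<subseteq>) \<and>
         homeomorphic_map X (Spc (compact_part \<kappa> K))
           (\<lambda>x. {A \<in> Obj (compact_part \<kappa> K).
                  x \<notin> Phi \<sigma> (generated_ideal (compact_part \<kappa> K) {A})})"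
proof -
  interpret compactly_generated_mtc K \<kappa> by (rule assms(1))
  interpret extended_weak_support_datum \<kappa> K X \<sigma> by (rule assms(3))
  interpret faithful_supported_mtc K \<kappa> X \<sigma>
    by unfold_locales (rule assms)+
  show ?thesis using Phi_ordered_monoid_iso point_ideal_homeomorphic unfolding point_ideal_def by blast
qed

end
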